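(* Let $s,t\in\mathbb{N}_0$ and $i,j\in\{0,1\}$. Then, as $\mathfrak{u}(\mathfrak{m})$-modules, $$\Omega^s(V_i)\otimes\Omega^t(V_j)\simeq\begin{cases}\Omega^{s+t}(V_{i+j})\oplus P(st,st),&\text{if } s+i \text{ and } t+j \text{ are even},\\ \Omega^{s+t}(V_{i+j})\oplus P(0,s(2t+1)),&\text{if } s+i\text{ is even and } t+j\text{ is odd},\\ \Omega^{s+t}(V_{i+j})\oplus P(0,(2s+1)t),&\text{if } s+i\text{ is odd and } t+j\text{ is even},\\ \Omega^{s+t}(V_{i+j})\oplus P(st,(s+1)(t+1)),&\text{if } s+i\text{ and } t+j\text{ are odd}.\end{cases}$$
   Context: $\Bbbk$ is an algebraically closed field of characteristic $2$; $\mathbb{N}_0=\{0,1,2,\dots\}$. $\mathfrak{u}(\mathfrak{m})$ is the unital associative $\Bbbk$-algebra generated by $a,b,c$ with relations $ab+ba=c$, $ac+ca=a$, $bc+cb=b$, $a^4=b^4=0$, $c^2+c=0$; it is a Hopf algebra in which $a,b,c$ are primitive, and tensor products of modules are over $\Bbbk$ with action through the comultiplication. $V_0$ is the trivial one-dimensional module and $V_1$ is the simple module with basis $v_1,v_2,v_3$ and $av_1=v_2$, $av_2=v_3$, $av_3=0$, $bv_1=0$, $bv_2=v_1$, $bv_3=v_2$, $cv_1=v_1$, $cv_2=0$, $cv_3=v_3$. By convention $V_2=V_0$. $P_i$ is the projective cover of $V_i$ and $P(m,n)=mP_0\oplus nP_1$ ($m$ copies of $P_0$ and $n$ copies of $P_1$).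 $\Omega(M)$ is the kernel of a projective cover $P(M)\to M$, $\Omega^0(V_i)=V_i$ and $\Omega^{s+1}=\Omega\Omega^s$. *)

theory Defs
  imports
    "HOL-Library.Poly_Mapping"
    "HOL-Computational_Algebra.Computational_Algebra"
    "Jordan_Normal_Form.Matrix"
begin

section \<open>The algebra\<close>

datatype gen = Ga | Gb | Gc

datatype word = Word (letters: "gen list")

instantiation word :: monoid_add
begin
definition zero_word :: word where "0 = Word []"
definition plus_word :: "word \<Rightarrow> word \<Rightarrow> word" where "u + v = Word (letters u @ letters v)"
instance by standard (auto simp: zero_word_def plus_word_def)
end

text \<open>Finitely supported functions on words, with the convolution product: the free
  associative algebra on three generators.\<close>

type_synonym 'k free_alg = "word \<Rightarrow>\<^sub>0 'k"

definition free_gen :: "gen \<Rightarrow> 'k::field free_alg" where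
  "free_gen g = Poly_Mapping.single (Word [g]) 1"

definition free_const :: "'k \<Rightarrow> 'k::field free_alg" where
  "free_const r = Poly_Mapping.single 0 r"

definition um_relators :: "'k::field free_alg set" where
  "um_relators = (let a = free_gen Ga; b = free_gen Gb; c = free_gen Gc in
     {a * b + b * a - c, a * c + c * a - a, b * c + c * b - b, a ^ 4, b ^ 4, c ^ 2 + c})"

text \<open>The two-sided ideal generated by the relators.\<close>

inductive_set um_ideal :: "'k::field free_alg set" where
  zero: "0 \<in> um_ideal"
| rel: "r \<in> um_relators \<Longrightarrow> x * r * y \<in> um_ideal"
| add: "p \<in> um_ideal \<Longrightarrow> q \<in> um_ideal \<Longrightarrow> p + q \<in> um_ideal"

lemma um_ideal_mult_left: "p \<in> um_ideal \<Longrightarrow> z * p \<in> um_ideal"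
proof (induction rule: um_ideal.induct)
  case (rel r x y)
  then show ?case using um_ideal.rel[of r "z * x" y] by (simp add: mult.assoc)
qed (auto simp: distrib_left intro: um_ideal.intros)

lemma um_ideal_mult_right: "p \<in> um_ideal \<Longrightarrow> p * z \<in> um_ideal"
proof (induction rule: um_ideal.induct)
  case (rel r x y)
  then show ?case using um_ideal.rel[of r x "y * z"] by (simp add: mult.assoc)
qed (auto simp: distrib_right intro: um_ideal.intros)

lemma um_ideal_uminus: "p \<in> um_ideal \<Longrightarrow> - p \<in> um_ideal"
  using um_ideal_mult_left[of p "- 1"] by simp

lemma um_ideal_diff: "p \<in> um_ideal \<Longrightarrow> q \<in> um_ideal \<Longrightarrow> p - q \<in> um_ideal"
  using um_ideal.add[OF _ um_ideal_uminus, of p q] by simp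

definition um_rel :: "'k::field free_alg \<Rightarrow> 'k free_alg \<Rightarrow> bool" where
  "um_rel p q \<longleftrightarrow> p - q \<in> um_ideal"

lemma equivp_um_rel: "equivp um_rel"
proof (rule equivpI)
  show "reflp um_rel" by (auto simp: reflp_def um_rel_def intro: um_ideal.zero)
  show "symp um_rel"
    unfolding symp_def um_rel_def by (metis um_ideal_uminus minus_diff_eq)
  show "transp um_rel"
    unfolding transp_def um_rel_def by (metis um_ideal.add diff_add_cancel add_diff_eq)
qed

quotient_type (overloaded) 'k um = "('k::field) free_alg" / um_rel
  by (rule equivp_um_rel)

lemma um_word_zero_sum: "(u :: word) + v = 0 \<longleftrightarrow> u = 0 \<and> v = 0"
  by (cases u; cases v) (auto simp: zero_word_def plus_word_def)

lemma lookup_times_0: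
  "Poly_Mapping.lookup (p * q) (0::word) = Poly_Mapping.lookup p 0 * Poly_Mapping.lookup (q :: 'k::field free_alg) 0"
proof -
  have "(\<Sum>q'. Poly_Mapping.lookup q q' when 0 = l + q') = (Poly_Mapping.lookup q 0 when l = 0)" for l
  proof (cases "l = 0")
    case True
    have "(\<lambda>q'. Poly_Mapping.lookup q q' when 0 = l + q') = (\<lambda>q'. Poly_Mapping.lookup q q' when 0 = q')"
      using True by simp
    then show ?thesis using True by simp
  next
    case False
    then have "(\<lambda>q'. Poly_Mapping.lookup q q' when 0 = l + q') = (\<lambda>_. 0)"
      using um_word_zero_sum[of l] by (auto simp: when_def fun_eq_iff)
    then show ?thesis using False by (simp only:) simp
  qed
  then show ?thesis by (simp add: lookup_mult mult_when)
qed

lemma um_ideal_lookup_0: "p \<in> um_ideal \<Longrightarrow> Poly_Mapping.lookup (p :: 'k::field free_alg) 0 = 0"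
proof (induction rule: um_ideal.induct)
  case (rel r x y)
  have g: "Poly_Mapping.lookup (free_gen g :: 'k free_alg) 0 = 0" for g
    by (simp add: free_gen_def zero_word_def lookup_single)
  have "Poly_Mapping.lookup r 0 = 0"
    using rel by (auto simp: um_relators_def Let_def lookup_add lookup_minus lookup_times_0 g
        numeral_eq_Suc)
  then show ?case by (simp add: lookup_times_0)
qed (auto simp: lookup_add)

instantiation um :: (field) ring_1
begin
lift_definition zero_um :: "'a um" is 0 .
lift_definition one_um :: "'a um" is 1 .
lift_definition plus_um :: "'a um \<Rightarrow> 'a um \<Rightarrow> 'a um" is "(+)"
  unfolding um_rel_def by (metis add_diff_add um_ideal.add)
lift_definition minus_um :: "'a um \<Rightarrow> 'a um \<Rightarrow> 'a um" is "(-)"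
proof -
  fix p p' q q' :: "'a free_alg"
  assume "um_rel p p'" "um_rel q q'"
  moreover have "p - q - (p' - q') = (p - p') - (q - q')" by simp
  ultimately show "um_rel (p - q) (p' - q')" unfolding um_rel_def by (metis um_ideal_diff)
qed
lift_definition uminus_um :: "'a um \<Rightarrow> 'a um" is uminus
  unfolding um_rel_def using um_ideal_uminus by fastforce
lift_definition times_um :: "'a um \<Rightarrow> 'a um \<Rightarrow> 'a um" is "(*)"
proof -
  fix p p' q q' :: "'a free_alg"
  assume "um_rel p p'" "um_rel q q'"
  moreover have "p * q - p' * q' = (p - p') * q + p' * (q - q')" by (simp add: algebra_simps)
  ultimately show "um_rel (p * q) (p' * q')" unfolding um_rel_def
    by (metis um_ideal.add um_ideal_mult_left um_ideal_mult_right)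
qed
instance
proof
  show "(0 :: 'a um) \<noteq> 1"
  proof (transfer, unfold um_rel_def, rule notI)
    assume "(0 - 1 :: 'a free_alg) \<in> um_ideal"
    from um_ideal_lookup_0[OF this] show False by (simp add: lookup_minus lookup_one)
  qed
qed (transfer; simp add: um_rel_def algebra_simps um_ideal.zero)+
end

text \<open>The image of \<open>um_const\<close> is the central copy of the base field.\<close>

lift_definition um_gen :: "gen \<Rightarrow> 'k::field um" is free_gen .

lift_definition um_const :: "'k \<Rightarrow> 'k::field um" is free_const .


section \<open>Modules\<close>

text \<open>A finite-dimensional left module is given in coordinates: the underlying space is
  \<open>k^n\<close> (column vectors) and the algebra acts by square matrices. Every finite-dimensional
  module is isomorphic to one of this form.\<close>

record (overloaded) 'k umod =
  mdim :: nat
  mact :: "('k::field) um \<Rightarrow> 'k mat"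

definition is_umod :: "'k::field umod \<Rightarrow> bool" where
  "is_umod M \<longleftrightarrow>
     (\<forall>x. mact M x \<in> carrier_mat (mdim M) (mdim M)) \<and>
     mact M 1 = 1\<^sub>m (mdim M) \<and>
     (\<forall>x y. mact M (x * y) = mact M x * mact M y) \<and>
     (\<forall>x y. mact M (x + y) = mact M x + mact M y) \<and>
     (\<forall>r x. mact M (um_const r * x) = r \<cdot>\<^sub>m mact M x)"

definition umod_hom :: "'k::field umod \<Rightarrow> 'k umod \<Rightarrow> 'k mat \<Rightarrow> bool" where
  "umod_hom M N f \<longleftrightarrow> f \<in> carrier_mat (mdim N) (mdim M) \<and>
     (\<forall>x. f * mact M x = mact N x * f)"

definition umod_iso :: "'k::field umod \<Rightarrow> 'k umod \<Rightarrow> bool" (infix "\<cong>\<^sub>u" 50) where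
  "M \<cong>\<^sub>u N \<longleftrightarrow> is_umod M \<and> is_umod N \<and>
     (\<exists>f g. umod_hom M N f \<and> umod_hom N M g \<and> g * f = 1\<^sub>m (mdim M) \<and> f * g = 1\<^sub>m (mdim N))"

definition ker_umod :: "'k::field umod \<Rightarrow> 'k mat \<Rightarrow> 'k vec set" where
  "ker_umod M f = {v \<in> carrier_vec (mdim M). f *\<^sub>v v = 0\<^sub>v (dim_row f)}"

definition range_umod :: "'k::field umod \<Rightarrow> 'k mat \<Rightarrow> 'k vec set" where
  "range_umod M f = (\<lambda>v. f *\<^sub>v v) ` carrier_vec (mdim M)"

definition umod_surj :: "'k::field umod \<Rightarrow> 'k umod \<Rightarrow> 'k mat \<Rightarrow> bool" where
  "umod_surj M N f \<longleftrightarrow> umod_hom M N f \<and> range_umod M f = carrier_vec (mdim N)"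

definition umod_inj :: "'k::field umod \<Rightarrow> 'k umod \<Rightarrow> 'k mat \<Rightarrow> bool" where
  "umod_inj M N f \<longleftrightarrow> umod_hom M N f \<and> inj_on (\<lambda>v. f *\<^sub>v v) (carrier_vec (mdim M))"

text \<open>Closure under scalars is the case \<open>x = um_const r\<close>.\<close>

definition is_submod :: "'k::field umod \<Rightarrow> 'k vec set \<Rightarrow> bool" where
  "is_submod M W \<longleftrightarrow> W \<subseteq> carrier_vec (mdim M) \<and> 0\<^sub>v (mdim M) \<in> W \<and>
     (\<forall>v\<in>W. \<forall>w\<in>W. v + w \<in> W) \<and> (\<forall>x. \<forall>v\<in>W. mact M x *\<^sub>v v \<in> W)"

definition is_superfluous :: "'k::field umod \<Rightarrow> 'k vec set \<Rightarrow> bool" where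
  "is_superfluous M K \<longleftrightarrow> is_submod M K \<and>
     (\<forall>W. is_submod M W \<and> {w + u |w u. w \<in> W \<and> u \<in> K} = carrier_vec (mdim M)
        \<longrightarrow> W = carrier_vec (mdim M))"

definition is_projective :: "'k::field umod \<Rightarrow> bool" where
  "is_projective P \<longleftrightarrow> is_umod P \<and>
     (\<forall>M N g f. is_umod M \<and> is_umod N \<and> umod_surj M N g \<and> umod_hom P N f
        \<longrightarrow> (\<exists>h. umod_hom P M h \<and> g * h = f))"

definition is_proj_cover :: "'k::field umod \<Rightarrow> 'k umod \<Rightarrow> 'k mat \<Rightarrow> bool" where
  "is_proj_cover P M p \<longleftrightarrow> is_projective P \<and> is_umod M \<and> umod_surj P M p \<and>
     is_superfluous P (ker_umod P p)"

text \<open>Projective covers, and hence \<open>\<Omega>\<close>, are determined up to isomorphism only; the following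
  pick representatives. The kernel is a module \<open>K\<close> together with an embedding whose image is
  the kernel of the covering map.\<close>

definition proj_cover :: "'k::field umod \<Rightarrow> 'k umod" where
  "proj_cover M = (SOME P. \<exists>p. is_proj_cover P M p)"

definition Omega :: "'k::field umod \<Rightarrow> 'k umod" where
  "Omega M = (SOME K. \<exists>P p e. is_proj_cover P M p \<and> is_umod K \<and>
     umod_inj K P e \<and> range_umod K e = ker_umod P p)"

definition dsum :: "'k::field umod \<Rightarrow> 'k umod \<Rightarrow> 'k umod" (infixr "\<oplus>\<^sub>u" 65) where
  "M \<oplus>\<^sub>u N = \<lparr>mdim = mdim M + mdim N,
     mact = (\<lambda>x. four_block_mat (mact M x) (0\<^sub>m (mdim M) (mdim N))
                               (0\<^sub>m (mdim N) (mdim M)) (mact N x))\<rparr>"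

definition zero_umod :: "'k::field umod" where
  "zero_umod = \<lparr>mdim = 0, mact = (\<lambda>_. 0\<^sub>m 0 0)\<rparr>"

primrec copies :: "nat \<Rightarrow> 'k::field umod \<Rightarrow> 'k umod" where
  "copies 0 M = zero_umod"
| "copies (Suc n) M = M \<oplus>\<^sub>u copies n M"

section \<open>Modules given by the action of the generators\<close>

definition word_mat :: "nat \<Rightarrow> (gen \<Rightarrow> 'k::field mat) \<Rightarrow> word \<Rightarrow> 'k mat" where
  "word_mat n \<rho> w = foldr (\<lambda>g X. \<rho> g * X) (letters w) (1\<^sub>m n)"

definition free_eval :: "nat \<Rightarrow> (gen \<Rightarrow> 'k::field mat) \<Rightarrow> 'k free_alg \<Rightarrow> 'k mat" where
  "free_eval n \<rho> p = mat n n (\<lambda>ij. \<Sum>w\<in>Poly_Mapping.keys p. Poly_Mapping.lookup p w * word_mat n \<rho> w $$ ij)"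

text \<open>The module \<open>k^n\<close> on which the generators act by the given matrices. It is meaningful
  when these matrices satisfy the defining relations, since then the choice of the
  representative \<open>rep_um x\<close> does not matter; see \<open>is_umod_umod_of\<close> below.\<close>

definition umod_of :: "nat \<Rightarrow> (gen \<Rightarrow> 'k::field mat) \<Rightarrow> 'k umod" where
  "umod_of n \<rho> = \<lparr>mdim = n, mact = (\<lambda>x. free_eval n \<rho> (rep_um x))\<rparr>"

lemma rep_um_abs_um: "um_rel (rep_um (abs_um p)) p"
  using Quotient3_rep_abs[OF Quotient3_um] equivp_reflp[OF equivp_um_rel] by blast

lemma word_mat_carrier:
  assumes "\<And>g. \<rho> g \<in> carrier_mat n n"
  shows "word_mat n \<rho> w \<in> carrier_mat n n"
proof -
  have "foldr (\<lambda>g X. \<rho> g * X) gs (1\<^sub>m n) \<in> carrier_mat n n" for gs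
    by (induction gs) (auto intro: mult_carrier_mat assms)
  then show ?thesis by (simp add: word_mat_def)
qed

lemma word_mat_add:
  assumes "\<And>g. \<rho> g \<in> carrier_mat n n"
  shows "word_mat n \<rho> (u + v) = word_mat n \<rho> u * word_mat n \<rho> v"
proof -
  define E where "E = (\<lambda>gs. foldr (\<lambda>g X. \<rho> g * X) gs (1\<^sub>m n))"
  have c: "E gs \<in> carrier_mat n n" for gs
    unfolding E_def by (induction gs) (auto intro: mult_carrier_mat assms)
  have "E (gs @ hs) = E gs * E hs" for gs hs
  proof (induction gs)
    case Nil
    then show ?case using c[of hs] by (simp add: E_def)
  next
    case (Cons g gs)
    then show ?case using assoc_mult_mat[OF assms[of g] c[of gs] c[of hs]] by (simp add: E_def)
  qed
  then show ?thesis by (simp add: word_mat_def plus_word_def E_def)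
qed

lemma free_eval_carrier [simp]: "free_eval n \<rho> p \<in> carrier_mat n n"
  by (simp add: free_eval_def)

lemma free_eval_superset:
  assumes "finite A" "Poly_Mapping.keys p \<subseteq> A"
  shows "free_eval n \<rho> p =
    mat n n (\<lambda>ij. \<Sum>w\<in>A. Poly_Mapping.lookup p w * word_mat n \<rho> w $$ ij)"
  unfolding free_eval_def
  by (intro eq_matI) (auto intro!: sum.mono_neutral_left assms simp: in_keys_iff)

lemma free_eval_zero: "free_eval n \<rho> 0 = 0\<^sub>m n n"
  by (intro eq_matI) (auto simp: free_eval_def)

lemma free_eval_add: "free_eval n \<rho> (p + q) = free_eval n \<rho> p + free_eval n \<rho> q"
proof -
  define A where "A = Poly_Mapping.keys p \<union> Poly_Mapping.keys q"
  have A: "finite A" "Poly_Mapping.keys p \<subseteq> A" "Poly_Mapping.keys q \<subseteq> A"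
    "Poly_Mapping.keys (p + q) \<subseteq> A"
    using Poly_Mapping.keys_add[of p q] by (auto simp: A_def)
  show ?thesis
    using A by (intro eq_matI)
      (auto simp: free_eval_superset[of A] lookup_add distrib_right sum.distrib)
qed

lemma free_eval_single:
  assumes "\<And>g. \<rho> g \<in> carrier_mat n n"
  shows "free_eval n \<rho> (Poly_Mapping.single w r) = r \<cdot>\<^sub>m word_mat n \<rho> w"
proof -
  have "word_mat n \<rho> w \<in> carrier_mat n n" by (rule word_mat_carrier) (rule assms)
  then show ?thesis
    by (intro eq_matI) (auto simp: free_eval_superset[of "{w}"])
qed

lemma free_alg_induct [case_names zero single add]:
  fixes p :: "'k::field free_alg"
  assumes "Q 0" "\<And>w r. Q (Poly_Mapping.single w r)" "\<And>p q. Q p \<Longrightarrow> Q q \<Longrightarrow> Q (p + q)"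
  shows "Q p"
proof (induction p rule: update_induct)
  case const
  then show ?case by (rule assms)
next
  case (update f a b)
  have "Poly_Mapping.update a b f = f + Poly_Mapping.single a b"
    using update by (intro poly_mapping_eqI)
      (auto simp: lookup_update lookup_add lookup_single when_def in_keys_iff)
  then show ?case using assms update by simp
qed

lemma free_eval_mult:
  assumes \<rho>: "\<And>g. \<rho> g \<in> carrier_mat n n"
  shows "free_eval n \<rho> (p * q) = free_eval n \<rho> p * free_eval n \<rho> q"
proof (induction p rule: free_alg_induct)
  case zero
  show ?case
    using left_mult_zero_mat[OF free_eval_carrier[of n \<rho> q], of n] by (simp add: free_eval_zero)
next
  case (add p p')
  then show ?case
    using add_mult_distrib_mat[of "free_eval n \<rho> p" n n "free_eval n \<rho> p'" "free_eval n \<rho> q" n]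
    by (simp add: distrib_right free_eval_add)
next
  case (single u r)
  show ?case
  proof (induction q rule: free_alg_induct)
    case zero
    show ?case using right_mult_zero_mat[OF free_eval_carrier, of n \<rho> _ n]
      by (simp add: free_eval_zero)
  next
    case (add q q')
    then show ?case
      using mult_add_distrib_mat[of "free_eval n \<rho> (Poly_Mapping.single u r)" n n
          "free_eval n \<rho> q" n "free_eval n \<rho> q'"]
      by (simp add: distrib_left free_eval_add)
  next
    case (single v r')
    have c: "word_mat n \<rho> w \<in> carrier_mat n n" for w by (rule word_mat_carrier) (rule \<rho>)
    have "(r \<cdot>\<^sub>m word_mat n \<rho> u) * (r' \<cdot>\<^sub>m word_mat n \<rho> v)
        = (r * r') \<cdot>\<^sub>m (word_mat n \<rho> u * word_mat n \<rho> v)"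
      using c[of u] c[of v]
      by (intro eq_matI) (auto simp: scalar_prod_def sum_distrib_left ac_simps)
    then show ?case
      by (simp add: mult_single free_eval_single[OF \<rho>] word_mat_add[OF \<rho>])
  qed
qed

lemma
  fixes \<rho> :: "gen \<Rightarrow> 'k::field mat"
  assumes \<rho>: "\<And>g. \<rho> g \<in> carrier_mat n n"
    and rels:
      "\<rho> Ga * \<rho> Gb + \<rho> Gb * \<rho> Ga = \<rho> Gc"
      "\<rho> Ga * \<rho> Gc + \<rho> Gc * \<rho> Ga = \<rho> Ga"
      "\<rho> Gb * \<rho> Gc + \<rho> Gc * \<rho> Gb = \<rho> Gb"
      "\<rho> Ga * (\<rho> Ga * (\<rho> Ga * \<rho> Ga)) = 0\<^sub>m n n"
      "\<rho> Gb * (\<rho> Gb * (\<rho> Gb * \<rho> Gb)) = 0\<^sub>m n n"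
      "\<rho> Gc * \<rho> Gc + \<rho> Gc = 0\<^sub>m n n"
  shows is_umod_umod_of: "is_umod (umod_of n \<rho>)"
    and mact_umod_of_gen: "mact (umod_of n \<rho>) (um_gen g) = \<rho> g"
proof -
  let ?e = "free_eval n \<rho>"
  have gen: "?e (free_gen g) = \<rho> g" for g
  proof -
    have "word_mat n \<rho> (Word [g]) = \<rho> g"
      using \<rho>[of g] by (simp add: word_mat_def)
    then show ?thesis using \<rho>[of g]
      by (simp add: free_gen_def free_eval_single[OF \<rho>]) (auto intro!: eq_matI)
  qed
  have const: "?e (free_const r) = r \<cdot>\<^sub>m 1\<^sub>m n" for r
    by (simp add: free_const_def free_eval_single[OF \<rho>]) (simp add: word_mat_def zero_word_def)
  have one: "?e 1 = 1\<^sub>m n"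
    using const[of 1] by (simp add: free_const_def) (auto intro!: eq_matI)
  have minus: "?e (p - q) = ?e p - ?e q" for p q
  proof -
    have "?e p = ?e (p - q) + ?e q" by (simp flip: free_eval_add)
    moreover have "A + B - B = A" if "A \<in> carrier_mat n n" "B \<in> carrier_mat n n" for A B :: "'k mat"
      using that by (intro eq_matI) auto
    ultimately show ?thesis by simp
  qed
  have relator: "?e r = 0\<^sub>m n n" if "r \<in> um_relators" for r
    using that rels \<rho>
    by (auto simp: um_relators_def Let_def free_eval_add minus free_eval_mult[OF \<rho>] gen
        numeral_eq_Suc one)
  have ideal: "?e p = 0\<^sub>m n n" if "p \<in> um_ideal" for p
    using that
  proof (induction rule: um_ideal.induct)
    case (rel r x y)
    then show ?case
      using right_mult_zero_mat[of "?e x" n n n] left_mult_zero_mat[of "?e y" n n n]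
      by (simp add: free_eval_mult[OF \<rho>] relator)
  qed (simp_all add: free_eval_zero free_eval_add)
  have wd: "?e p = ?e q" if "um_rel p q" for p q
  proof -
    have "?e p = ?e (p - q) + ?e q" by (simp flip: free_eval_add)
    then show ?thesis using that by (simp add: um_rel_def ideal)
  qed
  have act: "mact (umod_of n \<rho>) (abs_um p) = ?e p" for p
    by (simp add: umod_of_def wd[OF rep_um_abs_um])
  show "mact (umod_of n \<rho>) (um_gen g) = \<rho> g"
    by (simp add: um_gen.abs_eq act gen)
  have ex: "\<exists>p. x = abs_um p" for x :: "'k um"
    by (metis Quotient3_abs_rep[OF Quotient3_um])
  show "is_umod (umod_of n \<rho>)"
    unfolding is_umod_def
  proof (intro conjI allI)
    fix x y :: "'k um" and r :: 'k
    obtain p q where [simp]: "x = abs_um p" "y = abs_um q" using ex by metis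
    show "mact (umod_of n \<rho>) x \<in> carrier_mat (mdim (umod_of n \<rho>)) (mdim (umod_of n \<rho>))"
      by (simp add: umod_of_def)
    show "mact (umod_of n \<rho>) 1 = 1\<^sub>m (mdim (umod_of n \<rho>))"
      by (simp add: one_um.abs_eq act one) (simp add: umod_of_def)
    show "mact (umod_of n \<rho>) (x * y) = mact (umod_of n \<rho>) x * mact (umod_of n \<rho>) y"
      by (simp add: times_um.abs_eq act free_eval_mult[OF \<rho>])
    show "mact (umod_of n \<rho>) (x + y) = mact (umod_of n \<rho>) x + mact (umod_of n \<rho>) y"
      by (simp add: plus_um.abs_eq act free_eval_add)
    have "(r \<cdot>\<^sub>m 1\<^sub>m n) * ?e p = r \<cdot>\<^sub>m ?e p"
      using mult_smult_assoc_mat[of "1\<^sub>m n" n n "?e p" n r]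
        left_mult_one_mat[of "?e p" n n] by simp
    then show "mact (umod_of n \<rho>) (um_const r * x) = r \<cdot>\<^sub>m mact (umod_of n \<rho>) x"
      by (simp add: times_um.abs_eq um_const.abs_eq act free_eval_mult[OF \<rho>] const)
  qed
qed

definition kron :: "'k::field mat \<Rightarrow> 'k mat \<Rightarrow> 'k mat" where
  "kron A B = mat (dim_row A * dim_row B) (dim_col A * dim_col B)
     (\<lambda>(i, j). A $$ (i div dim_row B, j div dim_col B) * B $$ (i mod dim_row B, j mod dim_col B))"

text \<open>The basis vector \<open>e_i \<otimes> f_j\<close> of the tensor product has index \<open>i * mdim N + j\<close>. Since the
  generators are primitive, the comultiplication is the algebra map with
  \<open>g \<mapsto> g \<otimes> 1 + 1 \<otimes> g\<close> for each generator \<open>g\<close>.\<close>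

definition tensor :: "'k::field umod \<Rightarrow> 'k umod \<Rightarrow> 'k umod" (infixr "\<otimes>\<^sub>u" 70) where
  "M \<otimes>\<^sub>u N = umod_of (mdim M * mdim N) (\<lambda>g.
     kron (mact M (um_gen g)) (1\<^sub>m (mdim N)) + kron (1\<^sub>m (mdim M)) (mact N (um_gen g)))"

section \<open>The simple modules\<close>

text \<open>Columns are the images of the basis vectors.\<close>

fun V1_gen :: "gen \<Rightarrow> 'k::field mat" where
  "V1_gen Ga = mat_of_rows_list 3 [[0, 0, 0], [1, 0, 0], [0, 1, 0]]"
| "V1_gen Gb = mat_of_rows_list 3 [[0, 1, 0], [0, 0, 1], [0, 0, 0]]"
| "V1_gen Gc = mat_of_rows_list 3 [[1, 0, 0], [0, 0, 0], [0, 0, 1]]"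

text \<open>\<open>V_mod 0\<close> is the trivial module (the counit annihilates the primitive generators), and
  \<open>V_mod 2 = V_mod 0\<close> by convention; larger indices are not used.\<close>

definition V_mod :: "nat \<Rightarrow> 'k::field umod" where
  "V_mod i = (if i = 1 then umod_of 3 V1_gen else umod_of 1 (\<lambda>_. 0\<^sub>m 1 1))"

definition P_mod :: "nat \<Rightarrow> nat \<Rightarrow> 'k::field umod" where
  "P_mod m n = copies m (proj_cover (V_mod 0)) \<oplus>\<^sub>u copies n (proj_cover (V_mod 1))"

lemma is_umod_V_mod:
  assumes "CHAR('k::field) = 2"
  shows "is_umod (V_mod i :: 'k umod)"
proof -
  have two: "x + x = 0" for x :: 'k
    by (metis assms mult_2 of_nat_CHAR of_nat_numeral mult_zero_left)
  note [simp] = mat_of_rows_list_def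
  have c: "V1_gen g \<in> carrier_mat 3 3" for g
    by (cases g) auto
  have *: "A = B" if "A \<in> carrier_mat 3 3" "B \<in> carrier_mat 3 3"
     "\<And>i j. i \<in> {0,1,2} \<Longrightarrow> j \<in> {0,1,2} \<Longrightarrow> A $$ (i,j) = B $$ (i,j)" for A B :: "'k mat"
    using that by (intro eq_matI) (auto simp: less_Suc_eq numeral_eq_Suc)
  have "is_umod (umod_of 3 V1_gen :: 'k umod)"
    by (rule is_umod_umod_of[OF c]; rule *; auto simp: scalar_prod_def numeral_3_eq_3 two)
  moreover have "is_umod (umod_of 1 (\<lambda>_. 0\<^sub>m 1 1) :: 'k umod)"
    by (rule is_umod_umod_of) auto
  ultimately show ?thesis by (simp add: V_mod_def)
qed

end

theory Submission
  imports Defs "Jordan_Normal_Form.Determinant"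
begin

text \<open>The syzygies are modelled by preprojective modules of the Kronecker quiver: \<open>KK s d\<close> has head
  \<open>(s + 1) V_d\<close> and socle \<open>s V_e\<close>, \<open>e \<noteq> d\<close>, and a projective cover by \<open>(s + 1) P_d\<close> with kernel
  \<open>KK (s + 1) e\<close>. Tensoring this sequence with a syzygy \<open>X\<close> and comparing it by Schanuel's lemma with the
  minimal cover of \<open>KK s d \<otimes> X\<close>, known by induction, determines \<open>KK (s + 1) e \<otimes> X\<close> up to projective
  summands that occur on both sides; these cancel because the endomorphism rings of \<open>P_0\<close> and \<open>P_1\<close> are local.
  The middle term \<open>P_d \<otimes> X\<close> splits along the layers of \<open>X\<close>, so that the multiplicities reduce to
  \<open>P_0 \<otimes> V_1 = 3 P_1\<close> and \<open>P_1 \<otimes> V_1 = P_0 \<oplus> 2 P_1\<close>, and the induction starts from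
  \<open>V_1 \<otimes> V_1 = V_0 \<oplus> P_1\<close>. These three isomorphisms are explicit matrices over the prime field.\<close>

text \<open>A syzygy lies in the radical of a projective module. Each \<open>P d\<close> has Loewy
  length three with two copies of the other simple module in its middle, so a syzygy has Loewy
  length at most two and is described by two matrices, one for each basis vector of the extension
  space: a representation of the Kronecker quiver. With n simple modules in its head and m below,
  its cover has 2n in the middle, of which m survive; the next syzygy thus has 2n - m in its head
  and n below. From (1, 0) this gives (s + 1, s). The two projective modules come from the
  idempotent \<open>1 + c\<close>: there \<open>x^2\<close>, where \<open>x = a b\<close>, acts as
  an idempotent and splits \<open>1 + c\<close> into two idempotents z. Homomorphisms from
  \<open>P d\<close> to a module correspond to vectors of the form z m, which gives both the
  projectivity of \<open>P d\<close> and its endomorphism ring. The obstacle is that covers and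
  syzygies are arbitrary choices. They are replaced by the models once, through the uniqueness of
  projective covers.\<close>

section \<open>Matrices\<close>

text \<open>The carrier-set laws of the matrix library do not work well as rewrite rules, because the
  dimensions do not occur in the left-hand sides. These variants have computable side conditions.\<close>

lemma mat_assoc: "dim_col A = dim_row B \<Longrightarrow> dim_col B = dim_row C \<Longrightarrow> (A * B) * C = A * (B * C)"
  for A :: "'a::comm_ring_1 mat"
  by (rule assoc_mult_mat) (auto intro: carrier_matI)

lemma mat_distrib_right: "dim_row A = dim_row B \<Longrightarrow> dim_col A = dim_col B \<Longrightarrow> dim_col B = dim_row C \<Longrightarrow>
    (A + B) * C = A * C + B * C"
  for A :: "'a::comm_ring_1 mat"
  by (rule add_mult_distrib_mat) (auto intro: carrier_matI)

lemma mat_distrib_left: "dim_row B = dim_row C \<Longrightarrow> dim_col B = dim_col C \<Longrightarrow> dim_col A = dim_row C \<Longrightarrow>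
    A * (B + C) = A * B + A * C"
  for A :: "'a::comm_ring_1 mat"
  by (rule mult_add_distrib_mat) (auto intro: carrier_matI)

lemma mat_add_assoc: "dim_row A = dim_row B \<Longrightarrow> dim_col A = dim_col B \<Longrightarrow>
    dim_row B = dim_row C \<Longrightarrow> dim_col B = dim_col C \<Longrightarrow> (A + B) + C = A + (B + C)"
  for A :: "'a::comm_ring_1 mat"
  by (rule assoc_add_mat) (auto intro: carrier_matI)

lemma mat_add_comm: "dim_row A = dim_row B \<Longrightarrow> dim_col A = dim_col B \<Longrightarrow> A + B = B + A"
  for A :: "'a::comm_ring_1 mat"
  by (rule comm_add_mat) (auto intro: carrier_matI)

lemma mat_add_left_comm: "dim_row A = dim_row B \<Longrightarrow> dim_col A = dim_col B \<Longrightarrow>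
    dim_row B = dim_row C \<Longrightarrow> dim_col B = dim_col C \<Longrightarrow> A + (B + C) = B + (A + C)"
  for A :: "'a::comm_ring_1 mat"
  by (metis mat_add_assoc mat_add_comm)

lemma mat_one_left: "dim_row A = n \<Longrightarrow> 1\<^sub>m n * A = A" for A :: "'a::comm_ring_1 mat"
  by (rule left_mult_one_mat) auto

lemma mat_one_right: "dim_col A = n \<Longrightarrow> A * 1\<^sub>m n = A" for A :: "'a::comm_ring_1 mat"
  by (rule right_mult_one_mat) auto

lemma mat_zero_left: "dim_row A = m \<Longrightarrow> 0\<^sub>m n m * A = 0\<^sub>m n (dim_col A)" for A :: "'a::comm_ring_1 mat"
  by (rule left_mult_zero_mat) auto

lemma mat_zero_right: "dim_col A = m \<Longrightarrow> A * 0\<^sub>m m n = 0\<^sub>m (dim_row A) n" for A :: "'a::comm_ring_1 mat"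
  by (rule right_mult_zero_mat) auto

lemma mat_add_zero_left: "dim_row A = n \<Longrightarrow> dim_col A = m \<Longrightarrow> 0\<^sub>m n m + A = A" for A :: "'a::comm_ring_1 mat"
  by (rule left_add_zero_mat) auto

lemma mat_add_zero_right: "dim_row A = n \<Longrightarrow> dim_col A = m \<Longrightarrow> A + 0\<^sub>m n m = A" for A :: "'a::comm_ring_1 mat"
  by (rule right_add_zero_mat) auto

lemmas mat_ring = mat_assoc mat_distrib_right mat_distrib_left mat_add_assoc mat_one_left
  mat_one_right mat_zero_left mat_zero_right mat_add_zero_left mat_add_zero_right

lemmas mat_ac = mat_add_comm mat_add_left_comm

text \<open>Products are normalised to the right, where the left-hand side of an equation
  \<open>A * B = C\<close> no longer occurs as a subterm. This form applies such an equation inside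
  a longer product.\<close>

lemma mat_reassoc:
  fixes A :: "'a::comm_ring_1 mat"
  assumes "A * B = C" "dim_col A = dim_row B" "dim_col B = dim_row X"
  shows "A * (B * X) = C * X"
  using assms mat_assoc by metis

subsection \<open>Kronecker products\<close>

lemma dim_kron [simp]:
  "dim_row (kron A B) = dim_row A * dim_row B" "dim_col (kron A B) = dim_col A * dim_col B"
  by (auto simp: kron_def)

lemma index_kron [simp]:
  "i < dim_row A * dim_row B \<Longrightarrow> j < dim_col A * dim_col B \<Longrightarrow>
   kron A B $$ (i, j) = A $$ (i div dim_row B, j div dim_col B) * B $$ (i mod dim_row B, j mod dim_col B)"
  by (simp add: kron_def)

lemma div_mod_less:
  fixes i m n :: nat
  assumes "i < m * n"
  shows "i div n < m" "i mod n < n"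
  using assms less_mult_imp_div_less[of i m n] 
  by (auto simp: mod_less_divisor gr0_conv_Suc) (metis mod_less_divisor mult_0_right not_gr_zero not_less0)

lemma sum_div_mod:
  fixes f :: "nat \<Rightarrow> nat \<Rightarrow> 'a::comm_monoid_add"
  shows "(\<Sum>k<p * q. f (k div q) (k mod q)) = (\<Sum>i<p. \<Sum>j<q. f i j)"
proof -
  have "(\<Sum>k<p * q. f (k div q) (k mod q)) = (\<Sum>m<p. \<Sum>k=m*q..<m*q+q. f (k div q) (k mod q))"
    by (rule sum.nat_group[symmetric])
  also have "\<dots> = (\<Sum>i<p. \<Sum>j<q. f i j)"
  proof (rule sum.cong[OF refl])
    fix m
    have "(\<Sum>k=m*q..<m*q+q. f (k div q) (k mod q)) = (\<Sum>k=0..<q. f ((k + m*q) div q) ((k + m*q) mod q))"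
      using sum.shift_bounds_nat_ivl[of "\<lambda>k. f (k div q) (k mod q)" 0 "m*q" q] by (simp add: add.commute)
    also have "\<dots> = (\<Sum>j<q. f m j)"
      by (auto simp: atLeast0LessThan intro!: sum.cong)
    finally show "(\<Sum>k=m*q..<m*q+q. f (k div q) (k mod q)) = (\<Sum>j<q. f m j)" .
  qed
  finally show ?thesis .
qed

lemma kron_mult:
  fixes A :: "'a::field mat"
  assumes "dim_col A = dim_row C" "dim_col B = dim_row D"
  shows "kron A B * kron C D = kron (A * C) (B * D)"
proof (rule eq_matI)
  fix i j
  assume ij: "i < dim_row (kron (A * C) (B * D))" "j < dim_col (kron (A * C) (B * D))"
  then have ij': "i < dim_row A * dim_row B" "j < dim_col C * dim_col D" by simp_all
  note dm = div_mod_less[OF ij'(1)] div_mod_less[OF ij'(2)]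
  let ?f = "\<lambda>k l. (A $$ (i div dim_row B, k) * C $$ (k, j div dim_col D)) *
      (B $$ (i mod dim_row B, l) * D $$ (l, j mod dim_col D))"
  have "(kron A B * kron C D) $$ (i, j) = (\<Sum>k<dim_row C * dim_row D. ?f (k div dim_row D) (k mod dim_row D))"
    using ij' assms by (auto simp: scalar_prod_def atLeast0LessThan ac_simps intro!: sum.cong)
  also have "\<dots> = (\<Sum>k<dim_row C. \<Sum>l<dim_row D. ?f k l)" by (rule sum_div_mod)
  also have "\<dots> = kron (A * C) (B * D) $$ (i, j)"
    using ij' dm assms by (auto simp: scalar_prod_def atLeast0LessThan sum_product)
  finally show "(kron A B * kron C D) $$ (i, j) = kron (A * C) (B * D) $$ (i, j)" .
qed auto

lemma kron_add_left:
  "dim_row A = dim_row B \<Longrightarrow> dim_col A = dim_col B \<Longrightarrow> kron (A + B) C = kron A C + kron B C"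
  by (rule eq_matI) (auto simp: div_mod_less distrib_right)

lemma kron_add_right:
  "dim_row B = dim_row C \<Longrightarrow> dim_col B = dim_col C \<Longrightarrow> kron A (B + C) = kron A B + kron A C"
  by (rule eq_matI) (auto simp: div_mod_less distrib_left)

lemma kron_one: "kron (1\<^sub>m n) (1\<^sub>m m) = 1\<^sub>m (n * m)"
  by (rule eq_matI) (auto simp: div_mod_less, metis div_mod_decomp)

lemma kron_zero_left: "kron (0\<^sub>m n m) A = 0\<^sub>m (n * dim_row A) (m * dim_col A)"
  by (rule eq_matI) (auto simp: div_mod_less)

lemma kron_zero_right: "kron A (0\<^sub>m n m) = 0\<^sub>m (dim_row A * n) (dim_col A * m)"
  by (rule eq_matI) (auto simp: div_mod_less)

lemma kron_one_one_left: "kron (1\<^sub>m 1) A = A"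
  by (rule eq_matI) (auto simp: div_mod_less)

text \<open>The permutation matrix of the flip: with the index convention of \<open>tensor\<close>
  it takes the basis vector with index \<open>p * m + q\<close> to the one with index
  \<open>q * n + p\<close>.\<close>

definition kron_flip :: "nat \<Rightarrow> nat \<Rightarrow> 'k::field mat" where
  "kron_flip n m = mat (m * n) (n * m) (\<lambda>(i, j). if i div n = j mod m \<and> i mod n = j div m then 1 else 0)"

lemma kron_flip:
  assumes A: "A \<in> carrier_mat n n" and B: "B \<in> carrier_mat m m"
  shows "kron_flip n m * kron A B = kron B A * kron_flip n m"
proof (rule eq_matI)
  fix i j
  assume "i < dim_row (kron B A * kron_flip n m)" "j < dim_col (kron B A * kron_flip n m)"
  then have ij: "i < m * n" "j < n * m" using A B by (auto simp: kron_flip_def)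
  note dm = div_mod_less[OF ij(1)] div_mod_less[OF ij(2)]
  have "(kron_flip n m * kron A B) $$ (i, j) =
      (\<Sum>k<n * m. (\<lambda>k1 k2. (if i div n = k2 \<and> i mod n = k1 then 1 else 0) *
         (A $$ (k1, j div m) * B $$ (k2, j mod m))) (k div m) (k mod m))"
    using ij A B by (auto simp: kron_flip_def scalar_prod_def atLeast0LessThan intro!: sum.cong)
  also have "\<dots> = (\<Sum>k1<n. \<Sum>k2<m. (if i div n = k2 \<and> i mod n = k1 then 1 else 0) *
         (A $$ (k1, j div m) * B $$ (k2, j mod m)))"
    by (rule sum_div_mod)
  also have "\<dots> = (\<Sum>k1<n. \<Sum>k2<m. if i div n = k2 then if i mod n = k1 then
         A $$ (k1, j div m) * B $$ (k2, j mod m) else 0 else 0)"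
    by (intro sum.cong) auto
  also have "\<dots> = A $$ (i mod n, j div m) * B $$ (i div n, j mod m)"
    using dm by simp
  finally have 1: "(kron_flip n m * kron A B) $$ (i, j) = A $$ (i mod n, j div m) * B $$ (i div n, j mod m)" .
  have "(kron B A * kron_flip n m) $$ (i, j) =
      (\<Sum>k<m * n. (\<lambda>k1 k2. (B $$ (i div n, k1) * A $$ (i mod n, k2)) *
         (if k1 = j mod m \<and> k2 = j div m then 1 else 0)) (k div n) (k mod n))"
    using ij A B by (auto simp: kron_flip_def scalar_prod_def atLeast0LessThan intro!: sum.cong)
  also have "\<dots> = (\<Sum>k1<m. \<Sum>k2<n. (B $$ (i div n, k1) * A $$ (i mod n, k2)) *
         (if k1 = j mod m \<and> k2 = j div m then 1 else 0))"
    by (rule sum_div_mod)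
  also have "\<dots> = (\<Sum>k1<m. \<Sum>k2<n. if k2 = j div m then if k1 = j mod m then
         B $$ (i div n, k1) * A $$ (i mod n, k2) else 0 else 0)"
    by (intro sum.cong) auto
  also have "\<dots> = B $$ (i div n, j mod m) * A $$ (i mod n, j div m)"
    using dm by simp
  finally show "(kron_flip n m * kron A B) $$ (i, j) = (kron B A * kron_flip n m) $$ (i, j)"
    using 1 by (simp add: mult.commute)
qed (use A B in \<open>auto simp: kron_flip_def\<close>)

lemma kron_flip_inverse: "kron_flip m n * kron_flip n m = (1\<^sub>m (n * m) :: 'k::field mat)"
proof (rule eq_matI)
  fix i j
  assume "i < dim_row (1\<^sub>m (n * m) :: 'k mat)" "j < dim_col (1\<^sub>m (n * m) :: 'k mat)"
  then have ij: "i < n * m" "j < n * m" by simp_all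
  note dm = div_mod_less[OF ij(1)] div_mod_less[OF ij(2)]
  have "(kron_flip m n * kron_flip n m) $$ (i, j) =
      (\<Sum>k<m * n. (\<lambda>k1 k2. (if i div m = k2 \<and> i mod m = k1 then 1 else 0) *
         (if k1 = j mod m \<and> k2 = j div m then 1 else 0 :: 'k)) (k div n) (k mod n))"
    using ij by (auto simp: kron_flip_def scalar_prod_def atLeast0LessThan intro!: sum.cong)
  also have "\<dots> = (\<Sum>k1<m. \<Sum>k2<n. (if i div m = k2 \<and> i mod m = k1 then 1 else 0) *
         (if k1 = j mod m \<and> k2 = j div m then 1 else 0))"
    by (rule sum_div_mod)
  also have "\<dots> = (\<Sum>k1<m. \<Sum>k2<n. if k2 = j div m then if k1 = j mod m then
         if i div m = k2 \<and> i mod m = k1 then 1 else 0 else 0 else 0)"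
    by (intro sum.cong) auto
  also have "\<dots> = (if i div m = j div m \<and> i mod m = j mod m then 1 else 0)"
    using dm by simp
  also have "\<dots> = (1\<^sub>m (n * m) :: 'k mat) $$ (i, j)"
    using ij by (auto, metis div_mod_decomp)
  finally show "(kron_flip m n * kron_flip n m) $$ (i, j) = (1\<^sub>m (n * m) :: 'k mat) $$ (i, j)" .
qed (auto simp: kron_flip_def)

subsection \<open>Inclusions and projections of a direct sum\<close>

definition inl :: "nat \<Rightarrow> nat \<Rightarrow> 'k::field mat" where
  "inl n m = mat (n + m) n (\<lambda>(i, j). if i = j then 1 else 0)"
definition inr :: "nat \<Rightarrow> nat \<Rightarrow> 'k::field mat" where
  "inr n m = mat (n + m) m (\<lambda>(i, j). if i = n + j then 1 else 0)"
definition prl :: "nat \<Rightarrow> nat \<Rightarrow> 'k::field mat" where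
  "prl n m = mat n (n + m) (\<lambda>(i, j). if j = i then 1 else 0)"
definition prr :: "nat \<Rightarrow> nat \<Rightarrow> 'k::field mat" where
  "prr n m = mat m (n + m) (\<lambda>(i, j). if j = n + i then 1 else 0)"

lemma dim_inj_proj [simp]:
  "dim_row (inl n m) = n + m" "dim_col (inl n m) = n"
  "dim_row (inr n m) = n + m" "dim_col (inr n m) = m"
  "dim_row (prl n m) = n" "dim_col (prl n m) = n + m"
  "dim_row (prr n m) = m" "dim_col (prr n m) = n + m"
  by (auto simp: inl_def inr_def prl_def prr_def)

lemma sum_eq_single:
  fixes f :: "'b \<Rightarrow> 'a::comm_monoid_add"
  assumes "finite A" "\<And>k. k \<in> A \<Longrightarrow> k \<noteq> a \<Longrightarrow> f k = 0"
  shows "sum f A = (if a \<in> A then f a else 0)"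
proof -
  have "sum f A = (\<Sum>k\<in>A. if k = a then f a else 0)"
    using assms(2) by (intro sum.cong) auto
  then show ?thesis using assms(1) by simp
qed

lemma inj_proj:
  "prl n m * inl n m = (1\<^sub>m n :: 'k::field mat)"
  "prr n m * inr n m = (1\<^sub>m m :: 'k::field mat)"
  "prl n m * inr n m = (0\<^sub>m n m :: 'k::field mat)"
  "prr n m * inl n m = (0\<^sub>m m n :: 'k::field mat)"
proof -
  have 1: "(\<Sum>k = 0..<n + m. (if k = i then 1 else 0) * (if k = j then 1 else 0 :: 'k)) =
      (if i = j \<and> i < n + m then 1 else 0)" for i j
    by (subst sum_eq_single[where a = i]) auto
  show "prl n m * inl n m = (1\<^sub>m n :: 'k mat)" "prr n m * inr n m = (1\<^sub>m m :: 'k mat)"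
    "prl n m * inr n m = (0\<^sub>m n m :: 'k mat)" "prr n m * inl n m = (0\<^sub>m m n :: 'k mat)"
    by (rule eq_matI; simp add: inl_def inr_def prl_def prr_def scalar_prod_def 1)+
qed

lemma inj_proj_sum: "inl n m * prl n m + inr n m * prr n m = (1\<^sub>m (n + m) :: 'k::field mat)"
proof (rule eq_matI)
  fix i j
  assume ij: "i < dim_row (1\<^sub>m (n + m) :: 'k mat)" "j < dim_col (1\<^sub>m (n + m) :: 'k mat)"
  have "(\<Sum>k = 0..<m. (if i = n + k then 1 else 0) * (if j = n + k then 1 else 0)) 
     = (\<Sum>k = 0..<m. if k = i - n then if i = j \<and> n \<le> i then 1 else 0 else (0::'k))"
    by (intro sum.cong) auto
  moreover have "(\<Sum>k = 0..<n. (if i = k then 1 else 0) * (if j = k then 1 else 0)) 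
     = (\<Sum>k = 0..<n. if k = i then if i = j then 1 else 0 else (0::'k))"
    by (intro sum.cong) auto
  ultimately show "(inl n m * prl n m + inr n m * prr n m) $$ (i, j) = (1\<^sub>m (n + m) :: 'k mat) $$ (i, j)"
    using ij by (auto simp: inl_def inr_def prl_def prr_def scalar_prod_def)
qed auto

text \<open>Written through inclusions and projections, block diagonal matrices are multiplied by
  rewriting with \<open>inj_proj\<close>, with no case distinction on indices.\<close>

lemma four_block_diag_eq:
  assumes "A \<in> carrier_mat n n'" "B \<in> carrier_mat m m'"
  shows "four_block_mat A (0\<^sub>m n m') (0\<^sub>m m n') B =
    inl n m * A * prl n' m' + inr n m * B * prr n' (m' :: nat) "
proof -
  have 1: "(inl n m * A) $$ (i, k) = (if i < n then A $$ (i, k) else 0)" if "i < n + m" "k < n'" for i k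
    using that assms by (auto simp: inl_def scalar_prod_def if_distrib[of "\<lambda>x. x * _"] cong: if_cong)
  have 2: "(inr n m * B) $$ (i, k) = (if i < n then 0 else B $$ (i - n, k))" if "i < n + m" "k < m'" for i k
  proof -
    have "(inr n m * B) $$ (i, k) = (\<Sum>l = 0..<m. (if i = n + l then 1 else 0) * B $$ (l, k))"
      using that assms by (auto simp: inr_def scalar_prod_def intro!: sum.cong)
    also have "\<dots> = (if i < n then 0 else B $$ (i - n, k))"
      using that by (subst sum_eq_single[where a = "i - n"]) auto
    finally show ?thesis .
  qed
  have 3: "(X * prl n' m') $$ (i, j) = (if j < n' then X $$ (i, j) else 0)" 
    if "i < dim_row X" "dim_col X = n'" "j < n' + m'" for X :: "'a mat" and i j
    using that by (auto simp: prl_def scalar_prod_def if_distrib[of "\<lambda>x. _ * x"] cong: if_cong)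
  have 4: "(X * prr n' m') $$ (i, j) = (if j < n' then 0 else X $$ (i, j - n'))" 
    if "i < dim_row X" "dim_col X = m'" "j < n' + m'" for X :: "'a mat" and i j
  proof -
    have "(X * prr n' m') $$ (i, j) = (\<Sum>l = 0..<m'. X $$ (i, l) * (if n' + l = j then 1 else 0))"
      using that by (auto simp: prr_def scalar_prod_def intro!: sum.cong)
    also have "\<dots> = (if j < n' then 0 else X $$ (i, j - n'))"
      using that by (subst sum_eq_single[where a = "j - n'"]) auto
    finally show ?thesis .
  qed
  show ?thesis
    by (rule eq_matI) (use assms in \<open>auto simp: 1 2 3 4 simp del: index_mult_mat(1)\<close>)
qed

lemma mat_smult_add:
  fixes A :: "'a::comm_ring_1 mat"
  assumes "dim_row A = dim_row B" "dim_col A = dim_col B"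
  shows "r \<cdot>\<^sub>m (A + B) = r \<cdot>\<^sub>m A + r \<cdot>\<^sub>m B"
  using assms by (intro eq_matI) (auto simp: distrib_left)

lemma mat_smult: 
  fixes A :: "'a::comm_ring_1 mat"
  assumes "dim_col A = dim_row B"
  shows "(r \<cdot>\<^sub>m A) * B = r \<cdot>\<^sub>m (A * B)" "A * (r \<cdot>\<^sub>m B) = r \<cdot>\<^sub>m (A * B)"
  using assms by (simp_all add: mult_smult_assoc_mat[OF carrier_matI[OF refl refl] carrier_matI[OF _ refl]]
    mult_smult_distrib[OF carrier_matI[OF refl refl] carrier_matI[OF _ refl]])

section \<open>Modules and homomorphisms\<close>

lemma um_gen_relation:
  assumes "p - q \<in> um_relators" shows "abs_um p = abs_um q"
proof -
  have "p - q \<in> um_ideal" using um_ideal.rel[OF assms, of 1 1] by simp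
  then show ?thesis by (simp add: um.abs_eq_iff um_rel_def)
qed

lemma um_relations:
  fixes a b c :: "'k::field um"
  defines "a \<equiv> um_gen Ga" and "b \<equiv> um_gen Gb" and "c \<equiv> um_gen Gc"
  shows "a * b + b * a = c" "a * c + c * a = a" "b * c + c * b = b"
    "a * (a * (a * a)) = 0" "b * (b * (b * b)) = 0" "c * c + c = 0"
proof -
  note e = a_def b_def c_def um_gen.abs_eq times_um.abs_eq plus_um.abs_eq zero_um.abs_eq
  note r = um_relators_def Let_def
  show "a * b + b * a = c" "a * c + c * a = a" "b * c + c * b = b"
    unfolding e by (rule um_gen_relation, simp only: r, simp only: insert_iff, simp only: simp_thms)+
  show "a * (a * (a * a)) = 0" "b * (b * (b * b)) = 0"
    unfolding e by (rule um_gen_relation, simp only: r, simp only: insert_iff diff_zero,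
      simp only: power4_eq_xxxx mult.assoc, simp only: simp_thms)+
  show "c * c + c = 0"
    unfolding e by (rule um_gen_relation, simp only: r, simp only: insert_iff diff_zero,
      simp only: power2_eq_square, simp only: simp_thms)
qed

lemma um_const_0: "um_const 0 = (0 :: 'k::field um)"
  by (simp add: um_const.abs_eq zero_um.abs_eq free_const_def)

lemma um_const_1: "um_const 1 = (1 :: 'k::field um)"
  by (simp add: um_const.abs_eq one_um.abs_eq free_const_def)

lemma um_const_add: "um_const (r + s) = um_const r + (um_const s :: 'k::field um)"
  by (simp add: um_const.abs_eq plus_um.abs_eq free_const_def single_add)

text \<open>Every element is a sum of scalar multiples of words, so scalars and generators suffice
  as base cases. This reduces the homomorphism property to the generators.\<close>

lemma um_induct [case_names const gen add mult]:
  fixes x :: "'k::field um"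
  assumes const: "\<And>r. Q (um_const r)" and gen: "\<And>g. Q (um_gen g)"
    and add: "\<And>x y. Q x \<Longrightarrow> Q y \<Longrightarrow> Q (x + y)" and mult: "\<And>x y. Q x \<Longrightarrow> Q y \<Longrightarrow> Q (x * y)"
  shows "Q x"
proof -
  have "Q (abs_um (Poly_Mapping.single (Word gs) 1))" for gs
  proof (induction gs)
    case Nil
    then show ?case using const[of 1] by (simp add: um_const.abs_eq free_const_def zero_word_def)
  next
    case (Cons g gs)
    have "Poly_Mapping.single (Word (g # gs)) (1::'k) = free_gen g * Poly_Mapping.single (Word gs) 1"
      by (simp add: free_gen_def mult_single plus_word_def)
    then show ?case using mult[OF gen Cons] by (simp add: um_gen.abs_eq times_um.abs_eq)
  qed
  then have "Q (abs_um (Poly_Mapping.single w 1))" for w by (cases w) auto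
  from mult[OF const this]
  have single: "Q (abs_um (Poly_Mapping.single w r))" for w r
    by (simp add: um_const.abs_eq times_um.abs_eq free_const_def mult_single)
  have "Q (abs_um p)" for p
  proof (induction p rule: free_alg_induct)
    case zero
    show ?case using const[of 0] by (simp add: um_const.abs_eq free_const_def)
  next
    case (add p q)
    then show ?case using assms(3) by (simp flip: plus_um.abs_eq)
  qed (rule single)
  moreover obtain p where "x = abs_um p" by (metis Quotient3_abs_rep[OF Quotient3_um])
  ultimately show ?thesis by simp
qed

lemma is_umodD:
  assumes "is_umod M"
  shows "mact M x \<in> carrier_mat (mdim M) (mdim M)"
    "dim_row (mact M x) = mdim M" "dim_col (mact M x) = mdim M"
    "mact M 1 = 1\<^sub>m (mdim M)" "mact M (x * y) = mact M x * mact M y"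
    "mact M (x + y) = mact M x + mact M y" 
    "mact M (um_const r) = r \<cdot>\<^sub>m 1\<^sub>m (mdim M)" "mact M 0 = 0\<^sub>m (mdim M) (mdim M)"
proof -
  show c: "mact M x \<in> carrier_mat (mdim M) (mdim M)" for x using assms by (auto simp: is_umod_def)
  then show "dim_row (mact M x) = mdim M" "dim_col (mact M x) = mdim M" by auto
  show "mact M 1 = 1\<^sub>m (mdim M)" "mact M (x * y) = mact M x * mact M y"
    "mact M (x + y) = mact M x + mact M y" using assms by (auto simp: is_umod_def)
  have *: "mact M (um_const r * 1) = r \<cdot>\<^sub>m mact M 1" for r using assms unfolding is_umod_def by blast
  show const: "mact M (um_const r) = r \<cdot>\<^sub>m 1\<^sub>m (mdim M)" for r
    using *[of r] \<open>mact M 1 = _\<close> by (simp only: mult_1_right)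
  show "mact M 0 = 0\<^sub>m (mdim M) (mdim M)" 
    using const[of 0] by (auto simp: um_const_0)
qed

lemmas umod_dims = is_umodD(2,3)

lemma umod_homD:
  assumes "umod_hom M N f"
  shows "dim_row f = mdim N" "dim_col f = mdim M" "f * mact M x = mact N x * f"
    "f \<in> carrier_mat (mdim N) (mdim M)"
  using assms by (auto simp: umod_hom_def)

lemmas umod_hom_dims = umod_homD(1,2)

lemma umod_hom_genI:
  assumes M: "is_umod M" and N: "is_umod N" and f: "f \<in> carrier_mat (mdim N) (mdim M)"
    and gen: "\<And>g. f * mact M (um_gen g) = mact N (um_gen g) * f"
  shows "umod_hom M N f"
proof -
  have fd: "dim_row f = mdim N" "dim_col f = mdim M" using f by auto
  note d = fd umod_dims[OF M] umod_dims[OF N]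
  have "f * mact M x = mact N x * f" for x
  proof (induction x rule: um_induct)
    case (const r)
    show ?case by (simp add: is_umodD[OF M] is_umodD[OF N] d mat_smult mat_ring)
  next
    case (gen g)
    then show ?case by (rule assms)
  next
    case (add x y)
    then show ?case by (simp add: is_umodD[OF M] is_umodD[OF N] mat_ring d)
  next
    case (mult x y)
    have "f * mact M (x * y) = (f * mact M x) * mact M y" by (simp add: is_umodD[OF M] mat_assoc d)
    also have "\<dots> = mact N x * (f * mact M y)" by (simp add: mult mat_assoc d)
    also have "\<dots> = mact N (x * y) * f" by (simp add: mult is_umodD[OF N] mat_assoc d)
    finally show ?case .
  qed
  then show ?thesis using f by (simp add: umod_hom_def)
qed

lemma umod_hom_one: "is_umod M \<Longrightarrow> umod_hom M M (1\<^sub>m (mdim M))"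
  by (simp add: umod_hom_def mat_ring umod_dims)

lemma umod_hom_zero: "is_umod M \<Longrightarrow> is_umod N \<Longrightarrow> umod_hom M N (0\<^sub>m (mdim N) (mdim M))"
  by (simp add: umod_hom_def mat_ring umod_dims)

lemma umod_hom_comp:
  assumes M: "is_umod M" and N: "is_umod N" and L: "is_umod L" and f: "umod_hom M N f" and g: "umod_hom N L g"
  shows "umod_hom M L (g * f)"
  unfolding umod_hom_def
proof (intro conjI allI)
  note d = umod_dims[OF M] umod_dims[OF N] umod_dims[OF L] umod_hom_dims[OF f] umod_hom_dims[OF g]
  show "g * f \<in> carrier_mat (mdim L) (mdim M)" by (auto simp: d intro: carrier_matI)
  fix x
  have "g * f * mact M x = g * (mact N x * f)" using umod_homD(3)[OF f, of x] by (simp add: mat_assoc d)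
  also have "\<dots> = mact L x * (g * f)" 
    using mat_reassoc[OF umod_homD(3)[OF g], of x f] by (simp add: mat_assoc d)
  finally show "g * f * mact M x = mact L x * (g * f)" .
qed

lemma umod_hom_add:
  assumes M: "is_umod M" and N: "is_umod N" and f: "umod_hom M N f" and g: "umod_hom M N g"
  shows "umod_hom M N (f + g)"
  using umod_homD(3)[OF f] umod_homD(3)[OF g] umod_hom_dims[OF f] umod_hom_dims[OF g]
  by (auto simp: umod_hom_def mat_ring umod_dims[OF M] umod_dims[OF N] intro: carrier_matI)

lemma umod_isoE:
  assumes "M \<cong>\<^sub>u N"
  obtains f g where "is_umod M" "is_umod N" "umod_hom M N f" "umod_hom N M g"
    "g * f = 1\<^sub>m (mdim M)" "f * g = 1\<^sub>m (mdim N)"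
  using assms by (auto simp: umod_iso_def)

lemma umod_isoI:
  assumes "is_umod M" "is_umod N" "umod_hom M N f" "umod_hom N M g"
    "g * f = 1\<^sub>m (mdim M)" "f * g = 1\<^sub>m (mdim N)"
  shows "M \<cong>\<^sub>u N"
  using assms by (auto simp: umod_iso_def)

lemma umod_iso_refl: "is_umod M \<Longrightarrow> M \<cong>\<^sub>u M"
  by (rule umod_isoI[where f = "1\<^sub>m _" and g = "1\<^sub>m _"]) (auto intro: umod_hom_one simp: mat_ring)

lemma umod_iso_sym: "M \<cong>\<^sub>u N \<Longrightarrow> N \<cong>\<^sub>u M"
  by (auto simp: umod_iso_def)

lemma umod_iso_umod: "M \<cong>\<^sub>u N \<Longrightarrow> is_umod M" "M \<cong>\<^sub>u N \<Longrightarrow> is_umod N"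
  by (auto simp: umod_iso_def)

lemma umod_iso_trans [trans]:
  assumes "M \<cong>\<^sub>u N" "N \<cong>\<^sub>u L"
  shows "M \<cong>\<^sub>u L"
proof -
  from assms(1) obtain f g where 1: "is_umod M" "is_umod N" "umod_hom M N f" "umod_hom N M g"
    "g * f = 1\<^sub>m (mdim M)" "f * g = 1\<^sub>m (mdim N)" by (rule umod_isoE)
  from assms(2) obtain f' g' where 2: "is_umod N" "is_umod L" "umod_hom N L f'" "umod_hom L N g'"
    "g' * f' = 1\<^sub>m (mdim N)" "f' * g' = 1\<^sub>m (mdim L)" by (rule umod_isoE)
  note d = umod_hom_dims[OF 1(3)] umod_hom_dims[OF 1(4)] umod_hom_dims[OF 2(3)] umod_hom_dims[OF 2(4)]
  show ?thesis
  proof (rule umod_isoI[of _ _ "f' * f" "g * g'"])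
    show "g * g' * (f' * f) = 1\<^sub>m (mdim M)" 
      by (simp add: mat_ring d mat_reassoc[OF 2(5)] 1)
    show "f' * f * (g * g') = 1\<^sub>m (mdim L)"
      by (simp add: mat_ring d mat_reassoc[OF 1(6)] 2)
  qed (use 1 2 in \<open>auto intro: umod_hom_comp\<close>)
qed

lemma umod_iso_genI:
  assumes "is_umod M" "is_umod N" "mdim M = mdim N" "\<And>g. mact M (um_gen g) = mact N (um_gen g)"
  shows "M \<cong>\<^sub>u N"
  by (rule umod_isoI[where f = "1\<^sub>m (mdim M)" and g = "1\<^sub>m (mdim M)"])
    (use assms in \<open>auto intro!: umod_hom_genI simp: mat_ring umod_dims\<close>)

section \<open>Direct sums\<close>

lemma mdim_dsum [simp]: "mdim (M \<oplus>\<^sub>u N) = mdim M + mdim N"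
  by (simp add: dsum_def)

lemma mact_dsum:
  assumes M: "is_umod M" and N: "is_umod N"
  shows "mact (M \<oplus>\<^sub>u N) x = inl (mdim M) (mdim N) * mact M x * prl (mdim M) (mdim N) +
    inr (mdim M) (mdim N) * mact N x * prr (mdim M) (mdim N)"
  unfolding dsum_def by (simp, rule four_block_diag_eq) (auto intro: is_umodD[OF M] is_umodD[OF N])

lemma is_umod_zero: "is_umod zero_umod"
  by (auto simp: is_umod_def zero_umod_def intro!: eq_matI)

lemma is_umod_dsum:
  assumes M: "is_umod M" and N: "is_umod N"
  shows "is_umod (M \<oplus>\<^sub>u N)"
proof -
  let ?n = "mdim M" and ?m = "mdim N"
  note d = umod_dims[OF M] umod_dims[OF N]
  note a = is_umodD(4-)[OF M] is_umodD(4-)[OF N]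
  have "mact L (um_const r * x) = r \<cdot>\<^sub>m mact L x" if "is_umod L" for L r and x :: "'a um"
    using that by (auto simp: is_umod_def)
  note sm = this[OF M] this[OF N]
  note ip = inj_proj[of ?n ?m] inj_proj[of ?n ?m, THEN mat_reassoc] inj_proj_sum[of ?n ?m]
  show ?thesis
    unfolding is_umod_def mact_dsum[OF M N] mdim_dsum
  proof (intro conjI allI)
    fix x y :: "'a um" and r :: 'a
    let ?X = "\<lambda>x. inl ?n ?m * mact M x * prl ?n ?m" and ?Y = "\<lambda>x. inr ?n ?m * mact N x * prr ?n ?m"
    show "?X x + ?Y x \<in> carrier_mat (?n + ?m) (?n + ?m)" by (auto intro: carrier_matI)
    show "?X 1 + ?Y 1 = 1\<^sub>m (?n + ?m)" by (simp add: a mat_one_right ip)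
    show "?X (x * y) + ?Y (x * y) = (?X x + ?Y x) * (?X y + ?Y y)"
      by (simp add: a d mat_ring ip)
    show "?X (x + y) + ?Y (x + y) = (?X x + ?Y x) + (?X y + ?Y y)"
      by (simp add: a d mat_ring mat_ac)
    show "?X (um_const r * x) + ?Y (um_const r * x) = r \<cdot>\<^sub>m (?X x + ?Y x)"
      by (simp add: sm d mat_smult mat_smult_add)
  qed
qed

definition biprod :: "'k::field umod \<Rightarrow> 'k umod \<Rightarrow> 'k umod \<Rightarrow> 'k mat \<Rightarrow> 'k mat \<Rightarrow> 'k mat \<Rightarrow> 'k mat \<Rightarrow> bool" where
  "biprod X A B i j p q \<longleftrightarrow> is_umod X \<and> is_umod A \<and> is_umod B \<and>
     umod_hom A X i \<and> umod_hom B X j \<and> umod_hom X A p \<and> umod_hom X B q \<and>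
     p * i = 1\<^sub>m (mdim A) \<and> q * j = 1\<^sub>m (mdim B) \<and> i * p + j * q = 1\<^sub>m (mdim X)"

text \<open>The mixed products vanish because multiplying \<open>i * p + j * q = 1\<close> by
  \<open>j\<close> on the right leaves \<open>i * (p * j) = 0\<close>, where \<open>p\<close>
  cancels \<open>i\<close>; the other one is symmetric.\<close>

lemma biprodD:
  assumes "biprod X A B i j p q"
  shows "is_umod X" "is_umod A" "is_umod B" "umod_hom A X i" "umod_hom B X j" "umod_hom X A p" "umod_hom X B q"
    "p * i = 1\<^sub>m (mdim A)" "q * j = 1\<^sub>m (mdim B)" "i * p + j * q = 1\<^sub>m (mdim X)"
    "p * j = 0\<^sub>m (mdim A) (mdim B)" "q * i = 0\<^sub>m (mdim B) (mdim A)"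
proof -
  show *: "is_umod X" "is_umod A" "is_umod B" "umod_hom A X i" "umod_hom B X j" "umod_hom X A p" "umod_hom X B q"
    "p * i = 1\<^sub>m (mdim A)" "q * j = 1\<^sub>m (mdim B)" "i * p + j * q = 1\<^sub>m (mdim X)"
    using assms by (auto simp: biprod_def)
  note d = umod_hom_dims[OF *(4)] umod_hom_dims[OF *(5)] umod_hom_dims[OF *(6)] umod_hom_dims[OF *(7)]
  have cancel: "Y = 0\<^sub>m n m" if "X + Y = X" "dim_row X = n" "dim_col X = m" "dim_row Y = n" "dim_col Y = m"
    for X Y :: "'a mat" and n m
  proof (rule eq_matI)
    fix i j assume ij: "i < dim_row (0\<^sub>m n m :: 'a mat)" "j < dim_col (0\<^sub>m n m :: 'a mat)"
    have "(X + Y) $$ (i, j) = X $$ (i, j)" using that by simp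
    then have "X $$ (i, j) + Y $$ (i, j) = X $$ (i, j)" using ij that by (subst (asm) index_add_mat) auto
    then show "Y $$ (i, j) = 0\<^sub>m n m $$ (i, j)" using ij by simp
  qed (use that in auto)
  have "i * (p * j) + j = (i * p + j * q) * j" 
    by (simp add: mat_ring d *(9))
  also have "\<dots> = j" unfolding *(10) by (simp add: mat_ring d)
  finally have "j + i * (p * j) = j" by (subst mat_add_comm) (simp_all add: d)
  then have "i * (p * j) = 0\<^sub>m (mdim X) (mdim B)" by (rule cancel) (simp_all add: d)
  then have "p * (i * (p * j)) = 0\<^sub>m (mdim A) (mdim B)" by (simp add: mat_zero_right d)
  then show "p * j = 0\<^sub>m (mdim A) (mdim B)" by (simp add: mat_reassoc[OF *(8)] mat_one_left d)
  have "i + j * (q * i) = (i * p + j * q) * i" 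
    by (simp add: mat_ring d *(8))
  also have "\<dots> = i" unfolding *(10) by (simp add: mat_ring d)
  finally have "j * (q * i) = 0\<^sub>m (mdim X) (mdim A)" by (rule cancel) (simp_all add: d)
  then have "q * (j * (q * i)) = 0\<^sub>m (mdim B) (mdim A)" by (simp add: mat_zero_right d)
  then show "q * i = 0\<^sub>m (mdim B) (mdim A)" by (simp add: mat_reassoc[OF *(9)] mat_one_left d)
qed

lemma biprod_dsum:
  assumes M: "is_umod M" and N: "is_umod N"
  shows "biprod (M \<oplus>\<^sub>u N) M N (inl (mdim M) (mdim N)) (inr (mdim M) (mdim N)) (prl (mdim M) (mdim N)) (prr (mdim M) (mdim N))"
proof -
  let ?n = "mdim M" and ?m = "mdim N"
  note r = mact_dsum[OF M N] mat_ring umod_dims[OF M] umod_dims[OF N] inj_proj[of ?n ?m] inj_proj[of ?n ?m, THEN mat_reassoc]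
  have "umod_hom M (M \<oplus>\<^sub>u N) (inl ?n ?m)" "umod_hom N (M \<oplus>\<^sub>u N) (inr ?n ?m)"
    "umod_hom (M \<oplus>\<^sub>u N) M (prl ?n ?m)" "umod_hom (M \<oplus>\<^sub>u N) N (prr ?n ?m)"
    unfolding umod_hom_def by (intro conjI allI carrier_matI; simp add: r)+
  then show ?thesis
    by (simp add: biprod_def M N is_umod_dsum inj_proj inj_proj_sum)
qed

lemma biprod_swap:
  assumes "biprod X A B i j p q" shows "biprod X B A j i q p"
proof -
  note bp = biprodD[OF assms]
  have "j * q + i * p = 1\<^sub>m (mdim X)"
    using bp(10) mat_add_comm[of "j * q" "i * p"] bp(4-7)[THEN umod_hom_dims(1)] bp(4-7)[THEN umod_hom_dims(2)] by simp
  then show ?thesis using bp by (simp add: biprod_def)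
qed

lemma biprod_cong:
  assumes "biprod X A B i j p q" "A \<cong>\<^sub>u A'" "B \<cong>\<^sub>u B'"
  obtains i' j' p' q' where "biprod X A' B' i' j' p' q'"
proof -
  note bp = biprodD[OF assms(1)]
  from assms(2) obtain f f' where f: "is_umod A" "is_umod A'" "umod_hom A A' f" "umod_hom A' A f'"
    "f' * f = 1\<^sub>m (mdim A)" "f * f' = 1\<^sub>m (mdim A')" by (rule umod_isoE)
  from assms(3) obtain g g' where g: "is_umod B" "is_umod B'" "umod_hom B B' g" "umod_hom B' B g'"
    "g' * g = 1\<^sub>m (mdim B)" "g * g' = 1\<^sub>m (mdim B')" by (rule umod_isoE)
  note d = bp(4-7)[THEN umod_hom_dims(1)] bp(4-7)[THEN umod_hom_dims(2)]
     f(3,4)[THEN umod_hom_dims(1)] g(3,4)[THEN umod_hom_dims(1)] f(3,4)[THEN umod_hom_dims(2)] g(3,4)[THEN umod_hom_dims(2)]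
  have "biprod X A' B' (i * f') (j * g') (f * p) (g * q)"
    unfolding biprod_def
  proof (intro conjI)
    show "umod_hom A' X (i * f')" "umod_hom B' X (j * g')" "umod_hom X A' (f * p)" "umod_hom X B' (g * q)"
      by (rule umod_hom_comp[OF f(2,1) bp(1) f(4) bp(4)] umod_hom_comp[OF g(2,1) bp(1) g(4) bp(5)]
        umod_hom_comp[OF bp(1) f(1,2) bp(6) f(3)] umod_hom_comp[OF bp(1) g(1,2) bp(7) g(3)])+
  qed (simp_all add: bp f g mat_ring d mat_reassoc[OF bp(8)] mat_reassoc[OF bp(9)] mat_reassoc[OF f(5)] mat_reassoc[OF g(5)])
  then show ?thesis by (rule that)
qed

lemma biprod_iso:
  assumes X: "biprod X A B i j p q" and Y: "biprod Y A B i' j' p' q'"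
  shows "X \<cong>\<^sub>u Y"
proof -
  note x = biprodD[OF X] and y = biprodD[OF Y]
  note d = x(4-7)[THEN umod_hom_dims(1)] x(4-7)[THEN umod_hom_dims(2)]
    y(4-7)[THEN umod_hom_dims(1)] y(4-7)[THEN umod_hom_dims(2)]
  note r = x(8,9,11,12)[THEN mat_reassoc] y(8,9,11,12)[THEN mat_reassoc]
  show ?thesis
  proof (rule umod_isoI[of _ _ "i' * p + j' * q" "i * p' + j * q'"])
    show "(i * p' + j * q') * (i' * p + j' * q) = 1\<^sub>m (mdim X)"
      by (simp add: mat_ring d r x(10))
    show "(i' * p + j' * q) * (i * p' + j * q') = 1\<^sub>m (mdim Y)"
      by (simp add: mat_ring d r y(10))
  next
    show "umod_hom X Y (i' * p + j' * q)" "umod_hom Y X (i * p' + j * q')"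
      by (rule umod_hom_add umod_hom_comp[OF x(1,2) y(1) x(6) y(4)] umod_hom_comp[OF x(1,3) y(1) x(7) y(5)]
        umod_hom_comp[OF y(1,2) x(1) y(6) x(4)] umod_hom_comp[OF y(1,3) x(1) y(7) x(5)] x(1) y(1))+
  qed (rule x y)+
qed

lemma biprod_dsum_iso:
  assumes "biprod X A B i j p q"
  shows "X \<cong>\<^sub>u A \<oplus>\<^sub>u B"
  by (rule biprod_iso[OF assms biprod_dsum]) (rule biprodD[OF assms])+

lemma dsum_cong:
  assumes "A \<cong>\<^sub>u A'" "B \<cong>\<^sub>u B'"
  shows "A \<oplus>\<^sub>u B \<cong>\<^sub>u A' \<oplus>\<^sub>u B'"
proof -
  have "is_umod A" "is_umod B" using assms umod_iso_umod by blast+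
  from biprod_cong[OF biprod_dsum[OF this] assms] obtain i j p q where "biprod (A \<oplus>\<^sub>u B) A' B' i j p q" by blast
  then show ?thesis by (rule biprod_dsum_iso)
qed

lemma dsum_comm: 
  assumes "is_umod A" "is_umod B"
  shows "A \<oplus>\<^sub>u B \<cong>\<^sub>u B \<oplus>\<^sub>u A"
  using biprod_dsum_iso[OF biprod_swap[OF biprod_dsum[OF assms]]] .

lemma dsum_assoc:
  assumes "is_umod A" "is_umod B" "is_umod C"
  shows "(A \<oplus>\<^sub>u B) \<oplus>\<^sub>u C \<cong>\<^sub>u A \<oplus>\<^sub>u (B \<oplus>\<^sub>u C)"
proof (rule umod_iso_genI)
  fix g
  show "mact ((A \<oplus>\<^sub>u B) \<oplus>\<^sub>u C) (um_gen g) = mact (A \<oplus>\<^sub>u (B \<oplus>\<^sub>u C)) (um_gen g)"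
    using assoc_four_block_mat[of "mact A (um_gen g)" "mact B (um_gen g)" "mact C (um_gen g)"]
    by (simp add: dsum_def umod_dims[OF assms(1)] umod_dims[OF assms(2)] umod_dims[OF assms(3)])
qed (simp_all add: assms is_umod_dsum add.assoc)

lemma dsum_zero_left:
  assumes "is_umod A" shows "zero_umod \<oplus>\<^sub>u A \<cong>\<^sub>u A"
proof (rule umod_iso_genI)
  show "mact (zero_umod \<oplus>\<^sub>u A) (um_gen g) = mact A (um_gen g)" for g
    unfolding dsum_def zero_umod_def umod.simps
    by (rule eq_matI) (simp_all add: umod_dims[OF assms])
qed (simp_all add: assms is_umod_dsum is_umod_zero, simp add: zero_umod_def)

lemma dsum_zero_right:
  assumes "is_umod A" shows "A \<oplus>\<^sub>u zero_umod \<cong>\<^sub>u A"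
  using umod_iso_trans[OF dsum_comm[OF assms is_umod_zero] dsum_zero_left[OF assms]] .

section \<open>Short exact sequences and projective modules\<close>

text \<open>Exactness is expressed by linear splittings \<open>u\<close> and \<open>v\<close>, which need not be homomorphisms;
  all diagram chases become matrix identities.\<close>

definition ses :: "'k::field umod \<Rightarrow> 'k umod \<Rightarrow> 'k umod \<Rightarrow> 'k mat \<Rightarrow> 'k mat \<Rightarrow> 'k mat \<Rightarrow> 'k mat \<Rightarrow> bool" where
  "ses K Q M e p u v \<longleftrightarrow> is_umod K \<and> is_umod Q \<and> is_umod M \<and> umod_hom K Q e \<and> umod_hom Q M p \<and>
     u \<in> carrier_mat (mdim Q) (mdim M) \<and> v \<in> carrier_mat (mdim K) (mdim Q) \<and>
     p * u = 1\<^sub>m (mdim M) \<and> v * e = 1\<^sub>m (mdim K) \<and> p * e = 0\<^sub>m (mdim M) (mdim K) \<and>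
     u * p + e * v = 1\<^sub>m (mdim Q)"

lemma sesD:
  assumes "ses K Q M e p u v"
  shows "is_umod K" "is_umod Q" "is_umod M" "umod_hom K Q e" "umod_hom Q M p"
    "p * u = 1\<^sub>m (mdim M)" "v * e = 1\<^sub>m (mdim K)" "p * e = 0\<^sub>m (mdim M) (mdim K)"
    "u * p + e * v = 1\<^sub>m (mdim Q)"
    "dim_row u = mdim Q" "dim_col u = mdim M" "dim_row v = mdim K" "dim_col v = mdim Q"
    "dim_row e = mdim Q" "dim_col e = mdim K" "dim_row p = mdim M" "dim_col p = mdim Q"
  using assms by (auto simp: ses_def umod_hom_dims)

text \<open>Multiplying \<open>u * p + e * v = 1\<close> by \<open>d\<close> gives the
  factorisation. The factor is a homomorphism although \<open>v\<close> is only linear, since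
  \<open>v\<close> cancels \<open>e\<close> and \<open>e\<close> is a homomorphism.\<close>

lemma ses_factor:
  assumes s: "ses K Q M e p u v" and X: "is_umod X" and d: "umod_hom X Q d" and 0: "p * d = 0\<^sub>m (mdim M) (mdim X)"
  shows "e * (v * d) = d" "umod_hom X K (v * d)"
proof -
  note sd = sesD[OF s]
  note dims = sd(10-17) umod_hom_dims[OF d] umod_dims[OF sd(1)] umod_dims[OF sd(2)] umod_dims[OF X]
  have "e * (v * d) = (u * p + e * v) * d" by (simp add: mat_ring dims 0)
  then show ev: "e * (v * d) = d" by (simp add: sd(9) mat_ring dims)
  have "v * d * mact X x = mact K x * (v * d)" for x
  proof -
    have "v * d * mact X x = v * (mact Q x * (e * (v * d)))"
      using umod_homD(3)[OF d, of x] by (simp add: ev mat_assoc dims)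
    also have "\<dots> = v * ((mact Q x * e) * (v * d))" by (simp add: mat_assoc dims)
    also have "mact Q x * e = e * mact K x" using umod_homD(3)[OF sd(4), of x] ..
    also have "v * (e * mact K x * (v * d)) = (v * e) * (mact K x * (v * d))" by (simp add: mat_assoc dims)
    finally show ?thesis by (simp add: sd(7) mat_ring dims)
  qed
  then show "umod_hom X K (v * d)" by (auto simp: umod_hom_def dims intro: carrier_matI)
qed

section \<open>From images of vectors to matrix equations; lifting along surjections\<close>

lemma mult_mat_vec_assoc:
  fixes A :: "'a::comm_ring_1 mat"
  assumes "dim_col A = dim_row B" "dim_col B = dim_vec w"
  shows "(A * B) *\<^sub>v w = A *\<^sub>v (B *\<^sub>v w)"
  by (rule assoc_mult_mat_vec) (use assms in \<open>auto intro: carrier_matI carrier_vecI\<close>)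

lemma mat_unit_vec_col:
  fixes A :: "'a::comm_ring_1 mat"
  assumes "A \<in> carrier_mat n m" "j < m"
  shows "A *\<^sub>v unit_vec m j = col A j"
  using assms by (intro eq_vecI) (auto simp: scalar_prod_right_unit)

lemma mat_vec_eqI:
  fixes A B :: "'a::field mat"
  assumes "\<And>w. w \<in> carrier_vec m \<Longrightarrow> A *\<^sub>v w = B *\<^sub>v w" and "A \<in> carrier_mat n m" "B \<in> carrier_mat n m"
  shows "A = B"
proof (rule mat_col_eqI)
  fix j assume "j < dim_col B"
  then have j: "j < m" using assms(3) by simp
  have "A *\<^sub>v unit_vec m j = col A j" "B *\<^sub>v unit_vec m j = col B j"
    using assms(2,3) j by (auto intro!: mat_unit_vec_col)
  then show "col A j = col B j" using assms(1)[of "unit_vec m j"] by simp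
qed (use assms in auto)

text \<open>A preimage is chosen for each column of \<open>B\<close>. Inclusions of images thereby
  become matrix equations.\<close>

lemma mat_factor:
  fixes A B :: "'a::field mat"
  assumes A: "A \<in> carrier_mat n m" and B: "B \<in> carrier_mat n k"
    and sub: "\<And>w. w \<in> carrier_vec k \<Longrightarrow> B *\<^sub>v w \<in> (\<lambda>v. A *\<^sub>v v) ` carrier_vec m"
  obtains X where "X \<in> carrier_mat m k" "A * X = B"
proof -
  have "\<exists>x. x \<in> carrier_vec m \<and> A *\<^sub>v x = col B j" if "j < k" for j
  proof -
    have "B *\<^sub>v unit_vec k j = col B j" using B that by (auto intro!: mat_unit_vec_col)
    then show ?thesis using sub[of "unit_vec k j"] by auto
  qed
  then obtain x where x: "\<And>j. j < k \<Longrightarrow> x j \<in> carrier_vec m" "\<And>j. j < k \<Longrightarrow> A *\<^sub>v x j = col B j"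
    by metis
  let ?X = "mat_of_cols m (map x [0..<k])"
  have X: "?X \<in> carrier_mat m k" by auto
  have "A * ?X = B"
  proof (rule mat_col_eqI)
    fix j assume "j < dim_col B"
    then have j: "j < k" using B by simp
    have "col (A * ?X) j = A *\<^sub>v col ?X j" using j A X by (intro col_mult2) auto
    also have "col ?X j = x j" using j x(1) by (subst col_mat_of_cols) auto
    finally show "col (A * ?X) j = col B j" using x(2) j by simp
  qed (use A B in auto)
  then show ?thesis using X that by blast
qed

text \<open>The matrix \<open>u\<close> is a linear section and in general not a homomorphism; it
  represents surjectivity in matrix computations.\<close>

lemma umod_surj_iff:
  assumes f: "umod_hom M N f"
  shows "umod_surj M N f \<longleftrightarrow> (\<exists>u. u \<in> carrier_mat (mdim M) (mdim N) \<and> f * u = 1\<^sub>m (mdim N))"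
proof
  assume s: "umod_surj M N f"
  have "1\<^sub>m (mdim N) *\<^sub>v w \<in> (\<lambda>v. f *\<^sub>v v) ` carrier_vec (mdim M)" if "w \<in> carrier_vec (mdim N)" for w
    using s that by (auto simp: umod_surj_def range_umod_def)
  from mat_factor[OF umod_homD(4)[OF f] one_carrier_mat this]
  show "\<exists>u. u \<in> carrier_mat (mdim M) (mdim N) \<and> f * u = 1\<^sub>m (mdim N)" by metis
next
  assume "\<exists>u. u \<in> carrier_mat (mdim M) (mdim N) \<and> f * u = 1\<^sub>m (mdim N)"
  then obtain u where u: "u \<in> carrier_mat (mdim M) (mdim N)" "f * u = 1\<^sub>m (mdim N)" by blast
  have "w \<in> range_umod M f" if w: "w \<in> carrier_vec (mdim N)" for w
  proof -
    have "f *\<^sub>v (u *\<^sub>v w) = (f * u) *\<^sub>v w"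
      using u(1) w umod_hom_dims[OF f] by (intro mult_mat_vec_assoc[symmetric]) auto
    then have "w = f *\<^sub>v (u *\<^sub>v w)" using w u(2) by simp
    moreover have "u *\<^sub>v w \<in> carrier_vec (mdim M)" using u(1) by (rule mult_mat_vec_carrier) (rule w)
    ultimately show ?thesis unfolding range_umod_def by blast
  qed
  moreover have "range_umod M f \<subseteq> carrier_vec (mdim N)"
    using umod_homD(4)[OF f] by (auto simp: range_umod_def)
  ultimately show "umod_surj M N f" using f by (auto simp: umod_surj_def)
qed

lemma projectiveI:
  assumes "is_umod P"
    and "\<And>M N g u f. is_umod M \<Longrightarrow> is_umod N \<Longrightarrow> umod_hom M N g \<Longrightarrow> u \<in> carrier_mat (mdim M) (mdim N) \<Longrightarrow>
      g * u = 1\<^sub>m (mdim N) \<Longrightarrow> umod_hom P N f \<Longrightarrow> \<exists>h. umod_hom P M h \<and> g * h = f"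
  shows "is_projective P"
  unfolding is_projective_def
proof (intro conjI allI impI)
  fix M N :: "'a umod" and g f
  assume *: "is_umod M \<and> is_umod N \<and> umod_surj M N g \<and> umod_hom P N f"
  then have "umod_hom M N g" by (simp add: umod_surj_def)
  then show "\<exists>h. umod_hom P M h \<and> g * h = f"
    using assms(2)[of M N g _ f] umod_surj_iff * by metis
qed (rule assms)

lemma projective_umod: "is_projective P \<Longrightarrow> is_umod P"
  by (simp add: is_projective_def)

lemma projective_lift:
  assumes P: "is_projective P" and M: "is_umod M" and N: "is_umod N" and g: "umod_hom M N g"
    and u: "u \<in> carrier_mat (mdim M) (mdim N)" "g * u = 1\<^sub>m (mdim N)" and f: "umod_hom P N f"
  obtains h where "umod_hom P M h" "g * h = f"
  using assms umod_surj_iff[OF g] unfolding is_projective_def by blast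

lemma ses_lift:
  assumes P: "is_projective P" and s: "ses K Q M e p u v" and f: "umod_hom P M f"
  obtains h where "umod_hom P Q h" "p * h = f"
  using projective_lift[OF P sesD(2,3,5)[OF s] _ sesD(6)[OF s] f] sesD(10,11)[OF s] carrier_matI by blast

lemma projective_dsum:
  assumes "is_projective P" "is_projective Q"
  shows "is_projective (P \<oplus>\<^sub>u Q)"
proof (rule projectiveI)
  have PQ: "is_umod P" "is_umod Q" using assms by (auto intro: projective_umod)
  then show sum: "is_umod (P \<oplus>\<^sub>u Q)" by (rule is_umod_dsum)
  note b = biprodD[OF biprod_dsum[OF PQ]]
  let ?i = "inl (mdim P) (mdim Q)" and ?j = "inr (mdim P) (mdim Q)" 
  let ?p = "prl (mdim P) (mdim Q)" and ?q = "prr (mdim P) (mdim Q)" 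
  fix M N :: "'a umod" and g u f
  assume M: "is_umod M" and N: "is_umod N" and g: "umod_hom M N g"
    and u: "u \<in> carrier_mat (mdim M) (mdim N)" "g * u = 1\<^sub>m (mdim N)" and f: "umod_hom (P \<oplus>\<^sub>u Q) N f"
  obtain h where h: "umod_hom P M h" "g * h = f * ?i"
    using projective_lift[OF assms(1) M N g u umod_hom_comp[OF PQ(1) sum N b(4) f]] .
  obtain k where k: "umod_hom Q M k" "g * k = f * ?j"
    using projective_lift[OF assms(2) M N g u umod_hom_comp[OF PQ(2) sum N b(5) f]] .
  note d = umod_hom_dims[OF f] umod_hom_dims[OF g] umod_hom_dims[OF h(1)] umod_hom_dims[OF k(1)]
  have "g * (h * ?p + k * ?q) = f * (?i * ?p + ?j * ?q)"
    by (simp add: mat_ring d mat_reassoc[OF h(2)] mat_reassoc[OF k(2)])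
  also have "\<dots> = f" by (simp add: inj_proj_sum mat_ring d)
  finally have "g * (h * ?p + k * ?q) = f" .
  moreover have "umod_hom (P \<oplus>\<^sub>u Q) M (h * ?p + k * ?q)"
    by (rule umod_hom_add[OF sum M umod_hom_comp[OF sum PQ(1) M b(6) h(1)] umod_hom_comp[OF sum PQ(2) M b(7) k(1)]])
  ultimately show "\<exists>h. umod_hom (P \<oplus>\<^sub>u Q) M h \<and> g * h = f" by blast
qed

lemma projective_iso:
  assumes "is_projective P" "P \<cong>\<^sub>u Q"
  shows "is_projective Q"
proof -
  from assms(2) obtain a b where ab: "is_umod P" "is_umod Q" "umod_hom P Q a" "umod_hom Q P b"
    "b * a = 1\<^sub>m (mdim P)" "a * b = 1\<^sub>m (mdim Q)" by (rule umod_isoE)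
  show ?thesis
  proof (rule projectiveI)
    fix M N :: "'a umod" and g u f
    assume M: "is_umod M" and N: "is_umod N" and g: "umod_hom M N g"
      and u: "u \<in> carrier_mat (mdim M) (mdim N)" "g * u = 1\<^sub>m (mdim N)" and f: "umod_hom Q N f"
    obtain h where h: "umod_hom P M h" "g * h = f * a"
      using projective_lift[OF assms(1) M N g u umod_hom_comp[OF ab(1,2) N ab(3) f]] .
    note d = umod_hom_dims[OF f] umod_hom_dims[OF g] umod_hom_dims[OF h(1)] umod_hom_dims[OF ab(3)] umod_hom_dims[OF ab(4)]
    have "g * (h * b) = f" by (simp add: mat_ring d mat_reassoc[OF h(2)] ab(6))
    then show "\<exists>h. umod_hom Q M h \<and> g * h = f"
      using umod_hom_comp[OF ab(2,1) M ab(4) h(1)] by blast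
  qed (rule ab)
qed

lemma projective_zero: "is_projective zero_umod"
proof (rule projectiveI)
  fix M N :: "'a umod" and g u f
  assume M: "is_umod M" and N: "is_umod N" and g: "umod_hom M N g"
    and u: "u \<in> carrier_mat (mdim M) (mdim N)" "g * u = 1\<^sub>m (mdim N)" and f: "umod_hom zero_umod N f"
  have "f = 0\<^sub>m (mdim N) 0" using umod_hom_dims[OF f] by (intro eq_matI) (auto simp: zero_umod_def)
  moreover have "g * 0\<^sub>m (mdim M) 0 = 0\<^sub>m (mdim N) 0"
    using umod_hom_dims[OF g] by (intro eq_matI) auto
  ultimately show "\<exists>h. umod_hom zero_umod M h \<and> g * h = f"
    using umod_hom_zero[OF is_umod_zero M] by (auto simp: zero_umod_def)
qed (rule is_umod_zero)

section \<open>Splitting, Schanuel's lemma and cancellation in characteristic two\<close>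

locale char_two =
  fixes ty :: "'k::field itself"
  assumes char_two: "CHAR('k) = 2"
begin

lemma self_add: "x + x = 0" for x :: 'k
  by (metis char_two mult_2 of_nat_CHAR of_nat_numeral mult_zero_left)

lemma mat_self_add: "(A :: 'k mat) + A = 0\<^sub>m (dim_row A) (dim_col A)"
  by (rule eq_matI) (simp_all add: self_add)

text \<open>Once \<open>mat_ac\<close> has sorted a sum, equal terms are adjacent; this form cancels
  them in front of a remaining sum, and \<open>mat_self_add\<close> cancels them at its end.\<close>

lemma mat_self_add_left: "dim_row A = dim_row B \<Longrightarrow> dim_col A = dim_col B \<Longrightarrow> (A :: 'k mat) + (A + B) = B"
  by (simp flip: mat_add_assoc add: mat_self_add mat_add_zero_left)

lemmas mat_char2 = mat_self_add mat_self_add_left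

text \<open>A section \<open>h\<close> of \<open>p\<close> yields the projector
  \<open>1 + h * p\<close>, that is \<open>1 - h * p\<close>, onto the kernel of \<open>p\<close>;
  followed by \<open>v\<close> it is a retraction of \<open>e\<close>.\<close>

lemma ses_split:
  fixes K Q M :: "'k umod"
  assumes s: "ses K Q M e p u v" and M: "is_projective M"
  shows "Q \<cong>\<^sub>u K \<oplus>\<^sub>u M"
proof -
  note sd = sesD[OF s]
  obtain h where h: "umod_hom M Q h" "p * h = 1\<^sub>m (mdim M)"
    using ses_lift[OF M s umod_hom_one[OF sd(3)]] .
  note dims = sd(10-17) umod_hom_dims[OF h(1)]
  let ?d = "1\<^sub>m (mdim Q) + h * p"
  have d: "umod_hom Q Q ?d"
    by (rule umod_hom_add[OF sd(2,2) umod_hom_one[OF sd(2)] umod_hom_comp[OF sd(2,3,2,5) h(1)]])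
  have 0: "p * ?d = 0\<^sub>m (mdim M) (mdim Q)"
    by (simp add: mat_ring dims mat_reassoc[OF h(2)] mat_char2)
  note f = ses_factor[OF s sd(2) d 0]
  have "v * ?d * e = 1\<^sub>m (mdim K)"
    by (simp add: mat_ring dims sd)
  moreover have "e * (v * ?d) + h * p = 1\<^sub>m (mdim Q)"
    unfolding f(1) by (simp add: mat_ring dims mat_char2)
  ultimately have "biprod Q K M e h (v * ?d) p"
    using f(2) sd(1-5) h by (simp add: biprod_def)
  then show ?thesis by (rule biprod_dsum_iso)
qed

text \<open>Lifts \<open>h\<close> and \<open>h'\<close> of the two covering maps over each other
  provide explicit inclusions and projections between \<open>K \<oplus>\<^sub>u Q'\<close> and
  \<open>K'\<close>, \<open>Q\<close>. A pair (k, y) goes to \<open>q = e k + h' y\<close> in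
  \<open>Q\<close>; then \<open>d = y + h q\<close> is killed by \<open>p'\<close> and so comes from
  \<open>K'\<close>.\<close>

lemma schanuel:
  fixes K Q M :: "'k umod"
  assumes s: "ses K Q M e p u v" and s': "ses K' Q' M e' p' u' v'"
    and Q: "is_projective Q" and Q': "is_projective Q'"
  shows "K \<oplus>\<^sub>u Q' \<cong>\<^sub>u K' \<oplus>\<^sub>u Q"
proof -
  note sd = sesD[OF s] and sd' = sesD[OF s']
  obtain h where h: "umod_hom Q Q' h" "p' * h = p" using ses_lift[OF Q s' sd(5)] .
  obtain h' where h': "umod_hom Q' Q h'" "p * h' = p'" using ses_lift[OF Q' s sd'(5)] .
  define X where "X = K \<oplus>\<^sub>u Q'"
  define i where "i = (inl (mdim K) (mdim Q') :: 'k mat)"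
  define j where "j = (inr (mdim K) (mdim Q') :: 'k mat)"
  define a where "a = (prl (mdim K) (mdim Q') :: 'k mat)"
  define b where "b = (prr (mdim K) (mdim Q') :: 'k mat)"
  note B = biprodD[OF biprod_dsum[OF sd(1) sd'(2)], folded X_def i_def j_def a_def b_def]
  note dims = sd(10-17) sd'(10-17) umod_hom_dims[OF h(1)] umod_hom_dims[OF h'(1)]
    B(4-7)[THEN umod_hom_dims(1)] B(4-7)[THEN umod_hom_dims(2)]
  note prods = sd(6-8) sd'(6-8) h(2) h'(2) B(8,9,11,12)
  define q where "q = e * a + h' * b"
  have q: "umod_hom X Q q" unfolding q_def
    by (rule umod_hom_add[OF B(1) sd(2) umod_hom_comp[OF B(1,2) sd(2) B(6) sd(4)] umod_hom_comp[OF B(1,3) sd(2) B(7) h'(1)]])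
  define d where "d = b + h * q"
  have d: "umod_hom X Q' d" unfolding d_def
    by (rule umod_hom_add[OF B(1,3,7) umod_hom_comp[OF B(1) sd(2) sd'(2) q h(1)]])
  note dims = dims umod_hom_dims[OF q] umod_hom_dims[OF d]
  have pq: "p * q = p' * b" unfolding q_def 
    by (simp add: mat_ring dims prods prods[THEN mat_reassoc])
  have 0: "p' * d = 0\<^sub>m (mdim M) (mdim X)" 
    unfolding d_def by (simp add: mat_ring dims mat_reassoc[OF h(2)] pq mat_char2)
  note F = ses_factor[OF s' B(1) d 0]
  let ?d2 = "1\<^sub>m (mdim Q) + h' * h"
  have d2: "umod_hom Q Q ?d2"
    by (rule umod_hom_add[OF sd(2,2) umod_hom_one[OF sd(2)] umod_hom_comp[OF sd(2) sd'(2) sd(2) h(1) h'(1)]])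
  have "p * ?d2 = 0\<^sub>m (mdim M) (mdim Q)"
    by (simp add: mat_ring dims prods mat_reassoc[OF h'(2)] mat_char2)
  note G = ses_factor[OF s sd(2) d2 this]
  have d3: "umod_hom K' Q (h' * e')" by (rule umod_hom_comp[OF sd'(1,2) sd(2) sd'(4) h'(1)])
  have "p * (h' * e') = 0\<^sub>m (mdim M) (mdim K')"
    by (simp add: dims prods mat_reassoc[OF h'(2)])
  note H = ses_factor[OF s sd'(1) d3 this]
  \<comment> \<open>These solve \<open>q = 0\<close>, \<open>d = e'\<close> and
    \<open>q = 1\<close>, \<open>d = 0\<close>, respectively.\<close>
  let ?i1 = "i * (v * (h' * e')) + j * e'" and ?i2 = "i * (v * ?d2) + j * h"
  have hi1: "umod_hom K' X ?i1"
    by (rule umod_hom_add[OF sd'(1) B(1) umod_hom_comp[OF sd'(1) B(2,1) H(2) B(4)] umod_hom_comp[OF sd'(1) B(3,1) sd'(4) B(5)]])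
  have hi2: "umod_hom Q X ?i2"
    by (rule umod_hom_add[OF sd(2) B(1) umod_hom_comp[OF sd(2) B(2,1) G(2) B(4)] umod_hom_comp[OF sd(2) B(3,1) h(1) B(5)]])
  have bi: "b * ?i1 = e'" "a * ?i1 = v * (h' * e')" "b * ?i2 = h" "a * ?i2 = v * ?d2"
    by (simp_all add: mat_ring dims prods[THEN mat_reassoc])
  have qi1: "q * ?i1 = 0\<^sub>m (mdim Q) (mdim K')"
  proof -
    have "q * ?i1 = e * (a * ?i1) + h' * (b * ?i1)" unfolding q_def by (simp add: mat_ring mat_ac dims)
    then show ?thesis by (simp only: bi H(1)) (simp add: mat_char2 dims)
  qed
  have qi2: "q * ?i2 = 1\<^sub>m (mdim Q)"
  proof -
    have "q * ?i2 = e * (a * ?i2) + h' * (b * ?i2)" unfolding q_def by (simp add: mat_ring mat_ac dims)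
    also have "\<dots> = ?d2 + h' * h" by (simp only: bi G(1))
    finally show ?thesis by (simp add: mat_ring dims mat_char2)
  qed
  have "biprod X K' Q ?i1 ?i2 (v' * d) q"
    unfolding biprod_def
  proof (intro conjI)
    have "d * ?i1 = b * ?i1 + h * (q * ?i1)" unfolding d_def by (simp add: mat_ring mat_ac dims)
    then have "d * ?i1 = e'" by (simp only: bi qi1) (simp add: mat_ring dims)
    then have "v' * d * ?i1 = v' * e'" by (simp only: mat_assoc dims dim_row_mat index_add_mat index_mult_mat)
    then show "v' * d * ?i1 = 1\<^sub>m (mdim K')" by (simp add: prods)
    let ?S = "?i1 * (v' * d) + ?i2 * q"
    have "b * ?S = (b * ?i1) * (v' * d) + (b * ?i2) * q" by (simp add: mat_ring mat_ac dims)
    also have "\<dots> = d + h * q" by (simp only: bi F(1))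
    also have "\<dots> = b" unfolding d_def by (simp add: mat_ring dims mat_char2)
    finally have bS: "b * ?S = b" .
    have "a * ?S = (a * ?i1) * (v' * d) + (a * ?i2) * q" by (simp add: mat_ring mat_ac dims)
    also have "\<dots> = v * (h' * (e' * (v' * d))) + v * (?d2 * q)" unfolding bi by (simp add: mat_assoc dims)
    also have "\<dots> = v * (h' * d + ?d2 * q)" unfolding F(1) by (simp add: mat_distrib_left dims)
    also have "h' * d + ?d2 * q = e * a" 
      unfolding d_def by (simp add: mat_ring dims) (simp add: q_def mat_ring dims mat_ac mat_char2)
    also have "v * (e * a) = a" by (simp add: prods(2)[THEN mat_reassoc] mat_ring dims)
    finally have aS: "a * ?S = a" .
    have "?S = (i * a + j * b) * ?S" unfolding B(10) by (rule mat_one_left[symmetric]) (simp add: dims)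
    also have "\<dots> = i * (a * ?S) + j * (b * ?S)" by (simp add: mat_ring mat_ac dims)
    finally show "?S = 1\<^sub>m (mdim X)" unfolding aS bS B(10) .
  qed (rule B sd sd' hi1 hi2 F q qi2)+
  then show ?thesis using biprod_dsum_iso X_def by metis
qed

text \<open>The inverse of a Schur complement is a block of the inverse matrix.\<close>

lemma biprod_cancel_unit:
  fixes X P A B :: "'k umod"
  assumes 1: "biprod X P A i j a b" and 2: "biprod X P B i' j' a' b'"
    and w: "umod_hom P P w" "w * (a' * i) = 1\<^sub>m (mdim P)"
  shows "A \<cong>\<^sub>u B"
proof -
  note x = biprodD[OF 1] and y = biprodD[OF 2]
  have aw: "a' * i * w = 1\<^sub>m (mdim P)"
    by (rule mat_mult_left_right_inverse[OF _ _ w(2)])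
      (auto simp: umod_hom_dims[OF w(1)] umod_hom_dims[OF y(6)] umod_hom_dims[OF x(4)] intro: carrier_matI)
  note dims = x(4-7)[THEN umod_hom_dims(1)] x(4-7)[THEN umod_hom_dims(2)]
    y(4-7)[THEN umod_hom_dims(1)] y(4-7)[THEN umod_hom_dims(2)] umod_hom_dims[OF w(1)]
  \<comment> \<open>The correction term tilts \<open>A\<close> into the kernel of \<open>a'\<close>,
    which is the copy of \<open>B\<close>.\<close>
  define t where "t = j + i * (w * (a' * j))"
  have t: "umod_hom A X t" unfolding t_def
    by (rule umod_hom_add umod_hom_comp[OF x(3,2,1)] umod_hom_comp[OF x(3,2,2)] umod_hom_comp[OF x(3,1,2)] x y w)+
  note dims = dims umod_hom_dims[OF t]
  have awi: "w * (a' * (i * Z)) = Z" "a' * (i * (w * Z)) = Z" if "dim_row Z = mdim P" for Z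
    using that mat_reassoc[OF w(2), of Z] mat_reassoc[OF aw, of Z] by (simp_all add: mat_ring dims)
  have at: "a' * t = 0\<^sub>m (mdim P) (mdim A)" "b * t = 1\<^sub>m (mdim A)"
    unfolding t_def by (simp_all add: mat_ring dims awi mat_char2 x mat_reassoc[OF x(12)])
  have tb: "t * b = (1\<^sub>m (mdim X) + i * w * a') * (j * b)"
    unfolding t_def by (simp add: mat_ring dims)
  have ia: "j * b + i * a = 1\<^sub>m (mdim X)" using x(10) mat_add_comm[of "i * a" "j * b"] by (simp add: dims)
  have "j * b = j * b + i * a + i * a" by (simp add: mat_ring dims mat_char2)
  then have jb: "j * b = 1\<^sub>m (mdim X) + i * a" unfolding ia .
  have "b' * (t * (b * j')) = b' * ((t * b) * j')" by (simp add: mat_assoc dims)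
  also have "\<dots> = 1\<^sub>m (mdim B)"
    unfolding tb jb by (simp add: mat_ring mat_ac dims awi mat_char2 y mat_reassoc[OF y(11)])
  finally have 1: "b' * t * (b * j') = 1\<^sub>m (mdim B)" by (simp add: mat_assoc dims)
  have "(i' * a' + j' * b') * t = t" unfolding y(10) by (simp add: mat_ring dims)
  then have "j' * (b' * t) = t" by (simp add: mat_ring dims at)
  then have 2: "b * j' * (b' * t) = 1\<^sub>m (mdim A)" by (simp add: mat_assoc dims at)
  show ?thesis
    by (rule umod_isoI[OF x(3) y(3) umod_hom_comp[OF x(3,1) y(3) t y(7)] umod_hom_comp[OF y(3,1) x(3) y(5) x(7)] 2 1])
qed

text \<open>In characteristic two \<open>1 + f\<close> is \<open>1 - f\<close>, so this is the
  criterion for a local endomorphism ring; a one-sided inverse of a square matrix is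
  two-sided.\<close>

definition local_umod :: "'k umod \<Rightarrow> bool" where
  "local_umod P \<longleftrightarrow> (\<forall>f. umod_hom P P f \<longrightarrow>
     (\<exists>w. umod_hom P P w \<and> w * f = 1\<^sub>m (mdim P)) \<or> (\<exists>w. umod_hom P P w \<and> w * (1\<^sub>m (mdim P) + f) = 1\<^sub>m (mdim P)))"

text \<open>The blocks satisfy \<open>(a * i') * (a' * i) + ?f = 1\<close>, and locality makes one
  of the two summands left invertible. If it is the first, then \<open>a' * i\<close> is left
  invertible and \<open>biprod_cancel_unit\<close> applies; if it is \<open>?f\<close>, the second
  decomposition is changed to reach this situation.\<close>

lemma biprod_cancel:
  fixes X P A B :: "'k umod"
  assumes 1: "biprod X P A i j a b" and 2: "biprod X P B i' j' a' b'" and "local_umod P"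
  shows "A \<cong>\<^sub>u B"
proof -
  note x = biprodD[OF 1] and y = biprodD[OF 2]
  note dims = x(4-7)[THEN umod_hom_dims(1)] x(4-7)[THEN umod_hom_dims(2)]
    y(4-7)[THEN umod_hom_dims(1)] y(4-7)[THEN umod_hom_dims(2)]
  let ?f = "(a * j') * (b' * i)"
  have h: "umod_hom B P (a * j')" "umod_hom P B (b' * i)" "umod_hom P P (a' * i)" "umod_hom P P (a * i')"
    by (rule umod_hom_comp[OF y(3) x(1,2) y(5) x(6)] umod_hom_comp[OF x(2,1) y(3) x(4) y(7)]
      umod_hom_comp[OF x(2,1,2) x(4) y(6)] umod_hom_comp[OF x(2,1,2) y(4) x(6)])+
  have f: "umod_hom P P ?f" by (rule umod_hom_comp[OF x(2) y(3) x(2) h(2,1)])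
  have "a * ((i' * a' + j' * b') * i) = 1\<^sub>m (mdim P)" unfolding y(10) by (simp add: mat_ring dims x)
  then have sum: "(a * i') * (a' * i) + ?f = 1\<^sub>m (mdim P)" by (simp add: mat_ring dims)
  consider w where "umod_hom P P w" "w * ?f = 1\<^sub>m (mdim P)"
    | w where "umod_hom P P w" "w * (1\<^sub>m (mdim P) + ?f) = 1\<^sub>m (mdim P)"
    using assms(3) f unfolding local_umod_def by blast
  then show ?thesis
  proof cases
    case (1 w)
    note dims = dims umod_hom_dims[OF 1(1)]
    define p where "p = a' * i"
    \<comment> \<open>The projection \<open>a'\<close> will be replaced by
      \<open>a' + y' * b'\<close>. Since \<open>w * (a * j')\<close> is a left inverse of
      \<open>b' * i\<close>, this \<open>y'\<close> turns \<open>a' * i = p\<close> into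
      \<open>p + (1 + p) = 1\<close>.\<close>
    define y' where "y' = (1\<^sub>m (mdim P) + p) * (w * (a * j'))"
    have y': "umod_hom B P y'" unfolding y'_def p_def
      by (rule umod_hom_comp[OF y(3) x(2) x(2)] umod_hom_add umod_hom_one h 1 x y)+
    note dims = dims umod_hom_dims[OF y']
    have "biprod X P B i' (j' + i' * y') (a' + y' * b') b'"
      unfolding biprod_def
    proof (intro conjI)
      show "umod_hom B X (j' + i' * y')" 
        by (rule umod_hom_add[OF y(3,1,5) umod_hom_comp[OF y(3,2,1) y' y(4)]])
      show "umod_hom X P (a' + y' * b')" 
        by (rule umod_hom_add[OF y(1,2,6) umod_hom_comp[OF y(1,3,2) y(7) y']])
      have "i' * (a' + y' * b') + (j' + i' * y') * b' = i' * a' + j' * b'"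
        by (simp add: mat_ring mat_ac dims mat_char2)
      then show "i' * (a' + y' * b') + (j' + i' * y') * b' = 1\<^sub>m (mdim X)" by (simp add: y)
    qed (simp_all add: y mat_ring dims mat_reassoc[OF y(12)])
    moreover have "(a' + y' * b') * i = p + (1\<^sub>m (mdim P) + p) * (w * ?f)"
      unfolding y'_def by (simp add: mat_ring dims p_def)
    then have "1\<^sub>m (mdim P) * ((a' + y' * b') * i) = 1\<^sub>m (mdim P)"
      unfolding 1(2) by (simp add: mat_ring mat_ac dims p_def mat_char2)
    ultimately show ?thesis using biprod_cancel_unit[OF assms(1)] umod_hom_one[OF x(2)] by blast
  next
    case (2 w)
    note dims = dims umod_hom_dims[OF 2(1)]
    have "(a * i') * (a' * i) = 1\<^sub>m (mdim P) + ?f"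
      unfolding sum[symmetric] by (simp add: mat_ring mat_ac dims mat_char2)
    then have "w * ((a * i') * (a' * i)) = 1\<^sub>m (mdim P)" using 2(2) by simp
    then have "w * (a * i') * (a' * i) = 1\<^sub>m (mdim P)" by (simp add: mat_assoc dims)
    then show ?thesis using biprod_cancel_unit[OF assms(1) assms(2)] umod_hom_comp[OF x(2,2,2) h(4) 2(1)] by blast
  qed
qed

lemma dsum_cancel:
  fixes P A B :: "'k umod"
  assumes "P \<oplus>\<^sub>u A \<cong>\<^sub>u P \<oplus>\<^sub>u B" "local_umod P" "is_umod P" "is_umod A" "is_umod B"
  shows "A \<cong>\<^sub>u B"
proof -
  from assms(1) obtain f g where fg: "is_umod (P \<oplus>\<^sub>u A)" "is_umod (P \<oplus>\<^sub>u B)"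
    "umod_hom (P \<oplus>\<^sub>u A) (P \<oplus>\<^sub>u B) f" "umod_hom (P \<oplus>\<^sub>u B) (P \<oplus>\<^sub>u A) g"
    "g * f = 1\<^sub>m (mdim (P \<oplus>\<^sub>u A))" "f * g = 1\<^sub>m (mdim (P \<oplus>\<^sub>u B))" by (rule umod_isoE)
  note b = biprodD[OF biprod_dsum[OF assms(3,5)]]
  let ?i = "inl (mdim P) (mdim B) :: 'k mat" and ?j = "inr (mdim P) (mdim B) :: 'k mat" 
  let ?p = "prl (mdim P) (mdim B) :: 'k mat" and ?q = "prr (mdim P) (mdim B) :: 'k mat" 
  note d = umod_hom_dims[OF fg(3)] umod_hom_dims[OF fg(4)] 
  have "biprod (P \<oplus>\<^sub>u A) P B (g * ?i) (g * ?j) (?p * f) (?q * f)"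
    unfolding biprod_def
  proof (intro conjI)
    have "g * ?i * (?p * f) + g * ?j * (?q * f) = g * ((?i * ?p + ?j * ?q) * f)" 
      by (simp add: mat_ring d)
    then show "g * ?i * (?p * f) + g * ?j * (?q * f) = 1\<^sub>m (mdim (P \<oplus>\<^sub>u A))" 
      unfolding inj_proj_sum using fg(5) by (simp add: mat_ring d)
    show "?p * f * (g * ?i) = 1\<^sub>m (mdim P)" "?q * f * (g * ?j) = 1\<^sub>m (mdim B)"
      using fg(6) by (simp_all add: mat_ring d mat_reassoc[OF fg(6)] inj_proj)
  qed (rule fg assms umod_hom_comp[OF b(2,1) fg(1) b(4) fg(4)] umod_hom_comp[OF b(3,1) fg(1) b(5) fg(4)]
      umod_hom_comp[OF fg(1) b(1,2) fg(3) b(6)] umod_hom_comp[OF fg(1) b(1,3) fg(3) b(7)])+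
  from biprod_cancel[OF biprod_dsum[OF assms(3,4)] this assms(2)] show ?thesis .
qed

end

section \<open>Projective covers and syzygies\<close>

lemma range_umod_submod:
  assumes M: "is_umod M" and N: "is_umod N" and f: "umod_hom M N f"
  shows "is_submod N (range_umod M f)"
  unfolding is_submod_def range_umod_def
proof (intro conjI ballI allI)
  note d = umod_hom_dims[OF f]
  have fc: "f \<in> carrier_mat (mdim N) (mdim M)" by (rule umod_homD(4)[OF f])
  let ?R = "(\<lambda>v. f *\<^sub>v v) ` carrier_vec (mdim M)"
  show "?R \<subseteq> carrier_vec (mdim N)" using fc by auto
  have "f *\<^sub>v 0\<^sub>v (mdim M) = 0\<^sub>v (mdim N)" using fc by (intro eq_vecI) auto
  then show "0\<^sub>v (mdim N) \<in> ?R" by (metis imageI zero_carrier_vec)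
  fix v assume "v \<in> ?R"
  then obtain v' where v: "v' \<in> carrier_vec (mdim M)" "v = f *\<^sub>v v'" by blast
  { fix w assume "w \<in> ?R"
    then obtain w' where w: "w' \<in> carrier_vec (mdim M)" "w = f *\<^sub>v w'" by blast
    have "v + w = f *\<^sub>v (v' + w')" using v w fc by (simp add: mult_add_distrib_mat_vec)
    then show "v + w \<in> ?R" using v w by auto }
  fix x
  have "mact N x *\<^sub>v v = (mact N x * f) *\<^sub>v v'"
    using v d by (simp add: mult_mat_vec_assoc umod_dims[OF N])
  also have "\<dots> = (f * mact M x) *\<^sub>v v'" using umod_homD(3)[OF f] by simp
  also have "\<dots> = f *\<^sub>v (mact M x *\<^sub>v v')" using v d by (simp add: mult_mat_vec_assoc umod_dims[OF M])
  finally show "mact N x *\<^sub>v v \<in> ?R"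
    using mult_mat_vec_carrier[OF is_umodD(1)[OF M] v(1)] by blast
qed

lemma proj_coverD:
  assumes "is_proj_cover P M p"
  shows "is_projective P" "is_umod P" "is_umod M" "umod_hom P M p" "umod_surj P M p" "is_superfluous P (ker_umod P p)"
  using assms by (auto simp: is_proj_cover_def umod_surj_def is_projective_def)

lemma superfluous_range:
  assumes c: "is_proj_cover P M p" and Q: "is_umod Q" and h: "umod_hom Q P h"
    and lift: "\<And>w. w \<in> carrier_vec (mdim P) \<Longrightarrow> \<exists>q. q \<in> carrier_vec (mdim Q) \<and> p *\<^sub>v w = p *\<^sub>v (h *\<^sub>v q)"
  shows "umod_surj Q P h"
proof -
  note c = proj_coverD[OF c]
  have pc: "p \<in> carrier_mat (mdim M) (mdim P)" and hc: "h \<in> carrier_mat (mdim P) (mdim Q)"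
    using c(4) h by (simp_all add: umod_hom_def)
  have "carrier_vec (mdim P) \<subseteq> {w + u |w u. w \<in> range_umod Q h \<and> u \<in> ker_umod P p}"
  proof
    fix w :: "'a vec" assume w: "w \<in> carrier_vec (mdim P)"
    obtain q where q: "q \<in> carrier_vec (mdim Q)" "p *\<^sub>v w = p *\<^sub>v (h *\<^sub>v q)" using lift[OF w] by blast
    have hq: "h *\<^sub>v q \<in> carrier_vec (mdim P)" using hc q(1) by simp
    have "p *\<^sub>v (w - h *\<^sub>v q) = p *\<^sub>v w - p *\<^sub>v (h *\<^sub>v q)"
      using pc w hq by (intro mult_minus_distrib_mat_vec) auto
    also have "\<dots> = 0\<^sub>v (dim_row p)" unfolding q(2) using pc by (intro eq_vecI) auto
    finally have "w - h *\<^sub>v q \<in> ker_umod P p" using w hq by (simp add: ker_umod_def)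
    moreover have "w = h *\<^sub>v q + (w - h *\<^sub>v q)" using w carrier_vecD[OF hq] hc by (intro eq_vecI) auto
    ultimately show "w \<in> {w + u |w u. w \<in> range_umod Q h \<and> u \<in> ker_umod P p}"
      using q(1) unfolding range_umod_def by blast
  qed
  moreover have "range_umod Q h \<subseteq> carrier_vec (mdim P)" using hc by (auto simp: range_umod_def)
  ultimately have "{w + u |w u. w \<in> range_umod Q h \<and> u \<in> ker_umod P p} = carrier_vec (mdim P)"
    unfolding ker_umod_def by (auto 0 3)
  then have "range_umod Q h = carrier_vec (mdim P)"
    using c(6) range_umod_submod[OF Q c(2) h] unfolding is_superfluous_def by blast
  then show ?thesis using h by (simp add: umod_surj_def)
qed

lemma proj_cover_unique:
  assumes c: "is_proj_cover P M p" and c': "is_proj_cover P' M p'"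
  obtains h k where "umod_hom P P' h" "umod_hom P' P k" "k * h = 1\<^sub>m (mdim P)" "h * k = 1\<^sub>m (mdim P')" "p' * h = p"
proof -
  note d = proj_coverD[OF c] and d' = proj_coverD[OF c']
  from d'(5) obtain u' where u': "u' \<in> carrier_mat (mdim P') (mdim M)" "p' * u' = 1\<^sub>m (mdim M)"
    using umod_surj_iff[OF d'(4)] by blast
  obtain h where h: "umod_hom P P' h" "p' * h = p" 
    using projective_lift[OF d(1) d'(2,3,4) u' d(4)] .
  have "umod_surj P P' h"
  proof (rule superfluous_range[OF c' d(2) h(1)])
    fix w :: "'a vec" assume w: "w \<in> carrier_vec (mdim P')"
    then have "p' *\<^sub>v w \<in> range_umod P p"
      using d(5) umod_homD(4)[OF d'(4)] by (auto simp: umod_surj_def)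
    then obtain q where q: "q \<in> carrier_vec (mdim P)" "p' *\<^sub>v w = p *\<^sub>v q" by (auto simp: range_umod_def)
    have "p *\<^sub>v q = p' *\<^sub>v (h *\<^sub>v q)"
      unfolding h(2)[symmetric] using q(1) umod_hom_dims[OF d'(4)] umod_hom_dims[OF h(1)]
      by (intro mult_mat_vec_assoc) auto
    then show "\<exists>q. q \<in> carrier_vec (mdim P) \<and> p' *\<^sub>v w = p' *\<^sub>v (h *\<^sub>v q)" using q by auto
  qed
  then obtain u where u: "u \<in> carrier_mat (mdim P) (mdim P')" "h * u = 1\<^sub>m (mdim P')"
    using umod_surj_iff[OF h(1)] by blast
  obtain k where k: "umod_hom P' P k" "h * k = 1\<^sub>m (mdim P')"
    using projective_lift[OF d'(1) d(2) d'(2) h(1) u umod_hom_one[OF d'(2)]] .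
  note dims = umod_hom_dims[OF h(1)] umod_hom_dims[OF k(1)] umod_hom_dims[OF d(4)] umod_hom_dims[OF d'(4)]
  have pk: "p * k = p'" unfolding h(2)[symmetric] by (simp add: mat_ring dims k(2))
  have "umod_surj P' P k"
  proof (rule superfluous_range[OF c d'(2) k(1)])
    fix w :: "'a vec" assume w: "w \<in> carrier_vec (mdim P)"
    have "p *\<^sub>v (k *\<^sub>v (h *\<^sub>v w)) = (p * k * h) *\<^sub>v w"
      using w by (simp add: mult_mat_vec_assoc dims)
    also have "\<dots> = p *\<^sub>v w" unfolding pk h(2) ..
    finally show "\<exists>q. q \<in> carrier_vec (mdim P') \<and> p *\<^sub>v w = p *\<^sub>v (k *\<^sub>v q)"
      using w umod_homD(4)[OF h(1)] by (metis mult_mat_vec_carrier)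
  qed
  then obtain q where q: "q \<in> carrier_mat (mdim P') (mdim P)" "k * q = 1\<^sub>m (mdim P)"
    using umod_surj_iff[OF k(1)] by blast
  \<comment> \<open>A left inverse and a right inverse of \<open>k\<close> coincide.\<close>
  have "h * (k * q) = q" using q(1) by (simp add: mat_reassoc[OF k(2)] mat_ring dims)
  then have "q = h" unfolding q(2) by (simp add: mat_ring dims)
  then show ?thesis using that[OF h(1) k(1) _ k(2) h(2)] q(2) by simp
qed

lemma proj_cover_iso:
  assumes "is_proj_cover P M p" shows "proj_cover M \<cong>\<^sub>u P"
proof -
  have "\<exists>p'. is_proj_cover (proj_cover M) M p'"
    unfolding proj_cover_def by (rule someI_ex) (use assms in blast)
  then obtain p' where c: "is_proj_cover (proj_cover M) M p'" by blast
  obtain h k where "umod_hom (proj_cover M) P h" "umod_hom P (proj_cover M) k"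
    "k * h = 1\<^sub>m (mdim (proj_cover M))" "h * k = 1\<^sub>m (mdim P)"
    by (rule proj_cover_unique[OF c assms])
  then show ?thesis by (rule umod_isoI[OF proj_coverD(2)[OF c] proj_coverD(2)[OF assms]])
qed

context char_two
begin

text \<open>Translates the exactness used in \<open>Omega\<close>, which speaks of sets of vectors,
  into splittings: \<open>1 + u * p\<close> maps into the kernel of \<open>p\<close>, hence factors
  through \<open>e\<close>, and the factor is \<open>v\<close>.\<close>

lemma exact_imp_ses:
  fixes K P M :: "'k umod"
  assumes K: "is_umod K" and P: "is_umod P" and M: "is_umod M" and e: "umod_inj K P e" and p: "umod_surj P M p"
    and exact: "range_umod K e = ker_umod P p"
  obtains u v where "ses K P M e p u v"
proof -
  have eh: "umod_hom K P e" and ph: "umod_hom P M p" using e p by (auto simp: umod_inj_def umod_surj_def)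
  obtain u where u: "u \<in> carrier_mat (mdim P) (mdim M)" "p * u = 1\<^sub>m (mdim M)"
    using p umod_surj_iff[OF ph] by blast
  note d = umod_hom_dims[OF eh] umod_hom_dims[OF ph] carrier_matD[OF u(1)]
  let ?d = "1\<^sub>m (mdim P) + u * p"
  have pd: "p * ?d = 0\<^sub>m (mdim M) (mdim P)" by (simp add: mat_ring d mat_reassoc[OF u(2)] mat_char2)
  have dc: "?d \<in> carrier_mat (mdim P) (mdim P)" by (auto simp: d intro: carrier_matI)
  have "?d *\<^sub>v w \<in> (\<lambda>v. e *\<^sub>v v) ` carrier_vec (mdim K)" if w: "w \<in> carrier_vec (mdim P)" for w
  proof -
    have "p *\<^sub>v (?d *\<^sub>v w) = (p * ?d) *\<^sub>v w" using w d by (intro mult_mat_vec_assoc[symmetric]) auto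
    also have "\<dots> = 0\<^sub>v (dim_row p)" unfolding pd using w by (intro eq_vecI) (auto simp: d)
    finally have "?d *\<^sub>v w \<in> ker_umod P p" using mult_mat_vec_carrier[OF dc w] by (simp add: ker_umod_def)
    then show ?thesis using exact unfolding range_umod_def by blast
  qed
  from mat_factor[OF umod_homD(4)[OF eh] dc this] 
  obtain v where v: "v \<in> carrier_mat (mdim K) (mdim P)" "e * v = ?d" .
  note d = d carrier_matD[OF v(1)]
  have pe: "p * e = 0\<^sub>m (mdim M) (mdim K)"
  proof (rule mat_vec_eqI)
    fix w :: "'k vec" assume w: "w \<in> carrier_vec (mdim K)"
    then have "e *\<^sub>v w \<in> ker_umod P p" using exact unfolding range_umod_def by blast
    then have "p *\<^sub>v (e *\<^sub>v w) = 0\<^sub>v (mdim M)" by (simp add: ker_umod_def d)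
    moreover have "0\<^sub>m (mdim M) (mdim K) *\<^sub>v w = 0\<^sub>v (mdim M)" using w by (intro eq_vecI) auto
    ultimately show "p * e *\<^sub>v w = 0\<^sub>m (mdim M) (mdim K) *\<^sub>v w"
      using w d by (simp add: mult_mat_vec_assoc)
  qed (auto simp: d intro: carrier_matI)
  have eve: "e * (v * e) = e"
    using mat_reassoc[OF v(2), of e] by (simp add: mat_ring d pe)
  have "v * e = 1\<^sub>m (mdim K)"
  proof (rule mat_vec_eqI)
    fix w :: "'k vec" assume w: "w \<in> carrier_vec (mdim K)"
    have "e *\<^sub>v ((v * e) *\<^sub>v w) = (e * (v * e)) *\<^sub>v w" using w by (intro mult_mat_vec_assoc[symmetric]) (auto simp: d)
    then have "e *\<^sub>v ((v * e) *\<^sub>v w) = e *\<^sub>v w" unfolding eve .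
    moreover have "(v * e) *\<^sub>v w \<in> carrier_vec (mdim K)"
      by (rule mult_mat_vec_carrier[OF carrier_matI w]) (simp_all add: d)
    ultimately have "(v * e) *\<^sub>v w = w" using e w by (auto simp: umod_inj_def dest: inj_onD)
    then show "v * e *\<^sub>v w = 1\<^sub>m (mdim K) *\<^sub>v w" using w by simp
  qed (auto simp: d intro: carrier_matI)
  moreover have "u * p + e * v = 1\<^sub>m (mdim P)" unfolding v(2) by (simp add: mat_ring mat_ac d mat_char2)
  ultimately show ?thesis using that[of u v] K P M eh ph u v(1) pe by (simp add: ses_def)
qed

lemma ses_exact:
  fixes K P M :: "'k umod"
  assumes "ses K P M e p u v"
  shows "umod_inj K P e" "umod_surj P M p" "range_umod K e = ker_umod P p"
proof -
  note s = sesD[OF assms]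
  have v0: "0\<^sub>m (mdim M) n *\<^sub>v w = 0\<^sub>v (mdim M)" if "w \<in> carrier_vec n" for w :: "'k vec" and n
    using that by (intro eq_vecI) auto
  have "x = y" if "x \<in> carrier_vec (mdim K)" "y \<in> carrier_vec (mdim K)" "e *\<^sub>v x = e *\<^sub>v y" for x y
  proof -
    have "(v * e) *\<^sub>v x = (v * e) *\<^sub>v y" using that by (simp add: mult_mat_vec_assoc s(10-17))
    then show ?thesis using that by (simp add: s(7))
  qed
  then show "umod_inj K P e" using s(4) by (auto simp: umod_inj_def inj_on_def)
  show "umod_surj P M p" using umod_surj_iff[OF s(5)] s carrier_matI by blast
  show "range_umod K e = ker_umod P p"
  proof (intro equalityI subsetI)
    fix w assume "w \<in> range_umod K e"
    then obtain x where x: "x \<in> carrier_vec (mdim K)" "w = e *\<^sub>v x" by (auto simp: range_umod_def)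
    have "p *\<^sub>v w = (p * e) *\<^sub>v x" using x by (simp add: mult_mat_vec_assoc s(10-17))
    then show "w \<in> ker_umod P p" using x umod_homD(4)[OF s(4)] by (simp add: ker_umod_def s(8,16) v0)
  next
    fix w assume "w \<in> ker_umod P p"
    then have w: "w \<in> carrier_vec (mdim P)" "p *\<^sub>v w = 0\<^sub>v (mdim M)" by (auto simp: ker_umod_def s(16))
    have "w = (u * p + e * v) *\<^sub>v w" using w by (simp add: s(9))
    also have "\<dots> = u *\<^sub>v (p *\<^sub>v w) + e *\<^sub>v (v *\<^sub>v w)"
      using w(1) by (subst add_mult_distrib_mat_vec[of _ "mdim P" "mdim P"])
        (auto simp: mult_mat_vec_assoc s(10-17) intro!: carrier_matI)
    also have "u *\<^sub>v (p *\<^sub>v w) = 0\<^sub>v (mdim P)" unfolding w(2) by (intro eq_vecI) (auto simp: s(10,11) scalar_prod_def)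
    also have "0\<^sub>v (mdim P) + e *\<^sub>v (v *\<^sub>v w) = e *\<^sub>v (v *\<^sub>v w)"
      by (intro eq_vecI) (auto simp: s(14))
    finally show "w \<in> range_umod K e"
      using mult_mat_vec_carrier[OF carrier_matI[OF s(12,13)] w(1)] unfolding range_umod_def by blast
  qed
qed

text \<open>The module chosen by \<open>Omega\<close> belongs to some projective cover, and the
  isomorphism of that cover with the given one restricts to the kernels.\<close>

lemma Omega_iso:
  fixes K P M :: "'k umod"
  assumes c: "is_proj_cover P M p" and s: "ses K P M e p u v"
  shows "Omega M \<cong>\<^sub>u K"
proof -
  let ?ex = "\<lambda>K. \<exists>P p e. is_proj_cover P M p \<and> is_umod K \<and> umod_inj K P e \<and> range_umod K e = ker_umod P p"
  have "?ex K" using c ses_exact[OF s] sesD[OF s] by blast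
  then have "?ex (Omega M)" unfolding Omega_def by (rule someI)
  then obtain P' p' e' where c': "is_proj_cover P' M p'" and e': "is_umod (Omega M)" "umod_inj (Omega M) P' e'"
    "range_umod (Omega M) e' = ker_umod P' p'" by blast
  note d' = proj_coverD[OF c']
  obtain u' v' where s': "ses (Omega M) P' M e' p' u' v'"
    using exact_imp_ses[OF e'(1) d'(2,3) e'(2) d'(5) e'(3)] .
  note x = sesD[OF s] and y = sesD[OF s']
  obtain h k where h: "umod_hom P P' h" "umod_hom P' P k"
    "k * h = 1\<^sub>m (mdim P)" "h * k = 1\<^sub>m (mdim P')" "p' * h = p"
    using proj_cover_unique[OF c c'] .
  note dims = x(10-17) y(10-17) umod_hom_dims[OF h(1)] umod_hom_dims[OF h(2)]
  have pk: "p * k = p'" unfolding h(5)[symmetric] by (simp add: mat_ring dims h(4))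
  have he: "umod_hom K P' (h * e)" by (rule umod_hom_comp[OF x(1,2) y(2) x(4) h(1)])
  have "p' * (h * e) = 0\<^sub>m (mdim M) (mdim K)" by (simp add: mat_reassoc[OF h(5)] dims x)
  note F = ses_factor[OF s' x(1) he this]
  have ke: "umod_hom (Omega M) P (k * e')" by (rule umod_hom_comp[OF y(1,2) x(2) y(4) h(2)])
  have "p * (k * e') = 0\<^sub>m (mdim M) (mdim (Omega M))" by (simp add: mat_reassoc[OF pk] dims y)
  note G = ses_factor[OF s y(1) ke this]
  have "v * (k * e') * (v' * (h * e)) = v * (k * (e' * (v' * (h * e))))" by (simp add: mat_assoc dims)
  also have "\<dots> = 1\<^sub>m (mdim K)" unfolding F(1) by (simp add: mat_reassoc[OF h(3)] mat_ring dims x)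
  finally have 1: "v * (k * e') * (v' * (h * e)) = 1\<^sub>m (mdim K)" .
  have "v' * (h * e) * (v * (k * e')) = v' * (h * (e * (v * (k * e'))))" by (simp add: mat_assoc dims)
  also have "\<dots> = 1\<^sub>m (mdim (Omega M))" unfolding G(1) by (simp add: mat_reassoc[OF h(4)] mat_ring dims y)
  finally have 2: "v' * (h * e) * (v * (k * e')) = 1\<^sub>m (mdim (Omega M))" .
  show ?thesis by (rule umod_isoI[OF y(1) x(1) G(2) F(2) 2 1])
qed

end

section \<open>Tensor products\<close>

lemma mact_relations:
  assumes M: "is_umod M"
  defines "A \<equiv> mact M (um_gen Ga)" and "B \<equiv> mact M (um_gen Gb)" and "C \<equiv> mact M (um_gen Gc)"
  shows "A * B + B * A = C" "A * C + C * A = A" "B * C + C * B = B"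
    "A * (A * (A * A)) = 0\<^sub>m (mdim M) (mdim M)" "B * (B * (B * B)) = 0\<^sub>m (mdim M) (mdim M)" 
    "C * C + C = 0\<^sub>m (mdim M) (mdim M)"
  unfolding A_def B_def C_def is_umodD(5,6)[OF M, symmetric] is_umodD(8)[OF M, symmetric] um_relations
  by (rule refl)+

lemma is_umod_of_mact_relations:
  assumes "\<And>g. \<rho> g \<in> carrier_mat n n"
      "\<rho> Ga * \<rho> Gb + \<rho> Gb * \<rho> Ga = \<rho> Gc"
      "\<rho> Ga * \<rho> Gc + \<rho> Gc * \<rho> Ga = \<rho> Ga"
      "\<rho> Gb * \<rho> Gc + \<rho> Gc * \<rho> Gb = \<rho> Gb"
      "\<rho> Ga * (\<rho> Ga * (\<rho> Ga * \<rho> Ga)) = 0\<^sub>m n n"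
      "\<rho> Gb * (\<rho> Gb * (\<rho> Gb * \<rho> Gb)) = 0\<^sub>m n n"
      "\<rho> Gc * \<rho> Gc + \<rho> Gc = 0\<^sub>m n n"
  shows "is_umod (umod_of n \<rho>)" "mact (umod_of n \<rho>) (um_gen g) = \<rho> g"
  by (rule is_umod_umod_of mact_umod_of_gen; rule assms)+

lemma mdim_umod_of [simp]: "mdim (umod_of n \<rho>) = n"
  by (simp add: umod_of_def)

lemma mdim_tensor [simp]: "mdim (M \<otimes>\<^sub>u N) = mdim M * mdim N"
  by (simp add: tensor_def)

context char_two
begin

text \<open>The mixed terms in the product of two generators are symmetric in them. They cancel in
  \<open>g h + h g\<close> and in squares, so squares, and with them fourth powers, are additive
  over the two factors and the relations carry over.\<close>

lemma tensor_umod: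
  fixes M N :: "'k umod"
  assumes M: "is_umod M" and N: "is_umod N"
  shows "is_umod (M \<otimes>\<^sub>u N)"
    "mact (M \<otimes>\<^sub>u N) (um_gen g) = kron (mact M (um_gen g)) (1\<^sub>m (mdim N)) + kron (1\<^sub>m (mdim M)) (mact N (um_gen g))"
proof -
  let ?n = "mdim M" and ?m = "mdim N"
  let ?\<rho> = "\<lambda>g. kron (mact M (um_gen g)) (1\<^sub>m ?m) + kron (1\<^sub>m ?n) (mact N (um_gen g))"
  note dims = umod_dims[OF M] umod_dims[OF N]
  have c: "?\<rho> g \<in> carrier_mat (?n * ?m) (?n * ?m)" for g
    by (intro carrier_matI) (simp_all add: dims)
  have mul: "?\<rho> g * ?\<rho> h = kron (mact M (um_gen g) * mact M (um_gen h)) (1\<^sub>m ?m) +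
     (kron (1\<^sub>m ?n) (mact N (um_gen g) * mact N (um_gen h)) + 
      (kron (mact M (um_gen g)) (mact N (um_gen h)) + kron (mact M (um_gen h)) (mact N (um_gen g))))" for g h
    by (simp add: mat_ring mat_ac dims kron_mult)
  have sq: "?\<rho> g * ?\<rho> g = kron (mact M (um_gen g) * mact M (um_gen g)) (1\<^sub>m ?m) + kron (1\<^sub>m ?n) (mact N (um_gen g) * mact N (um_gen g))" for g
    unfolding mul by (simp add: mat_ring dims mat_char2)
  have comm: "?\<rho> g * ?\<rho> h + ?\<rho> h * ?\<rho> g = 
    kron (mact M (um_gen g) * mact M (um_gen h) + mact M (um_gen h) * mact M (um_gen g)) (1\<^sub>m ?m) +
    kron (1\<^sub>m ?n) (mact N (um_gen g) * mact N (um_gen h) + mact N (um_gen h) * mact N (um_gen g))" for g h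
    unfolding mul by (simp add: mat_ring mat_ac dims kron_add_left kron_add_right mat_char2)
  have four: "?\<rho> g * (?\<rho> g * (?\<rho> g * ?\<rho> g)) = 
     kron (mact M (um_gen g) * (mact M (um_gen g) * (mact M (um_gen g) * mact M (um_gen g)))) (1\<^sub>m ?m) +
     kron (1\<^sub>m ?n) (mact N (um_gen g) * (mact N (um_gen g) * (mact N (um_gen g) * mact N (um_gen g))))" for g
  proof -
    have "?\<rho> g * (?\<rho> g * (?\<rho> g * ?\<rho> g)) = (?\<rho> g * ?\<rho> g) * (?\<rho> g * ?\<rho> g)"
      by (rule mat_assoc[symmetric]) (simp_all add: dims)
    also have "\<dots> = kron (mact M (um_gen g) * (mact M (um_gen g) * (mact M (um_gen g) * mact M (um_gen g)))) (1\<^sub>m ?m) +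
     kron (1\<^sub>m ?n) (mact N (um_gen g) * (mact N (um_gen g) * (mact N (um_gen g) * mact N (um_gen g))))"
      unfolding sq by (simp add: mat_ring mat_ac dims kron_mult mat_char2)
    finally show ?thesis .
  qed
  have z: "0\<^sub>m (?n * ?m) (?n * ?m) + 0\<^sub>m (?n * ?m) (?n * ?m) = (0\<^sub>m (?n * ?m) (?n * ?m) :: 'k mat)"
    by (simp add: mat_ring)
  have rel: "?\<rho> Ga * ?\<rho> Gb + ?\<rho> Gb * ?\<rho> Ga = ?\<rho> Gc" "?\<rho> Ga * ?\<rho> Gc + ?\<rho> Gc * ?\<rho> Ga = ?\<rho> Ga"
    "?\<rho> Gb * ?\<rho> Gc + ?\<rho> Gc * ?\<rho> Gb = ?\<rho> Gb"
    "?\<rho> Ga * (?\<rho> Ga * (?\<rho> Ga * ?\<rho> Ga)) = 0\<^sub>m (?n * ?m) (?n * ?m)" 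
    "?\<rho> Gb * (?\<rho> Gb * (?\<rho> Gb * ?\<rho> Gb)) = 0\<^sub>m (?n * ?m) (?n * ?m)"
    unfolding comm four mact_relations[OF M] mact_relations[OF N] kron_zero_left kron_zero_right
    by (simp_all add: z)
  have "?\<rho> Gc * ?\<rho> Gc + ?\<rho> Gc = kron (mact M (um_gen Gc) * mact M (um_gen Gc) + mact M (um_gen Gc)) (1\<^sub>m ?m) 
    + kron (1\<^sub>m ?n) (mact N (um_gen Gc) * mact N (um_gen Gc) + mact N (um_gen Gc))"
    unfolding sq by (simp add: mat_ring mat_ac dims kron_add_left kron_add_right)
  also have "\<dots> = 0\<^sub>m (?n * ?m) (?n * ?m)"
    unfolding mact_relations[OF M] mact_relations[OF N] kron_zero_left kron_zero_right by (simp add: z)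
  finally have "?\<rho> Gc * ?\<rho> Gc + ?\<rho> Gc = 0\<^sub>m (?n * ?m) (?n * ?m)" .
  note * = is_umod_of_mact_relations[of ?\<rho>, OF c rel this]
  show "is_umod (M \<otimes>\<^sub>u N)" unfolding tensor_def by (rule *)
  show "mact (M \<otimes>\<^sub>u N) (um_gen g) = ?\<rho> g" unfolding tensor_def by (rule *)
qed

lemma tensor_hom:
  fixes M N M' N' :: "'k umod"
  assumes "is_umod M" "is_umod N" "is_umod M'" "is_umod N'" and f: "umod_hom M M' f" and g: "umod_hom N N' g"
  shows "umod_hom (M \<otimes>\<^sub>u N) (M' \<otimes>\<^sub>u N') (kron f g)"
proof (rule umod_hom_genI)
  note d = umod_hom_dims[OF f] umod_hom_dims[OF g] assms(1-4)[THEN umod_dims(1)] assms(1-4)[THEN umod_dims(2)]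
  show "kron f g \<in> carrier_mat (mdim (M' \<otimes>\<^sub>u N')) (mdim (M \<otimes>\<^sub>u N))"
    by (intro carrier_matI) (simp_all add: d)
  fix x
  show "kron f g * mact (M \<otimes>\<^sub>u N) (um_gen x) = mact (M' \<otimes>\<^sub>u N') (um_gen x) * kron f g"
    unfolding tensor_umod(2)[OF assms(1,2)] tensor_umod(2)[OF assms(3,4)]
    by (simp add: mat_ring d kron_mult umod_homD(3)[OF f] umod_homD(3)[OF g])
qed (rule tensor_umod assms)+

lemma tensor_cong:
  fixes M N :: "'k umod"
  assumes "M \<cong>\<^sub>u M'" "N \<cong>\<^sub>u N'"
  shows "M \<otimes>\<^sub>u N \<cong>\<^sub>u M' \<otimes>\<^sub>u N'"
proof -
  from assms(1) obtain f f' where f: "is_umod M" "is_umod M'" "umod_hom M M' f" "umod_hom M' M f'"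
    "f' * f = 1\<^sub>m (mdim M)" "f * f' = 1\<^sub>m (mdim M')" by (rule umod_isoE)
  from assms(2) obtain g g' where g: "is_umod N" "is_umod N'" "umod_hom N N' g" "umod_hom N' N g'"
    "g' * g = 1\<^sub>m (mdim N)" "g * g' = 1\<^sub>m (mdim N')" by (rule umod_isoE)
  note d = f(3,4)[THEN umod_hom_dims(1)] g(3,4)[THEN umod_hom_dims(1)] f(3,4)[THEN umod_hom_dims(2)] g(3,4)[THEN umod_hom_dims(2)]
  show ?thesis
    by (rule umod_isoI[of _ _ "kron f g" "kron f' g'"])
      (simp_all add: tensor_umod tensor_hom f g d kron_mult kron_one)
qed

lemma biprod_tensor_left:
  fixes X A B N :: "'k umod"
  assumes b: "biprod X A B i j p q" and N: "is_umod N"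
  shows "biprod (X \<otimes>\<^sub>u N) (A \<otimes>\<^sub>u N) (B \<otimes>\<^sub>u N) (kron i (1\<^sub>m (mdim N))) (kron j (1\<^sub>m (mdim N)))
    (kron p (1\<^sub>m (mdim N))) (kron q (1\<^sub>m (mdim N)))"
proof -
  note b = biprodD[OF b]
  note d = b(4-7)[THEN umod_hom_dims(1)] b(4-7)[THEN umod_hom_dims(2)]
  have "kron (i * p) (1\<^sub>m (mdim N)) + kron (j * q) (1\<^sub>m (mdim N)) = kron (i * p + j * q) (1\<^sub>m (mdim N))"
    by (rule kron_add_left[symmetric]) (simp_all add: d)
  then show ?thesis unfolding b(10)
    by (simp add: biprod_def tensor_umod tensor_hom umod_hom_one N b d kron_mult kron_one mat_one_left)
qed

lemma dsum_tensor:
  fixes A B N :: "'k umod"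
  assumes "is_umod A" "is_umod B" "is_umod N"
  shows "(A \<oplus>\<^sub>u B) \<otimes>\<^sub>u N \<cong>\<^sub>u A \<otimes>\<^sub>u N \<oplus>\<^sub>u B \<otimes>\<^sub>u N"
  by (rule biprod_dsum_iso[OF biprod_tensor_left[OF biprod_dsum]]) (rule assms)+

lemma ses_tensor_left:
  fixes K Q M N :: "'k umod"
  assumes s: "ses K Q M e p u v" and N: "is_umod N"
  shows "ses (K \<otimes>\<^sub>u N) (Q \<otimes>\<^sub>u N) (M \<otimes>\<^sub>u N) (kron e (1\<^sub>m (mdim N))) (kron p (1\<^sub>m (mdim N)))
    (kron u (1\<^sub>m (mdim N))) (kron v (1\<^sub>m (mdim N)))"
proof -
  note s = sesD[OF s]
  have "kron (u * p) (1\<^sub>m (mdim N)) + kron (e * v) (1\<^sub>m (mdim N)) = kron (u * p + e * v) (1\<^sub>m (mdim N))"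
    by (rule kron_add_left[symmetric]) (simp_all add: s(10-17))
  then show ?thesis unfolding s(9)
    by (auto simp: ses_def tensor_umod tensor_hom umod_hom_one N s kron_mult kron_one mat_one_left kron_zero_left intro!: carrier_matI)
qed

lemma ses_tensor_right:
  fixes K Q M N :: "'k umod"
  assumes s: "ses K Q M e p u v" and N: "is_umod N"
  shows "ses (N \<otimes>\<^sub>u K) (N \<otimes>\<^sub>u Q) (N \<otimes>\<^sub>u M) (kron (1\<^sub>m (mdim N)) e) (kron (1\<^sub>m (mdim N)) p)
    (kron (1\<^sub>m (mdim N)) u) (kron (1\<^sub>m (mdim N)) v)"
proof -
  note s = sesD[OF s]
  have "kron (1\<^sub>m (mdim N)) (u * p) + kron (1\<^sub>m (mdim N)) (e * v) = kron (1\<^sub>m (mdim N)) (u * p + e * v)"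
    by (rule kron_add_right[symmetric]) (simp_all add: s(10-17))
  then show ?thesis unfolding s(9)
    by (auto simp: ses_def tensor_umod tensor_hom umod_hom_one N s kron_mult kron_one mat_one_left kron_zero_right intro!: carrier_matI)
qed

lemma tensor_comm:
  fixes M N :: "'k umod"
  assumes M: "is_umod M" and N: "is_umod N"
  shows "M \<otimes>\<^sub>u N \<cong>\<^sub>u N \<otimes>\<^sub>u M"
proof -
  let ?n = "mdim M" and ?m = "mdim N"
  have hom: "umod_hom (A \<otimes>\<^sub>u B) (B \<otimes>\<^sub>u A) (kron_flip (mdim A) (mdim B))" 
    if A: "is_umod A" and B: "is_umod B" for A B :: "'k umod"
  proof (rule umod_hom_genI)
    note d = umod_dims[OF A] umod_dims[OF B]
    show "kron_flip (mdim A) (mdim B) \<in> carrier_mat (mdim (B \<otimes>\<^sub>u A)) (mdim (A \<otimes>\<^sub>u B))"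
      by (simp add: kron_flip_def)
    then have kd: "dim_row (kron_flip (mdim A) (mdim B) :: 'k mat) = mdim B * mdim A" 
      "dim_col (kron_flip (mdim A) (mdim B) :: 'k mat) = mdim A * mdim B" by (auto simp: kron_flip_def)
    fix g
    have "kron_flip (mdim A) (mdim B) * kron (mact A (um_gen g)) (1\<^sub>m (mdim B)) = kron (1\<^sub>m (mdim B)) (mact A (um_gen g)) * kron_flip (mdim A) (mdim B)"
      "kron_flip (mdim A) (mdim B) * kron (1\<^sub>m (mdim A)) (mact B (um_gen g)) = kron (mact B (um_gen g)) (1\<^sub>m (mdim A)) * kron_flip (mdim A) (mdim B)"
      by (rule kron_flip; simp add: is_umodD[OF A] is_umodD[OF B])+
    then show "kron_flip (mdim A) (mdim B) * mact (A \<otimes>\<^sub>u B) (um_gen g) = mact (B \<otimes>\<^sub>u A) (um_gen g) * kron_flip (mdim A) (mdim B)"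
      unfolding tensor_umod(2)[OF A B] tensor_umod(2)[OF B A] by (simp add: mat_ring mat_ac d kd)
  qed (rule tensor_umod that)+
  show ?thesis
    by (rule umod_isoI[OF tensor_umod(1)[OF M N] tensor_umod(1)[OF N M] hom[OF M N] hom[OF N M]])
      (simp_all add: kron_flip_inverse mult.commute)
qed

end

section \<open>Multiples of a module\<close>

lemma is_umod_copies: "is_umod M \<Longrightarrow> is_umod (copies n M)"
  by (induction n) (simp_all add: is_umod_zero is_umod_dsum)

lemma mdim_copies [simp]: "mdim (copies n M) = n * mdim M"
  by (induction n) (simp_all add: zero_umod_def)

text \<open>In the chosen index order the identity on the left gives a block diagonal matrix, which
  matches the nested direct sums of \<open>copies\<close>.\<close>

lemma kron_one_Suc:
  assumes "A \<in> carrier_mat k m"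
  shows "kron (1\<^sub>m (Suc n)) A = four_block_mat A (0\<^sub>m k (n * m)) (0\<^sub>m (n * k) m) (kron (1\<^sub>m n) A)"
proof (rule eq_matI)
  fix i j
  assume "i < dim_row (four_block_mat A (0\<^sub>m k (n * m)) (0\<^sub>m (n * k) m) (kron (1\<^sub>m n) A))"
    "j < dim_col (four_block_mat A (0\<^sub>m k (n * m)) (0\<^sub>m (n * k) m) (kron (1\<^sub>m n) A))"
  then have ij: "i < Suc n * k" "j < Suc n * m" using assms by auto
  have pos: "0 < k" "0 < m" using ij by (auto intro: gr0I)
  have *: "(i div k = 0) = (i < k)" "(j div m = 0) = (j < m)" 
    using pos by (auto simp: div_eq_0_iff)
  have **: "i div k = Suc ((i - k) div k)" "i mod k = (i - k) mod k" if "\<not> i < k"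
    using that ij by (auto simp: le_div_geq le_mod_geq not_less pos)
  have ***: "j div m = Suc ((j - m) div m)" "j mod m = (j - m) mod m" if "\<not> j < m"
    using that ij by (auto simp: le_div_geq le_mod_geq not_less pos)
  have ki: "i div k < Suc n" "i mod k < k" "j div m < Suc n" "j mod m < m"
    using div_mod_less[OF ij(1)] div_mod_less[OF ij(2)] by simp_all
  show "kron (1\<^sub>m (Suc n)) A $$ (i, j) = four_block_mat A (0\<^sub>m k (n * m)) (0\<^sub>m (n * k) m) (kron (1\<^sub>m n) A) $$ (i, j)"
    using assms ij ki by (cases "i < k"; cases "j < m") (simp_all add: * ** ***)
qed (use assms in auto)

lemma mact_copies:
  assumes M: "is_umod M"
  shows "mact (copies n M) x = kron (1\<^sub>m n) (mact M x)"
proof (induction n)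
  case 0
  then show ?case using umod_dims[OF M] by (auto simp: zero_umod_def intro!: eq_matI)
next
  case (Suc n)
  show ?case using kron_one_Suc[OF is_umodD(1)[OF M], of n x] Suc by (simp add: dsum_def)
qed

lemma copies_cong: "M \<cong>\<^sub>u N \<Longrightarrow> copies n M \<cong>\<^sub>u copies n N"
  by (induction n) (simp_all add: umod_iso_refl is_umod_zero dsum_cong)

lemma projective_copies: "is_projective P \<Longrightarrow> is_projective (copies n P)"
  by (induction n) (simp_all add: projective_zero projective_dsum)

lemma copies_add:
  assumes M: "is_umod M"
  shows "copies (n + m) M \<cong>\<^sub>u copies n M \<oplus>\<^sub>u copies m M"
proof (induction n)
  case 0
  show ?case using umod_iso_sym[OF dsum_zero_left[OF is_umod_copies[OF M]]] by simp
next
  case (Suc n)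
  have "copies (Suc n + m) M \<cong>\<^sub>u M \<oplus>\<^sub>u (copies n M \<oplus>\<^sub>u copies m M)"
    using dsum_cong[OF umod_iso_refl[OF M] Suc] by simp
  also have "\<dots> \<cong>\<^sub>u (M \<oplus>\<^sub>u copies n M) \<oplus>\<^sub>u copies m M"
    by (rule umod_iso_sym[OF dsum_assoc]) (simp_all add: M is_umod_copies)
  finally show ?case by simp
qed

lemma (in char_two) copies_tensor:
  fixes M N :: "'k umod"
  assumes M: "is_umod M" and N: "is_umod N"
  shows "copies n M \<otimes>\<^sub>u N \<cong>\<^sub>u copies n (M \<otimes>\<^sub>u N)"
proof (induction n)
  case 0
  show ?case
  proof (rule umod_iso_genI)
    show "mact (copies 0 M \<otimes>\<^sub>u N) (um_gen g) = mact (copies 0 (M \<otimes>\<^sub>u N)) (um_gen g)" for g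
      using umod_dims[OF tensor_umod(1)[OF is_umod_zero N]] umod_dims[OF is_umod_zero]
      by (intro eq_matI) (simp_all add: zero_umod_def)
  qed (simp_all add: is_umod_zero tensor_umod N, simp add: zero_umod_def)
next
  case (Suc n)
  have "copies (Suc n) M \<otimes>\<^sub>u N \<cong>\<^sub>u M \<otimes>\<^sub>u N \<oplus>\<^sub>u copies n M \<otimes>\<^sub>u N"
    by (simp add: dsum_tensor M N is_umod_copies)
  also have "\<dots> \<cong>\<^sub>u M \<otimes>\<^sub>u N \<oplus>\<^sub>u copies n (M \<otimes>\<^sub>u N)"
    by (rule dsum_cong[OF umod_iso_refl[OF tensor_umod(1)[OF M N]] Suc])
  finally show ?case by simp
qed

lemma (in char_two) tensor_copies:
  fixes M N :: "'k umod"
  assumes M: "is_umod M" and N: "is_umod N"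
  shows "N \<otimes>\<^sub>u copies n M \<cong>\<^sub>u copies n (N \<otimes>\<^sub>u M)"
proof -
  have "N \<otimes>\<^sub>u copies n M \<cong>\<^sub>u copies n M \<otimes>\<^sub>u N" by (rule tensor_comm) (simp_all add: M N is_umod_copies)
  also have "\<dots> \<cong>\<^sub>u copies n (M \<otimes>\<^sub>u N)" by (rule copies_tensor[OF M N])
  also have "\<dots> \<cong>\<^sub>u copies n (N \<otimes>\<^sub>u M)" by (rule copies_cong[OF tensor_comm[OF M N]])
  finally show ?thesis .
qed

section \<open>Sparse matrices over the prime field\<close>

text \<open>A matrix with entries in \<open>{0, 1}\<close> is given by the list of its columns, a column by the list of
  the positions of its nonzero entries. Entries may be repeated; only parities matter. This makes
  the verification of concrete matrix identities a computation with natural numbers.\<close>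

type_synonym cols = "nat list list"

definition spm :: "nat \<Rightarrow> cols \<Rightarrow> 'k::field mat" where
  "spm n X = mat n (length X) (\<lambda>(i, j). of_nat (count_list (X ! j) i))"

definition bounded_cols :: "nat \<Rightarrow> cols \<Rightarrow> bool" where
  "bounded_cols n X \<longleftrightarrow> list_all (list_all (\<lambda>i. i < n)) X"

definition cols_add :: "cols \<Rightarrow> cols \<Rightarrow> cols" where
  "cols_add X Y = map2 (@) X Y"

definition cols_mult :: "cols \<Rightarrow> cols \<Rightarrow> cols" where
  "cols_mult X Y = map (\<lambda>y. concat (map ((!) X) y)) Y"

definition cols_kron :: "nat \<Rightarrow> cols \<Rightarrow> cols \<Rightarrow> cols" where
  "cols_kron m X Y = concat (map (\<lambda>x. map (\<lambda>y. concat (map (\<lambda>i. map (\<lambda>k. i * m + k) y) x)) Y) X)"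

definition cols_dsum :: "nat \<Rightarrow> cols \<Rightarrow> cols \<Rightarrow> cols" where
  "cols_dsum n X Y = X @ map (map ((+) n)) Y"

definition cols_one :: "nat \<Rightarrow> cols" where
  "cols_one n = map (\<lambda>i. [i]) [0..<n]"

fun odd_count :: "nat list \<Rightarrow> nat \<Rightarrow> bool" where
  "odd_count [] i = False"
| "odd_count (k # x) i = ((k = i) \<noteq> odd_count x i)"

text \<open>Only positions that occur in one of the two columns are tested; at all others both
  entries vanish.\<close>

definition cols_eq :: "cols \<Rightarrow> cols \<Rightarrow> bool" where
  "cols_eq X Y \<longleftrightarrow> list_all2 (\<lambda>x y. list_all (\<lambda>i. odd_count x i = odd_count y i) (x @ y)) X Y"

lemma dim_spm [simp]: "dim_row (spm n X) = n" "dim_col (spm n X) = length X"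
  by (simp_all add: spm_def)

lemma spm_carrier [simp]: "spm n X \<in> carrier_mat n (length X)"
  by (simp add: spm_def)

lemma length_cols [simp]:
  "length (cols_add X Y) = min (length X) (length Y)" "length (cols_mult X Y) = length Y"
  "length (cols_kron m X Y) = length X * length Y" "length (cols_dsum n X Y) = length X + length Y"
  "length (cols_one n) = n"
  by (simp_all add: cols_add_def cols_mult_def cols_kron_def cols_dsum_def cols_one_def length_concat
      comp_def sum_list_triv)

lemma spm_add: "length X = length Y \<Longrightarrow> spm n X + spm n Y = spm n (cols_add X Y)"
  by (rule eq_matI) (simp_all add: spm_def cols_add_def)

lemma spm_one: "spm n (cols_one n) = 1\<^sub>m n"
  by (rule eq_matI) (auto simp: spm_def cols_one_def)

lemma count_list_concat_map:
  fixes n :: nat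
  assumes "\<forall>k\<in>set y. k < n"
  shows "count_list (concat (map f y)) i = (\<Sum>k<n. count_list (f k) i * count_list y k)"
  using assms
proof (induction y)
  case (Cons a y)
  have "(\<Sum>k<n. count_list (f k) i * count_list (a # y) k) =
      (\<Sum>k<n. (if k = a then count_list (f a) i else 0) + count_list (f k) i * count_list y k)"
    by (intro sum.cong) (auto simp: algebra_simps)
  also have "\<dots> = count_list (f a) i + (\<Sum>k<n. count_list (f k) i * count_list y k)"
    using Cons.prems by (subst sum.distrib) (simp add: sum.delta)
  finally show ?case using Cons by simp
qed simp

lemma spm_mult:
  assumes "bounded_cols (length X) Y"
  shows "spm n X * spm (length X) Y = spm n (cols_mult X Y)"
proof (rule eq_matI)
  fix i j
  assume "i < dim_row (spm n (cols_mult X Y))" "j < dim_col (spm n (cols_mult X Y))"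
  then have ij: "i < n" "j < length Y" by simp_all
  have "\<forall>k\<in>set (Y ! j). k < length X"
    using assms ij by (auto simp: bounded_cols_def list_all_iff)
  from count_list_concat_map[OF this, of "(!) X" i]
  show "(spm n X * spm (length X) Y) $$ (i, j) = spm n (cols_mult X Y) $$ (i, j)"
    using ij by (simp add: spm_def cols_mult_def scalar_prod_def atLeast0LessThan)
qed auto

lemma nth_concat_const:
  assumes "\<And>x. x \<in> set X \<Longrightarrow> length (f x) = m" "j < length X * m"
  shows "concat (map f X) ! j = f (X ! (j div m)) ! (j mod m)"
  using assms
proof (induction X arbitrary: j)
  case (Cons x X)
  have len: "length (f x) = m" using Cons.prems by simp
  show ?case
  proof (cases "j < m")
    case False
    then have "0 < m" "j - m < length X * m" using Cons.prems(2) by (auto intro: gr0I)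
    then show ?thesis using False Cons.IH[of "j - m"] Cons.prems(1) len
      by (simp add: nth_append le_div_geq le_mod_geq not_less)
  qed (simp add: nth_append len)
qed simp

lemma count_list_map_plus: "count_list (map ((+) c) y) (r::nat) = (if c \<le> r then count_list y (r - c) else 0)"
  by (induction y) auto

lemma count_list_kron:
  fixes m :: nat
  assumes "\<forall>k\<in>set y. k < m" "0 < m"
  shows "count_list (concat (map (\<lambda>i. map (\<lambda>k. i * m + k) y) x)) r = count_list x (r div m) * count_list y (r mod m)"
proof (induction x)
  case (Cons a x)
  have none: "count_list y k = 0" if "\<not> k < m" for k
    using assms(1) that by (auto simp: count_list_0_iff)
  have "count_list (map (\<lambda>k. a * m + k) y) r = (if a = r div m then count_list y (r mod m) else 0)"
  proof (cases "a = r div m")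
    case True
    then show ?thesis by (simp add: count_list_map_plus minus_div_mult_eq_mod)
  next
    case False
    have "count_list y (r - a * m) = 0" if le: "a * m \<le> r"
    proof (rule none)
      show "\<not> r - a * m < m"
      proof
        assume "r - a * m < m"
        then have "r < m * Suc a" using le by (simp add: mult.commute)
        moreover have "m * a \<le> r" using le by (simp add: mult.commute)
        ultimately have "r div m = a" by (intro div_nat_eqI)
        then show False using False by simp
      qed
    qed
    then show ?thesis using False by (simp add: count_list_map_plus)
  qed
  then show ?case using Cons by (simp add: distrib_right)
qed simp

lemma spm_kron:
  assumes "bounded_cols m Y" "0 < m"
  shows "kron (spm n X) (spm m Y) = spm (n * m) (cols_kron m X Y)"
proof (rule eq_matI)
  fix i j
  assume "i < dim_row (spm (n * m) (cols_kron m X Y))" "j < dim_col (spm (n * m) (cols_kron m X Y))"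
  then have ij: "i < n * m" "j < length X * length Y" by simp_all
  note dm = div_mod_less[OF ij(1)] div_mod_less[OF ij(2)]
  have "cols_kron m X Y ! j = concat (map (\<lambda>i. map (\<lambda>k. i * m + k) (Y ! (j mod length Y))) (X ! (j div length Y)))"
    unfolding cols_kron_def using ij(2) dm by (subst nth_concat_const[where m = "length Y"]) auto
  moreover have "\<forall>k\<in>set (Y ! (j mod length Y)). k < m"
    using assms(1) dm by (auto simp: bounded_cols_def list_all_iff)
  ultimately have "count_list (cols_kron m X Y ! j) i = count_list (X ! (j div length Y)) (i div m) * count_list (Y ! (j mod length Y)) (i mod m)"
    using count_list_kron[OF _ assms(2)] by simp
  then show "kron (spm n X) (spm m Y) $$ (i, j) = spm (n * m) (cols_kron m X Y) $$ (i, j)"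
    using ij dm by (simp add: spm_def)
qed auto

lemma spm_dsum:
  assumes "bounded_cols n X"
  shows "four_block_mat (spm n X) (0\<^sub>m n (length Y)) (0\<^sub>m m (length X)) (spm m Y) = spm (n + m) (cols_dsum n X Y)"
proof (rule eq_matI)
  fix i j
  assume "i < dim_row (spm (n + m) (cols_dsum n X Y))" "j < dim_col (spm (n + m) (cols_dsum n X Y))"
  then have ij: "i < n + m" "j < length X + length Y" by simp_all
  have none: "count_list (X ! j) i = 0" if "\<not> i < n" "j < length X"
  proof -
    have "\<forall>k\<in>set (X ! j). k < n"
      using assms nth_mem[OF that(2)] unfolding bounded_cols_def list_all_iff by blast
    then show ?thesis using that(1) by (auto simp: count_list_0_iff)
  qed
  show "four_block_mat (spm n X) (0\<^sub>m n (length Y)) (0\<^sub>m m (length X)) (spm m Y) $$ (i, j)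
      = spm (n + m) (cols_dsum n X Y) $$ (i, j)"
    using ij by (cases "i < n"; cases "j < length X")
      (simp_all add: spm_def cols_dsum_def nth_append count_list_map_plus none)
qed auto

lemma odd_count_iff: "odd_count x i \<longleftrightarrow> odd (count_list x i)"
  by (induction x) auto

lemma (in char_two) spm_eq:
  assumes "cols_eq X Y"
  shows "(spm n X :: 'k mat) = spm n Y"
proof (rule eq_matI)
  have even: "of_nat m = (if odd m then 1 else 0 :: 'k)" for m
  proof -
    have *: "of_nat (2 * k) = (0 :: 'k)" for k by (simp only: mult_2 of_nat_add self_add)
    show ?thesis
    proof (cases "even m")
      case True
      then obtain k where "m = 2 * k" by (rule evenE)
      then show ?thesis using * by (simp only: dvd_triv_left not_True_eq_False if_False)
    next
      case False
      then obtain k where "m = 2 * k + 1" by (rule oddE)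
      then show ?thesis using *[of k] False by (simp only: of_nat_add of_nat_1 if_True add_0 not_False_eq_True)
    qed
  qed
  have len: "length X = length Y" using assms unfolding cols_eq_def by (rule list_all2_lengthD)
  then show "dim_row (spm n X :: 'k mat) = dim_row (spm n Y :: 'k mat)" "dim_col (spm n X :: 'k mat) = dim_col (spm n Y :: 'k mat)" by simp_all
  fix i j assume ij: "i < dim_row (spm n Y :: 'k mat)" "j < dim_col (spm n Y :: 'k mat)"
  have "list_all (\<lambda>i. odd_count (X ! j) i = odd_count (Y ! j) i) (X ! j @ Y ! j)"
    using list_all2_nthD[OF assms[unfolded cols_eq_def], of j] ij len by simp
  then have "odd (count_list (X ! j) i) = odd (count_list (Y ! j) i)" if "i \<in> set (X ! j @ Y ! j)"
    using that unfolding list_all_iff odd_count_iff by blast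
  moreover have "count_list (X ! j) i = 0 \<and> count_list (Y ! j) i = 0" if "i \<notin> set (X ! j @ Y ! j)"
    using that by (simp add: count_list_0_iff)
  ultimately have "odd (count_list (X ! j) i) = odd (count_list (Y ! j) i)" by metis
  then show "spm n X $$ (i, j) = (spm n Y $$ (i, j) :: 'k)"
    using ij len by (simp add: spm_def even)
qed

section \<open>Modules given by sparse matrices\<close>

definition spmod :: "nat \<Rightarrow> (gen \<Rightarrow> cols) \<Rightarrow> 'k::field umod" where
  "spmod n \<rho> = umod_of n (\<lambda>g. spm n (\<rho> g))"

definition sp_dim :: "nat \<Rightarrow> (gen \<Rightarrow> cols) \<Rightarrow> bool" where
  "sp_dim n \<rho> \<longleftrightarrow> list_all (\<lambda>g. length (\<rho> g) = n \<and> bounded_cols n (\<rho> g)) [Ga, Gb, Gc]"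

definition sp_relations :: "nat \<Rightarrow> (gen \<Rightarrow> cols) \<Rightarrow> bool" where
  "sp_relations n \<rho> \<longleftrightarrow> sp_dim n \<rho> \<and>
     (let a = \<rho> Ga; b = \<rho> Gb; c = \<rho> Gc; z = replicate n [];
          aa = cols_mult a a; bb = cols_mult b b in
      cols_eq (cols_add (cols_mult a b) (cols_mult b a)) c \<and>
      cols_eq (cols_add (cols_mult a c) (cols_mult c a)) a \<and>
      cols_eq (cols_add (cols_mult b c) (cols_mult c b)) b \<and>
      cols_eq (cols_mult a (cols_mult a aa)) z \<and>
      cols_eq (cols_mult b (cols_mult b bb)) z \<and>
      cols_eq (cols_add (cols_mult c c) c) z)"

definition sp_tensor :: "nat \<Rightarrow> (gen \<Rightarrow> cols) \<Rightarrow> nat \<Rightarrow> (gen \<Rightarrow> cols) \<Rightarrow> gen \<Rightarrow> cols" where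
  "sp_tensor n \<rho> m \<sigma> g = cols_add (cols_kron m (\<rho> g) (cols_one m)) (cols_kron m (cols_one n) (\<sigma> g))"

definition sp_dsum :: "nat \<Rightarrow> (gen \<Rightarrow> cols) \<Rightarrow> (gen \<Rightarrow> cols) \<Rightarrow> gen \<Rightarrow> cols" where
  "sp_dsum n \<rho> \<sigma> g = cols_dsum n (\<rho> g) (\<sigma> g)"

definition sp_hom :: "nat \<Rightarrow> (gen \<Rightarrow> cols) \<Rightarrow> nat \<Rightarrow> (gen \<Rightarrow> cols) \<Rightarrow> cols \<Rightarrow> bool" where
  "sp_hom n \<rho> m \<sigma> f \<longleftrightarrow> length f = n \<and> bounded_cols m f \<and>
     list_all (\<lambda>g. cols_eq (cols_mult f (\<rho> g)) (cols_mult (\<sigma> g) f)) [Ga, Gb, Gc]"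

lemma sp_dimD: "sp_dim n \<rho> \<Longrightarrow> length (\<rho> g) = n \<and> bounded_cols n (\<rho> g)"
  by (cases g) (auto simp: sp_dim_def)

lemma mdim_spmod [simp]: "mdim (spmod n \<rho>) = n"
  by (simp add: spmod_def)

lemma bounded_cols_mult:
  assumes "bounded_cols (length X) Y" "bounded_cols n X"
  shows "bounded_cols n (cols_mult X Y)"
  unfolding bounded_cols_def cols_mult_def list_all_iff
proof (intro ballI)
  fix x i assume "x \<in> set (map (\<lambda>y. concat (map ((!) X) y)) Y)" "i \<in> set x"
  then obtain y k where "y \<in> set Y" "k \<in> set y" "i \<in> set (X ! k)" by auto
  then show "i < n" using assms nth_mem[of k X] unfolding bounded_cols_def list_all_iff by blast
qed

context char_two
begin

lemma spmod_umod:
  assumes "sp_relations n \<rho>"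
  shows "is_umod (spmod n \<rho> :: 'k umod)" "mact (spmod n \<rho>) (um_gen g) = (spm n (\<rho> g) :: 'k mat)"
proof -
  have d: "length (\<rho> g) = n" "bounded_cols n (\<rho> g)" for g
    using assms sp_dimD[of n \<rho> g] by (auto simp: sp_relations_def)
  have mult: "spm n (\<rho> g) * spm n Y = (spm n (cols_mult (\<rho> g) Y) :: 'k mat)" if "bounded_cols n Y" for g Y
    using spm_mult[where 'a = 'k, of "\<rho> g" Y n] that d by simp
  have b: "bounded_cols n (cols_mult (\<rho> g) Y)" if "bounded_cols n Y" for g Y
    using bounded_cols_mult that d by simp
  have zero: "0\<^sub>m n n = (spm n (replicate n []) :: 'k mat)"
    by (rule eq_matI) (simp_all add: spm_def)
  have c: "spm n (\<rho> g) \<in> carrier_mat n n" for g using d by (auto intro: carrier_matI)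
  note r = assms[unfolded sp_relations_def Let_def]
  have "spm n (\<rho> Ga) * spm n (\<rho> Gb) + spm n (\<rho> Gb) * spm n (\<rho> Ga) = (spm n (\<rho> Gc) :: 'k mat)"
    "spm n (\<rho> Ga) * spm n (\<rho> Gc) + spm n (\<rho> Gc) * spm n (\<rho> Ga) = (spm n (\<rho> Ga) :: 'k mat)"
    "spm n (\<rho> Gb) * spm n (\<rho> Gc) + spm n (\<rho> Gc) * spm n (\<rho> Gb) = (spm n (\<rho> Gb) :: 'k mat)"
    "spm n (\<rho> Ga) * (spm n (\<rho> Ga) * (spm n (\<rho> Ga) * spm n (\<rho> Ga))) = (0\<^sub>m n n :: 'k mat)"
    "spm n (\<rho> Gb) * (spm n (\<rho> Gb) * (spm n (\<rho> Gb) * spm n (\<rho> Gb))) = (0\<^sub>m n n :: 'k mat)"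
    "spm n (\<rho> Gc) * spm n (\<rho> Gc) + spm n (\<rho> Gc) = (0\<^sub>m n n :: 'k mat)"
    unfolding zero using r by (simp_all add: mult d b spm_add spm_eq)
  note * = is_umod_of_mact_relations[of "\<lambda>g. spm n (\<rho> g)", OF c this]
  show "is_umod (spmod n \<rho> :: 'k umod)" "mact (spmod n \<rho>) (um_gen g) = (spm n (\<rho> g) :: 'k mat)"
    unfolding spmod_def by (rule *)+
qed

lemma spmod_hom:
  assumes "sp_relations n \<rho>" "sp_relations m \<sigma>" "sp_hom n \<rho> m \<sigma> f"
  shows "umod_hom (spmod n \<rho>) (spmod m \<sigma>) (spm m f :: 'k mat)"
proof (rule umod_hom_genI)
  have d: "length (\<rho> g) = n" "bounded_cols n (\<rho> g)" "length (\<sigma> g) = m" "bounded_cols m (\<sigma> g)" for g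
    using assms(1,2) sp_dimD[of n \<rho> g] sp_dimD[of m \<sigma> g] by (auto simp: sp_relations_def)
  have f: "length f = n" "bounded_cols m f" using assms(3) by (auto simp: sp_hom_def)
  then show "spm m f \<in> carrier_mat (mdim (spmod m \<sigma>)) (mdim (spmod n \<rho>))" by (auto intro: carrier_matI)
  fix g
  have "cols_eq (cols_mult f (\<rho> g)) (cols_mult (\<sigma> g) f)"
    using assms(3) by (cases g) (auto simp: sp_hom_def)
  then show "spm m f * mact (spmod n \<rho>) (um_gen g) = mact (spmod m \<sigma>) (um_gen g) * (spm m f :: 'k mat)"
    using spm_mult[where 'a = 'k, of f "\<rho> g" m] spm_mult[where 'a = 'k, of "\<sigma> g" f m] spm_eq
    by (simp add: spmod_umod[OF assms(1)] spmod_umod[OF assms(2)] d f)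
qed (rule spmod_umod assms)+

lemma spmod_iso:
  assumes "sp_relations n \<rho>" "sp_relations n \<sigma>" "sp_hom n \<rho> n \<sigma> f" "sp_hom n \<sigma> n \<rho> g"
    "cols_eq (cols_mult g f) (cols_one n)" "cols_eq (cols_mult f g) (cols_one n)"
  shows "(spmod n \<rho> :: 'k umod) \<cong>\<^sub>u spmod n \<sigma>"
proof (rule umod_isoI[of _ _ "spm n f" "spm n g"])
  have f: "length f = n" "bounded_cols n f" "length g = n" "bounded_cols n g" 
    using assms(3,4) by (auto simp: sp_hom_def)
  show "spm n g * spm n f = (1\<^sub>m (mdim (spmod n \<rho> :: 'k umod)) :: 'k mat)"
    "spm n f * spm n g = (1\<^sub>m (mdim (spmod n \<sigma> :: 'k umod)) :: 'k mat)"
    using spm_mult[where 'a = 'k, of f g n] spm_mult[where 'a = 'k, of g f n] f spm_eq[OF assms(5)] spm_eq[OF assms(6)] 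
    by (simp_all add: spm_one)
qed (rule spmod_umod spmod_hom assms)+

lemma spmod_tensor:
  assumes "sp_relations n \<rho>" "sp_relations m \<sigma>" "sp_relations (n * m) (sp_tensor n \<rho> m \<sigma>)" "0 < m"
  shows "(spmod n \<rho> :: 'k umod) \<otimes>\<^sub>u spmod m \<sigma> \<cong>\<^sub>u spmod (n * m) (sp_tensor n \<rho> m \<sigma>)"
proof (rule umod_iso_genI)
  fix g
  have d: "length (\<rho> g) = n" "bounded_cols n (\<rho> g)" "length (\<sigma> g) = m" "bounded_cols m (\<sigma> g)"
    using assms(1,2) sp_dimD[of n \<rho> g] sp_dimD[of m \<sigma> g] by (auto simp: sp_relations_def)
  have one: "bounded_cols m (cols_one m)" by (auto simp: bounded_cols_def cols_one_def list_all_iff)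
  show "mact ((spmod n \<rho> :: 'k umod) \<otimes>\<^sub>u spmod m \<sigma>) (um_gen g) = mact (spmod (n * m) (sp_tensor n \<rho> m \<sigma>)) (um_gen g)"
    unfolding tensor_umod(2)[OF spmod_umod(1)[OF assms(1)] spmod_umod(1)[OF assms(2)]]
      spmod_umod(2)[OF assms(1)] spmod_umod(2)[OF assms(2)] spmod_umod(2)[OF assms(3)] sp_tensor_def mdim_spmod
    by (simp add: d one assms(4) spm_add spm_kron flip: spm_one)
qed (simp_all add: tensor_umod spmod_umod assms)

lemma spmod_dsum:
  assumes "sp_relations n \<rho>" "sp_relations m \<sigma>" "sp_relations (n + m) (sp_dsum n \<rho> \<sigma>)"
  shows "(spmod n \<rho> :: 'k umod) \<oplus>\<^sub>u spmod m \<sigma> \<cong>\<^sub>u spmod (n + m) (sp_dsum n \<rho> \<sigma>)"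
proof (rule umod_iso_genI)
  fix g
  have d: "length (\<rho> g) = n" "bounded_cols n (\<rho> g)" "length (\<sigma> g) = m" "bounded_cols m (\<sigma> g)"
    using assms(1,2) sp_dimD[of n \<rho> g] sp_dimD[of m \<sigma> g] by (auto simp: sp_relations_def)
  show "mact ((spmod n \<rho> :: 'k umod) \<oplus>\<^sub>u spmod m \<sigma>) (um_gen g) = mact (spmod (n + m) (sp_dsum n \<rho> \<sigma>)) (um_gen g)"
    using spm_dsum[of n "\<rho> g" "\<sigma> g" m]
    by (simp add: dsum_def spmod_umod[OF assms(1)] spmod_umod[OF assms(2)] spmod_umod[OF assms(3)] sp_dsum_def d)
qed (simp_all add: is_umod_dsum spmod_umod assms)

end

section \<open>The simple and the projective indecomposable modules\<close>

fun V_cols :: "bool \<Rightarrow> gen \<Rightarrow> cols" where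
  "V_cols False g = [[]]"
| "V_cols True Ga = [[1], [2], []]"
| "V_cols True Gb = [[], [0], [1]]"
| "V_cols True Gc = [[0], [], [2]]"

text \<open>With a generator \<open>v\<close> and \<open>x = a b\<close>, the basis is \<open>v; a v, a\<^sup>2 v, a\<^sup>3 v; b\<^sup>3 v, b\<^sup>2 v, b v; x v\<close>
  for \<open>P_0\<close> (where \<open>c v = 0\<close>, \<open>x\<^sup>2 v = 0\<close>) and
  \<open>b v, v, a v; b\<^sup>2 v; a\<^sup>2 v; b (x + 1) v, (x + 1) v, a (x + 1) v\<close> for \<open>P_1\<close>
  (where \<open>c v = 0\<close>, \<open>x\<^sup>2 v = v\<close>).\<close>

fun P_cols :: "bool \<Rightarrow> gen \<Rightarrow> cols" where
  "P_cols False Ga = [[1], [2], [3], [], [5], [6], [7], []]"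
| "P_cols False Gb = [[6], [7], [1], [2], [], [4], [5], []]"
| "P_cols False Gc = [[], [1], [], [3], [4], [], [6], []]"
| "P_cols True Ga = [[1, 6], [2], [4], [5], [], [6], [7], []]"
| "P_cols True Gb = [[3], [0], [1, 6], [], [7], [], [5], [6]]"
| "P_cols True Gc = [[0], [], [2], [], [], [5], [], [7]]"

definition V_dim :: "bool \<Rightarrow> nat" where "V_dim d = (if d then 3 else 1)"
definition V :: "bool \<Rightarrow> 'k::field umod" where "V d = spmod (V_dim d) (V_cols d)"
definition P :: "bool \<Rightarrow> 'k::field umod" where "P d = spmod 8 (P_cols d)"

lemma sp_relations_V: "sp_relations (V_dim d) (V_cols d)"
proof -
  have "sp_relations (V_dim False) (V_cols False)" "sp_relations (V_dim True) (V_cols True)" by code_simp+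
  then show ?thesis by (cases d) auto
qed

lemma sp_relations_P: "sp_relations 8 (P_cols d)"
proof -
  have "sp_relations 8 (P_cols False)" "sp_relations 8 (P_cols True)" by code_simp+
  then show ?thesis by (cases d) auto
qed

lemma V_mod_eq_V: "(V_mod i :: 'a::field umod) = V (i = 1)"
proof -
  have "V1_gen = (\<lambda>g. spm 3 (V_cols True g) :: 'a mat)"
  proof
    fix g
    show "V1_gen g = (spm 3 (V_cols True g) :: 'a mat)"
      by (cases g) (auto simp: mat_of_rows_list_def spm_def less_Suc_eq numeral_3_eq_3 intro!: eq_matI)
  qed
  moreover have "(\<lambda>g. 0\<^sub>m 1 1) = (\<lambda>g. spm 1 (V_cols False g) :: 'a mat)"
    by (rule ext, rule eq_matI) (auto simp: spm_def)
  ultimately show ?thesis by (cases "i = 1") (simp_all only: V_mod_def V_def spmod_def V_dim_def if_True if_False simp_thms)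
qed

section \<open>Cyclic projective modules\<close>

definition um_word :: "gen list \<Rightarrow> 'k::field um" where
  "um_word w = prod_list (map um_gen w)"

definition um_words :: "gen list list \<Rightarrow> 'k::field um" where
  "um_words ws = sum_list (map um_word ws)"

definition word_cols :: "(gen \<Rightarrow> cols) \<Rightarrow> gen list \<Rightarrow> nat list \<Rightarrow> nat list" where
  "word_cols \<rho> w y = foldr (\<lambda>g z. concat (map ((!) (\<rho> g)) z)) w y"

definition words_cols :: "(gen \<Rightarrow> cols) \<Rightarrow> gen list list \<Rightarrow> cols \<Rightarrow> cols" where
  "words_cols \<rho> ws Y = map (\<lambda>y. concat (map (\<lambda>w. word_cols \<rho> w y) ws)) Y"

lemma length_words_cols [simp]: "length (words_cols \<rho> ws Y) = length Y"
  by (simp add: words_cols_def)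

lemma bounded_cols_word:
  assumes \<rho>: "\<And>g. length (\<rho> g) = n" "\<And>g. bounded_cols n (\<rho> g)" and y: "\<forall>k\<in>set y. k < n"
  shows "\<forall>k\<in>set (word_cols \<rho> w y). k < n"
proof (induction w)
  case Nil
  then show ?case using y by (simp add: word_cols_def)
next
  case (Cons g w)
  have "\<forall>l\<in>set (\<rho> g ! k). l < n" if "k < n" for k
    using \<rho>(2)[of g] nth_mem[of k "\<rho> g"] that \<rho>(1)[of g] unfolding bounded_cols_def list_all_iff by blast
  then show ?case using Cons by (simp add: word_cols_def) blast
qed

lemma sum_count_list:
  fixes f :: "nat \<Rightarrow> 'a::comm_semiring_1"
  assumes "\<forall>k\<in>set y. k < n"
  shows "(\<Sum>k<n. f k * of_nat (count_list y k)) = sum_list (map f y)"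
  using assms
proof (induction y)
  case (Cons a y)
  have "(\<Sum>k<n. f k * of_nat (count_list (a # y) k)) =
      (\<Sum>k<n. (if k = a then f a else 0) + f k * of_nat (count_list y k))"
    by (intro sum.cong) (auto simp: distrib_left)
  also have "\<dots> = f a + (\<Sum>k<n. f k * of_nat (count_list y k))"
    using Cons.prems by (subst sum.distrib) (simp add: sum.delta)
  finally show ?case using Cons by simp
qed simp

lemma spm_col_eq: "col (spm n [y]) 0 = vec n (\<lambda>i. of_nat (count_list y i))"
  by (rule eq_vecI) (simp_all add: spm_def)

context char_two
begin

lemma mact_word:
  assumes r: "sp_relations n \<rho>" and Y: "bounded_cols n Y"
  shows "mact (spmod n \<rho>) (um_word w) * spm n Y = (spm n (map (word_cols \<rho> w) Y) :: 'k mat)"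
    "bounded_cols n (map (word_cols \<rho> w) Y)"
proof -
  have \<rho>: "length (\<rho> g) = n" "bounded_cols n (\<rho> g)" for g
    using r sp_dimD[of n \<rho> g] by (auto simp: sp_relations_def)
  note u = spmod_umod[OF r] is_umodD[OF spmod_umod(1)[OF r]]
  have b: "bounded_cols n (map (word_cols \<rho> w) Y)" for w
    using Y bounded_cols_word[of \<rho> n _ w, OF \<rho>] by (auto simp: bounded_cols_def list_all_iff)
  then show "bounded_cols n (map (word_cols \<rho> w) Y)" .
  show "mact (spmod n \<rho>) (um_word w) * spm n Y = (spm n (map (word_cols \<rho> w) Y) :: 'k mat)"
  proof (induction w)
    case Nil
    show ?case by (simp add: um_word_def word_cols_def u mat_one_left)
  next
    case (Cons g w)
    have "mact (spmod n \<rho>) (um_word (g # w)) * spm n Y = 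
        spm n (\<rho> g) * (mact (spmod n \<rho>) (um_word w) * (spm n Y :: 'k mat))"
      by (simp add: um_word_def u mat_assoc \<rho>)
    also have "\<dots> = spm n (cols_mult (\<rho> g) (map (word_cols \<rho> w) Y))"
      unfolding Cons using spm_mult[where 'a = 'k, of "\<rho> g" "map (word_cols \<rho> w) Y" n] b by (simp add: \<rho>)
    also have "cols_mult (\<rho> g) (map (word_cols \<rho> w) Y) = map (word_cols \<rho> (g # w)) Y"
      by (simp add: cols_mult_def word_cols_def)
    finally show ?case .
  qed
qed

lemma mact_words:
  assumes r: "sp_relations n \<rho>" and Y: "bounded_cols n Y"
  shows "mact (spmod n \<rho>) (um_words ws) * spm n Y = (spm n (words_cols \<rho> ws Y) :: 'k mat)"
    "bounded_cols n (words_cols \<rho> ws Y)"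
proof -
  note u = spmod_umod[OF r] is_umodD[OF spmod_umod(1)[OF r]]
  show "mact (spmod n \<rho>) (um_words ws) * spm n Y = (spm n (words_cols \<rho> ws Y) :: 'k mat)"
  proof (induction ws)
    case Nil
    show ?case by (rule eq_matI) (simp_all add: um_words_def words_cols_def u spm_def)
  next
    case (Cons w ws)
    have "mact (spmod n \<rho>) (um_words (w # ws)) * spm n Y = 
       mact (spmod n \<rho>) (um_word w) * spm n Y + mact (spmod n \<rho>) (um_words ws) * (spm n Y :: 'k mat)"
      by (simp add: um_words_def u mat_distrib_right)
    also have "\<dots> = spm n (words_cols \<rho> (w # ws) Y)"
      unfolding Cons mact_word(1)[OF r Y] by (rule eq_matI) (simp_all add: spm_def words_cols_def)
    finally show ?case .
  qed
  show "bounded_cols n (words_cols \<rho> ws Y)"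
    using mact_word(2)[OF r Y] unfolding bounded_cols_def list_all_iff words_cols_def by fastforce
qed

lemma umod_hom_spmod_eqI:
  assumes "A \<in> carrier_mat m n" "B \<in> carrier_mat m n" "\<And>k. k < n \<Longrightarrow> A * spm n [[k]] = B * (spm n [[k]] :: 'k mat)"
  shows "A = B"
proof (rule mat_col_eqI)
  fix k assume "k < dim_col B"
  then have k: "k < n" using assms by simp
  have e: "col (spm n [[k]]) 0 = (unit_vec n k :: 'k vec)" 
    unfolding spm_col_eq by (rule eq_vecI) (simp_all add: unit_vec_def)
  have "col (X * spm n [[k]]) 0 = col X k" if X: "X \<in> carrier_mat m n" for X :: "'k mat"
  proof -
    have "col (X * spm n [[k]]) 0 = X *\<^sub>v col (spm n [[k]]) 0"
      using X by (intro col_mult2[of _ m n _ 1]) (auto intro: carrier_matI)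
    then show ?thesis unfolding e using mat_unit_vec_col[OF X k] by simp
  qed
  from this[OF assms(1)] this[OF assms(2)] assms(3)[OF k] show "col A k = col B k" by simp
qed (use assms in auto)

end

text \<open>The module \<open>spmod n \<rho>\<close> is generated by its basis vector \<open>v\<close>: the word sum \<open>w k\<close> takes \<open>v\<close> to the
  \<open>k\<close>-th basis vector, and \<open>v\<close> represents the elements of the form \<open>z m\<close> of a module.\<close>

locale cyclic = char_two ty for ty :: "'k::field itself" +
  fixes n :: nat and \<rho> :: "gen \<Rightarrow> cols" and w :: "nat \<Rightarrow> gen list list" and z :: "gen list list" and v :: nat
  assumes rel: "sp_relations n \<rho>" and v: "v < n"
    and fixed: "cols_eq (words_cols \<rho> z [[v]]) [[v]]"
    and basis: "\<And>k. k < n \<Longrightarrow> cols_eq (words_cols \<rho> (w k) [[v]]) [[k]]"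
    and action: "\<And>g k. g = Ga \<or> g = Gb \<Longrightarrow> k < n \<Longrightarrow> um_gen g * (um_words (w k) * um_words z) =
      (sum_list (map (\<lambda>j. um_words (w j) * um_words z) (\<rho> g ! k)) :: 'k um)"
begin

abbreviation "C \<equiv> spmod n \<rho> :: 'k umod"
abbreviation "W k \<equiv> um_words (w k) * um_words z :: 'k um"

lemma C_umod: "is_umod C" by (rule spmod_umod[OF rel])

lemma unit_bounded: "k < n \<Longrightarrow> bounded_cols n [[k]]"
  by (simp add: bounded_cols_def)

lemma W_v: "k < n \<Longrightarrow> mact C (W k) * spm n [[v]] = (spm n [[k]] :: 'k mat)"
  using mact_words(1)[OF rel unit_bounded[OF v], of z] mact_words(1)[OF rel unit_bounded[OF v], of "w k"]
    spm_eq[OF fixed] spm_eq[OF basis, of k]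
  by (simp add: is_umodD[OF C_umod] mat_assoc)

lemma hom_basis:
  assumes M: "is_umod M" and f: "umod_hom C M f" and k: "k < n"
  shows "f * spm n [[k]] = mact M (W k) * (f * spm n [[v]])"
proof -
  note d = umod_hom_dims[OF f] umod_dims[OF M] umod_dims[OF C_umod]
  have "f * spm n [[k]] = f * mact C (W k) * spm n [[v]]"
    unfolding W_v[OF k, symmetric] by (simp add: mat_assoc d)
  then show ?thesis unfolding umod_homD(3)[OF f] by (simp add: mat_assoc d)
qed

lemma hom_eqI:
  assumes M: "is_umod M" and f: "umod_hom C M f" and g: "umod_hom C M g" and eq: "f * spm n [[v]] = g * spm n [[v]]"
  shows "f = g"
  by (rule umod_hom_spmod_eqI[of _ "mdim M" n])
    (use umod_homD(4)[OF f] umod_homD(4)[OF g] in \<open>simp_all add: hom_basis[OF M f] hom_basis[OF M g] eq\<close>)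

text \<open>Commuting with \<open>a\<close> and \<open>b\<close> implies commuting with
  \<open>c = a b + b a\<close>.\<close>

lemma umod_hom_abI:
  fixes M N :: "'k umod"
  assumes M: "is_umod M" and N: "is_umod N" and f: "f \<in> carrier_mat (mdim N) (mdim M)"
    and ab: "\<And>g. g = Ga \<or> g = Gb \<Longrightarrow> f * mact M (um_gen g) = mact N (um_gen g) * f"
  shows "umod_hom M N f"
proof (rule umod_hom_genI[OF M N f])
  fix g
  note d = umod_dims[OF M] umod_dims[OF N] carrier_matD[OF f]
  have "f * mact M (um_gen Gc) = mact N (um_gen Gc) * f"
    unfolding mact_relations(1)[OF M, symmetric] mact_relations(1)[OF N, symmetric]
    by (simp add: mat_ring d ab mat_reassoc[OF ab])
  then show "f * mact M (um_gen g) = mact N (um_gen g) * f" by (cases g) (simp_all add: ab)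
qed

text \<open>The vectors \<open>mact M (W k) * m\<close> are the columns of the map, and
  \<open>action\<close>, an identity in the algebra, makes it commute with \<open>a\<close> and
  \<open>b\<close>. Any \<open>m\<close> is admissible because \<open>W k\<close> ends in
  \<open>z\<close>, which turns \<open>m\<close> into a possible image of the generator.\<close>

lemma hom_exists:
  assumes M: "is_umod M" and m: "m \<in> carrier_mat (mdim M) 1"
  obtains h where "umod_hom C M h" "\<And>k. k < n \<Longrightarrow> h * spm n [[k]] = mact M (W k) * m"
proof
  let ?h = "mat (mdim M) n (\<lambda>(i, k). (mact M (W k) * m) $$ (i, 0)) :: 'k mat"
  have md: "dim_row m = mdim M" "dim_col m = 1" using m by auto
  note d = md umod_dims[OF M]
  have bd: "\<forall>j\<in>set (\<rho> g ! k). j < n" "length (\<rho> g) = n" if "k < n" for g k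
    using rel sp_dimD[of n \<rho> g] nth_mem[of k "\<rho> g"] that unfolding sp_relations_def bounded_cols_def list_all_iff by fast+
  have sum: "(mact M (sum_list (map f y)) * m) $$ (i, 0) = sum_list (map (\<lambda>j. (mact M (f j) * m) $$ (i, 0)) y)"
    if "i < mdim M" for f :: "nat \<Rightarrow> 'k um" and y i
  proof (induction y)
    case Nil
    show ?case using that by (simp add: is_umodD[OF M] mat_ring d)
  next
    case (Cons a y)
    have "mact M (sum_list (map f (a # y))) * m = mact M (f a) * m + mact M (sum_list (map f y)) * m"
      by (simp add: is_umodD[OF M] mat_distrib_right d)
    then show ?case using Cons that by (simp add: d del: index_mult_mat(1))
  qed
  show "umod_hom C M ?h"
  proof (rule umod_hom_abI[OF C_umod M])
    fix g assume g: "g = Ga \<or> g = Gb"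
    show "?h * mact C (um_gen g) = mact M (um_gen g) * ?h"
    proof (rule eq_matI)
      fix i k assume "i < dim_row (mact M (um_gen g) * ?h)" "k < dim_col (mact M (um_gen g) * ?h)"
      then have ik: "i < mdim M" "k < n" by (simp_all add: d)
      have "(?h * mact C (um_gen g)) $$ (i, k) = (\<Sum>j<n. (mact M (W j) * m) $$ (i, 0) * of_nat (count_list (\<rho> g ! k) j))"
        unfolding spmod_umod(2)[OF rel] using ik bd(2)[OF ik(2)]
        by (subst index_mult_mat(1)) (simp_all add: scalar_prod_def spm_def atLeast0LessThan del: index_mult_mat(1))
      also have "\<dots> = sum_list (map (\<lambda>j. (mact M (W j) * m) $$ (i, 0)) (\<rho> g ! k))"
        by (rule sum_count_list[OF bd(1)[OF ik(2)]])
      also have "\<dots> = (mact M (um_gen g * W k) * m) $$ (i, 0)"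
        unfolding action[OF g ik(2)] by (rule sum[OF ik(1), symmetric])
      also have "mact M (um_gen g * W k) * m = mact M (um_gen g) * (mact M (W k) * m)"
        by (simp only: is_umodD(5)[OF M, of "um_gen g"]) (simp add: mat_assoc d)
      also have "(mact M (um_gen g) * (mact M (W k) * m)) $$ (i, 0) = (\<Sum>l<mdim M. mact M (um_gen g) $$ (i, l) * (mact M (W k) * m) $$ (l, 0))"
        using ik by (subst index_mult_mat(1)) (simp_all add: d scalar_prod_def atLeast0LessThan del: index_mult_mat(1))
      also have "\<dots> = (mact M (um_gen g) * ?h) $$ (i, k)"
        using ik by (subst index_mult_mat(1)) (simp_all add: d scalar_prod_def atLeast0LessThan del: index_mult_mat(1))
      finally show "(?h * mact C (um_gen g)) $$ (i, k) = (mact M (um_gen g) * ?h) $$ (i, k)" .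
    qed (simp_all add: d umod_dims[OF C_umod])
  qed simp
  fix k assume k: "k < n"
  show "?h * spm n [[k]] = mact M (W k) * m"
  proof (rule eq_matI)
    fix i j assume ij: "i < dim_row (mact M (W k) * m)" "j < dim_col (mact M (W k) * m)"
    then have "(?h * spm n [[k]]) $$ (i, j) = (\<Sum>l<n. (mact M (W l) * m) $$ (i, 0) * of_nat (count_list [k] l))"
      by (subst index_mult_mat(1)) (simp_all add: scalar_prod_def spm_def d atLeast0LessThan del: index_mult_mat(1))
    also have "\<dots> = (mact M (W k) * m) $$ (i, 0)" by (subst sum_count_list) (use k in auto)
    finally show "(?h * spm n [[k]]) $$ (i, j) = (mact M (W k) * m) $$ (i, j)" using ij by (simp add: d)
  qed (simp_all add: d)
qed

text \<open>The image of the generator under \<open>f\<close> is lifted linearly by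
  \<open>u\<close>; \<open>hom_exists\<close> turns this vector into a homomorphism, which lifts
  \<open>f\<close> on every basis vector.\<close>

lemma projective: "is_projective C"
proof (rule projectiveI[OF C_umod])
  fix M N :: "'k umod" and g u f
  assume M: "is_umod M" and N: "is_umod N" and g: "umod_hom M N g"
    and u: "u \<in> carrier_mat (mdim M) (mdim N)" "g * u = 1\<^sub>m (mdim N)" and f: "umod_hom C N f"
  note d = umod_dims[OF M] umod_dims[OF N] umod_hom_dims[OF g] umod_hom_dims[OF f] carrier_matD[OF u(1)]
  let ?m = "u * (f * spm n [[v]])"
  have "?m \<in> carrier_mat (mdim M) 1" by (auto simp: d intro: carrier_matI)
  then obtain h where h: "umod_hom C M h" "\<And>k. k < n \<Longrightarrow> h * spm n [[k]] = mact M (W k) * ?m"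
    using hom_exists[OF M] by blast
  note d = d umod_hom_dims[OF h(1)]
  have "g * h = f"
  proof (rule umod_hom_spmod_eqI[of _ "mdim N" n])
    fix k assume k: "k < n"
    have "g * h * spm n [[k]] = g * (mact M (W k) * ?m)" using h(2)[OF k] by (simp add: mat_assoc d)
    also have "\<dots> = (g * mact M (W k)) * ?m" by (rule mat_assoc[symmetric]) (simp_all add: d)
    also have "\<dots> = mact N (W k) * ((g * u) * (f * spm n [[v]]))"
      unfolding umod_homD(3)[OF g] by (simp add: mat_assoc d)
    also have "\<dots> = f * spm n [[k]]" unfolding u(2) hom_basis[OF N f k] by (simp add: mat_ring d)
    finally show "g * h * spm n [[k]] = f * spm n [[k]]" .
  qed (auto simp: d intro: carrier_matI)
  then show "\<exists>h. umod_hom C M h \<and> g * h = f" using h(1) by blast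
qed

end

section \<open>Projectivity and local endomorphism rings\<close>

text \<open>Word sums that take the generator to the basis vectors used in \<open>P_cols\<close>. As
  \<open>c v = 0\<close>, the vector \<open>b (x + 1) v\<close> equals \<open>a b b v\<close>, which
  is the form chosen here.\<close>

definition P_words :: "bool \<Rightarrow> gen list list list" where
  "P_words d = (if d then [[[Gb]], [[]], [[Ga]], [[Gb, Gb]], [[Ga, Ga]], [[Ga, Gb, Gb]], [[Ga, Gb], []], [[Ga, Ga, Gb], [Ga]]]
     else [[[]], [[Ga]], [[Ga, Ga]], [[Ga, Ga, Ga]], [[Gb, Gb, Gb]], [[Gb, Gb]], [[Gb]], [[Ga, Gb]]])"

text \<open>With \<open>x = a b\<close>, these are \<open>(1 + x\<^sup>2) (1 + c)\<close> and \<open>x\<^sup>2 (1 + c)\<close>.\<close>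

definition P_proj :: "bool \<Rightarrow> gen list list" where
  "P_proj d = (if d then [[Ga, Gb, Ga, Gb], [Ga, Gb, Ga, Gb, Gc]] else [[], [Gc], [Ga, Gb, Ga, Gb], [Ga, Gb, Ga, Gb, Gc]])"

definition P_top :: "bool \<Rightarrow> nat" where "P_top d = (if d then 1 else 0)"

context char_two
begin

section \<open>Normal forms in the algebra and the relations of the two projective modules\<close>

lemma um_self_add: "x + x = (0 :: 'k um)"
proof -
  have "x + x = (um_const 1 + um_const 1) * x" by (simp only: um_const_1 distrib_right mult_1_left)
  also have "\<dots> = 0" by (simp only: um_const_add[symmetric] self_add um_const_0 mult_zero_left)
  finally show ?thesis .
qed

lemma um_self_add_left: "x + (x + y) = (y :: 'k um)"
  by (simp flip: add.assoc add: um_self_add)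

lemma um_eq_iff: "x + y = z \<longleftrightarrow> x = z + (y :: 'k um)"
  by (metis add.assoc add.right_neutral um_self_add)

text \<open>Rewriting to the normal form \<open>a\<^sup>i b\<^sup>j c\<^sup>k\<close>.\<close>

lemma um_normal:
  fixes z :: "'k um"
  defines "a \<equiv> um_gen Ga" and "b \<equiv> um_gen Gb" and "c \<equiv> um_gen Gc"
  shows "b * a = a * b + c" "b * (a * z) = a * (b * z) + c * z"
    "c * a = a * c + a" "c * (a * z) = a * (c * z) + a * z"
    "c * b = b * c + b" "c * (b * z) = b * (c * z) + b * z"
    "c * c = c" "c * (c * z) = c * z"
    "a * (a * (a * a)) = 0" "a * (a * (a * (a * z))) = 0"
    "b * (b * (b * b)) = 0" "b * (b * (b * (b * z))) = 0"
proof -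
  note r = um_relations[where 'k = 'k, folded a_def b_def c_def]
  show 1: "b * a = a * b + c" "c * a = a * c + a" "c * b = b * c + b" "c * c = c"
    using r(1,2,3,6) by (metis add.commute um_eq_iff add_0)+
  show "b * (a * z) = a * (b * z) + c * z" "c * (a * z) = a * (c * z) + a * z"
    "c * (b * z) = b * (c * z) + b * z" "c * (c * z) = c * z"
    by (simp_all only: mult.assoc[symmetric] 1 distrib_right)
  show "a * (a * (a * a)) = 0" "b * (b * (b * b)) = 0" by (rule r)+
  show "a * (a * (a * (a * z))) = 0" "b * (b * (b * (b * z))) = 0"
    using r(4,5) by (metis mult.assoc mult_zero_left)+
qed

lemmas um_char2 = um_self_add um_self_add_left

text \<open>Whatever \<open>a\<close> and \<open>b\<close> kill is killed by
  \<open>c = a b + b a\<close>. Applied to the difference of two sides, this derives relations from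
  \<open>c p = 0\<close> and a condition on \<open>x^2 p\<close>.\<close>

lemma um_eq_0I:
  fixes q :: "'k um"
  assumes "um_gen Ga * q = 0" "um_gen Gb * q = 0" "um_gen Gc * q = q"
  shows "q = 0"
proof -
  have "um_gen Gc * q = um_gen Ga * (um_gen Gb * q) + um_gen Gb * (um_gen Ga * q)"
    by (simp only: um_relations(1)[symmetric] distrib_right mult.assoc)
  then show ?thesis using assms by simp
qed

lemma um_proj_top:
  fixes p :: "'k um"
  defines "a \<equiv> um_gen Ga" and "b \<equiv> um_gen Gb" and "c \<equiv> um_gen Gc"
  assumes c: "c * p = 0"
  shows "a * (a * (b * (b * p))) = a * (b * (a * (b * p))) + a * (b * p)"
    "b * (b * (a * (a * p))) = a * (a * (b * (b * p)))"
  using c by (simp_all add: um_normal[folded a_def b_def c_def] um_char2 distrib_left distrib_right add_ac)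

text \<open>Relations that the action table of \<open>P False\<close> demands of a generator
  \<open>p\<close>. For the second and the third one, the difference of the two sides is killed by
  \<open>a\<close> and \<open>b\<close> and fixed by \<open>c\<close>.\<close>

lemma um_proj_0:
  fixes p :: "'k um"
  defines "a \<equiv> um_gen Ga" and "b \<equiv> um_gen Gb" and "c \<equiv> um_gen Gc"
  assumes c: "c * p = 0" and x: "a * (b * (a * (b * p))) = 0"
  shows "a * (a * (b * (b * p))) = a * (b * p)" "a * (a * (b * p)) = 0" "a * (b * (b * p)) = b * p"
    "a * (b * (b * (b * p))) = b * (b * p)"
proof -
  note n = um_normal[folded a_def b_def c_def] um_char2 distrib_left distrib_right add_ac c
  note top = um_proj_top[folded a_def b_def c_def, OF c, unfolded x add_0]
  show 1: "a * (a * (b * (b * p))) = a * (b * p)" by (rule top)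
  show aab: "a * (a * (b * p)) = 0"
  proof (rule um_eq_0I, unfold a_def[symmetric] b_def[symmetric] c_def[symmetric])
    \<comment> \<open>Relation \<open>1\<close> is read from right to left to create the factor
      \<open>a^4\<close>.\<close>
    have "a * (a * (a * (b * p))) = a * (a * (a * (a * (b * (b * p)))))" by (simp only: 1)
    then show "a * (a * (a * (b * p))) = 0" by (simp add: n)
    show "b * (a * (a * (b * p))) = 0" by (simp add: n 1)
    show "c * (a * (a * (b * p))) = a * (a * (b * p))" by (simp add: n)
  qed
  have "a * (b * (b * p)) + b * p = 0"
  proof (rule um_eq_0I, unfold a_def[symmetric] b_def[symmetric] c_def[symmetric])
    show "a * (a * (b * (b * p)) + b * p) = 0" by (simp add: n 1)
    have "b * (a * (b * (b * p)) + b * p) = b * (b * (a * (b * p)))" by (simp add: n)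
    also have "\<dots> = b * (b * (b * (b * (a * (a * p)))))" by (simp only: top)
    also have "\<dots> = 0" by (rule n(12))
    finally show "b * (a * (b * (b * p)) + b * p) = 0" .
    show "c * (a * (b * (b * p)) + b * p) = a * (b * (b * p)) + b * p" by (simp add: n)
  qed
  then show abb: "a * (b * (b * p)) = b * p" by (simp only: um_eq_iff add_0)
  have "b * (a * (b * (b * p))) = b * (b * p)" by (simp only: abb)
  then show "a * (b * (b * (b * p))) = b * (b * p)" by (simp add: n)
qed

text \<open>Multiplying the first relation by \<open>a^2\<close> and by \<open>b^2\<close> gives the
  second and the third, as fourth powers vanish. With these, \<open>a^3 p\<close> and
  \<open>b^3 p\<close> are killed by \<open>a\<close> and \<open>b\<close> and fixed by
  \<open>c\<close>.\<close>

lemma um_proj_1: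
  fixes p :: "'k um"
  defines "a \<equiv> um_gen Ga" and "b \<equiv> um_gen Gb" and "c \<equiv> um_gen Gc"
  assumes c: "c * p = 0" and x: "a * (b * (a * (b * p))) = p"
  shows "a * (a * (b * (b * p))) = a * (b * p) + p" "a * (a * (a * (b * p))) = a * (a * p)" 
    "a * (b * (b * (b * p))) = 0" "a * (a * (a * p)) = 0" "b * (b * (b * p)) = 0"
proof -
  note n = um_normal[folded a_def b_def c_def] um_char2 distrib_left distrib_right add_ac c
  note top = um_proj_top[folded a_def b_def c_def, OF c, unfolded x]
  show 1: "a * (a * (b * (b * p))) = a * (b * p) + p" using top by (simp add: add_ac)
  have "a * (a * (a * (a * (b * (b * p))))) = a * (a * (a * (b * p))) + a * (a * p)" by (simp only: 1 distrib_left)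
  then show aaab: "a * (a * (a * (b * p))) = a * (a * p)" by (simp only: n(10) um_eq_iff[symmetric]) (simp add: um_eq_iff)
  have "b * (b * (a * (b * p))) + b * (b * p) = b * (b * (a * (a * (b * (b * p)))))" by (simp only: 1 distrib_left)
  also have "\<dots> = b * (b * (b * (b * (a * (a * p)))))" by (simp only: top)
  also have "\<dots> = 0" by (rule n(12))
  finally have "b * (b * (a * (b * p))) + b * (b * p) = 0" .
  then show abbb: "a * (b * (b * (b * p))) = 0" by (simp add: n)
  show "a * (a * (a * p)) = 0"
    by (rule um_eq_0I, unfold a_def[symmetric] b_def[symmetric] c_def[symmetric]) (simp_all add: n aaab)
  show "b * (b * (b * p)) = 0"
    by (rule um_eq_0I, unfold a_def[symmetric] b_def[symmetric] c_def[symmetric]) (simp_all add: n abbb)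
qed

text \<open>These equations make the two elements \<open>P_proj d\<close> orthogonal idempotents
  with sum \<open>1 + c\<close>; they are also the hypotheses of \<open>um_proj_0\<close> and
  \<open>um_proj_1\<close>.\<close>

lemma um_P_proj:
  defines "a \<equiv> um_gen Ga :: 'k um" and "b \<equiv> um_gen Gb :: 'k um" and "c \<equiv> um_gen Gc :: 'k um"
  shows "c * um_words (P_proj d) = 0" 
    "a * (b * (a * (b * um_words (P_proj d)))) = (if d then um_words (P_proj d) else 0)"
  by (simp_all add: P_proj_def um_words_def um_word_def mult.assoc um_normal um_char2 distrib_left distrib_right add_ac a_def b_def c_def)

lemma P_action:
  assumes g: "g = Ga \<or> g = Gb" and k: "k < 8"
  shows "um_gen g * (um_words (P_words d ! k) * um_words (P_proj d)) =
    (sum_list (map (\<lambda>j. um_words (P_words d ! j) * um_words (P_proj d)) (P_cols d g ! k)) :: 'k um)"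
proof -
  have k: "k \<in> {0, 1, 2, 3, 4, 5, 6, 7}" using k by auto
  note n = um_words_def um_word_def mult.assoc um_normal um_char2 distrib_left distrib_right add_ac
  have "um_gen g * (um_words (P_words True ! k) * p) = (sum_list (map (\<lambda>j. um_words (P_words True ! j) * p) (P_cols True g ! k)) :: 'k um)"
    if "um_gen Gc * p = 0" "um_gen Ga * (um_gen Gb * (um_gen Ga * (um_gen Gb * p))) = p" for p
    using g k by (elim insertE disjE emptyE; simp add: P_words_def n that um_proj_1[OF that])
  moreover have "um_gen g * (um_words (P_words False ! k) * p) = (sum_list (map (\<lambda>j. um_words (P_words False ! j) * p) (P_cols False g ! k)) :: 'k um)"
    if "um_gen Gc * p = 0" "um_gen Ga * (um_gen Gb * (um_gen Ga * (um_gen Gb * p))) = 0" for p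
    using g k by (elim insertE disjE emptyE; simp add: P_words_def n that um_proj_0[OF that])
  ultimately show ?thesis
    using um_P_proj[of d] by (cases d) (simp_all only: if_True if_False simp_thms)
qed

end

lemma P_cyclic_data:
  "k < 8 \<Longrightarrow> cols_eq (words_cols (P_cols d) (P_words d ! k) [[P_top d]]) [[k]]"
  "cols_eq (words_cols (P_cols d) (P_proj d) [[P_top d]]) [[P_top d]]"
proof -
  have *: "list_all (\<lambda>k. cols_eq (words_cols (P_cols True) (P_words True ! k) [[P_top True]]) [[k]]) [0..<8]"
    "list_all (\<lambda>k. cols_eq (words_cols (P_cols False) (P_words False ! k) [[P_top False]]) [[k]]) [0..<8]"
    "cols_eq (words_cols (P_cols True) (P_proj True) [[P_top True]]) [[P_top True]]"
    "cols_eq (words_cols (P_cols False) (P_proj False) [[P_top False]]) [[P_top False]]"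
    by code_simp+
  then show "k < 8 \<Longrightarrow> cols_eq (words_cols (P_cols d) (P_words d ! k) [[P_top d]]) [[k]]"
    by (cases d) (simp_all add: list_all_iff)
  show "cols_eq (words_cols (P_cols d) (P_proj d) [[P_top d]]) [[P_top d]]"
    using *(3,4) by (cases d) simp_all
qed

sublocale char_two \<subseteq> P: cyclic ty 8 "P_cols d" "\<lambda>k. P_words d ! k" "P_proj d" "P_top d" for d
  by unfold_locales (rule sp_relations_P P_cyclic_data P_action | assumption | simp add: P_top_def)+

section \<open>Endomorphisms of the two projective modules\<close>

definition P_soc :: "bool \<Rightarrow> nat" where "P_soc d = (if d then 6 else 7)"

text \<open>The nilpotent endomorphism of \<open>P d\<close>, which maps the top onto the socle.\<close>

definition P_nil :: "bool \<Rightarrow> cols" where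
  "P_nil d = (if d then [[5], [6], [7], [], [], [], [], []] else [[7], [], [], [], [], [], [], []])"

text \<open>The matrix of \<open>P_proj d\<close> acting on \<open>P d\<close>. Its image is spanned
  by the generator and the basis vector \<open>P_soc d\<close>, which leaves two parameters for an
  endomorphism.\<close>

definition P_proj_cols :: "bool \<Rightarrow> cols" where
  "P_proj_cols d = (if d then [[], [1], [], [], [], [], [6], []] else [[0], [], [], [], [], [], [], [7]])"

lemma P_nil_data:
  "sp_hom 8 (P_cols d) 8 (P_cols d) (P_nil d)" "cols_eq (cols_mult (P_nil d) (P_nil d)) (replicate 8 [])"
  "cols_eq (cols_mult (P_nil d) [[P_top d]]) [[P_soc d]]"
  "cols_eq (words_cols (P_cols d) (P_proj d) (cols_one 8)) (P_proj_cols d)"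
proof -
  have *: "list_all (\<lambda>d. sp_hom 8 (P_cols d) 8 (P_cols d) (P_nil d) \<and> cols_eq (cols_mult (P_nil d) (P_nil d)) (replicate 8 []) \<and>
     cols_eq (cols_mult (P_nil d) [[P_top d]]) [[P_soc d]] \<and>
     cols_eq (words_cols (P_cols d) (P_proj d) (cols_one 8)) (P_proj_cols d)) [False, True]"
    by code_simp
  show "sp_hom 8 (P_cols d) 8 (P_cols d) (P_nil d)" "cols_eq (cols_mult (P_nil d) (P_nil d)) (replicate 8 [])"
    "cols_eq (cols_mult (P_nil d) [[P_top d]]) [[P_soc d]]"
    "cols_eq (words_cols (P_cols d) (P_proj d) (cols_one 8)) (P_proj_cols d)"
    using * by (cases d; simp only: list.pred_inject simp_thms)+
qed

lemma umod_hom_smult: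
  assumes "is_umod M" "is_umod N" "umod_hom M N f"
  shows "umod_hom M N (r \<cdot>\<^sub>m f)"
  using umod_homD(3)[OF assms(3)] umod_hom_dims[OF assms(3)] umod_dims[OF assms(1)] umod_dims[OF assms(2)]
  by (auto simp: umod_hom_def mat_smult intro: carrier_matI)

lemma bounded_cols_one: "bounded_cols n (cols_one n)"
  by (auto simp: bounded_cols_def cols_one_def list_all_iff)

context char_two
begin

lemma P_umod: "is_umod (P d :: 'k umod)" "mdim (P d :: 'k umod) = 8"
  "mact (P d) (um_gen g) = (spm 8 (P_cols d g) :: 'k mat)"
  unfolding P_def by (rule spmod_umod[OF sp_relations_P] mdim_spmod)+

lemma V_umod: "is_umod (V d :: 'k umod)" "mdim (V d :: 'k umod) = V_dim d"
  "mact (V d) (um_gen g) = (spm (V_dim d) (V_cols d g) :: 'k mat)"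
  unfolding V_def by (rule spmod_umod[OF sp_relations_V] mdim_spmod)+

lemma projective_P: "is_projective (P d :: 'k umod)"
  unfolding P_def by (rule P.projective)

lemma mact_P_words:
  assumes "bounded_cols 8 Y"
  shows "mact (P d) (um_words ws) * spm 8 Y = (spm 8 (words_cols (P_cols d) ws Y) :: 'k mat)"
    "bounded_cols 8 (words_cols (P_cols d) ws Y)"
  unfolding P_def by (rule mact_words[OF sp_relations_P assms])+

lemma mact_P_proj: "mact (P d) (um_words (P_proj d)) = (spm 8 (P_proj_cols d) :: 'k mat)"
  using mact_P_words(1)[OF bounded_cols_one, of d "P_proj d"] spm_eq[OF P_nil_data(4)[of d], of 8]
  by (simp add: spm_one mat_one_right umod_dims[OF P_umod(1)] P_umod(2))

text \<open>An endomorphism sends the generator into the image of the projector and therefore has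
  the form \<open>r + t N\<close> with the nilpotent \<open>N\<close> of \<open>P_nil\<close>. It is
  invertible if \<open>r\<close> is nonzero, and otherwise \<open>1 + t N\<close> is.\<close>

lemma local_P: "local_umod (P d :: 'k umod)"
proof -
  let ?v = "spm 8 [[P_top d]] :: 'k mat" and ?s = "spm 8 [[P_soc d]] :: 'k mat" and ?N = "spm 8 (P_nil d) :: 'k mat"
  have td: "P_top d < 8" "P_soc d < 8" "P_top d \<noteq> P_soc d" by (simp_all add: P_top_def P_soc_def)
  have len: "length (P_nil d) = 8" by (simp add: P_nil_def)
  have bd: "bounded_cols 8 (P_nil d)" using P_nil_data(1)[of d] by (simp add: sp_hom_def)
  have N: "umod_hom (P d) (P d) ?N" unfolding P_def by (rule spmod_hom[OF sp_relations_P sp_relations_P P_nil_data(1)])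
  have "?N * ?N = spm 8 (replicate 8 [])"
    using spm_mult[where 'a = 'k, of "P_nil d" "P_nil d" 8] spm_eq[OF P_nil_data(2), of 8] by (simp add: len bd)
  also have "\<dots> = 0\<^sub>m 8 8" by (rule eq_matI) (simp_all add: spm_def)
  finally have NN: "?N * ?N = 0\<^sub>m 8 8" .
  have Nv: "?N * ?v = ?s"
    using spm_mult[where 'a = 'k, of "P_nil d" "[[P_top d]]" 8] spm_eq[OF P_nil_data(3), of 8]
    by (simp add: len bounded_cols_def td)
  \<comment> \<open>The geometric series for the inverse of \<open>r + t N\<close> ends after two
    terms, as \<open>N * N = 0\<close>; its sign disappears in characteristic two.\<close>
  have inv: "((1 / r) \<cdot>\<^sub>m 1\<^sub>m 8 + (t / (r * r)) \<cdot>\<^sub>m ?N) * (r \<cdot>\<^sub>m 1\<^sub>m 8 + t \<cdot>\<^sub>m ?N) = 1\<^sub>m 8" if "r \<noteq> 0" for r t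
  proof -
    have "((1 / r) \<cdot>\<^sub>m 1\<^sub>m 8 + (t / (r * r)) \<cdot>\<^sub>m ?N) * (r \<cdot>\<^sub>m 1\<^sub>m 8 + t \<cdot>\<^sub>m ?N) =
        1\<^sub>m 8 + ((t / r) \<cdot>\<^sub>m ?N + (t / r) \<cdot>\<^sub>m ?N)"
      by (rule eq_matI, simp_all add: mat_ring mat_smult NN len that del: index_mult_mat(1),
        auto simp: field_simps that)
    then show ?thesis by (simp add: mat_self_add mat_ring len)
  qed
  have hom: "umod_hom (P d) (P d) (r \<cdot>\<^sub>m 1\<^sub>m 8 + t \<cdot>\<^sub>m ?N)" for r t
    using umod_hom_one[OF P_umod(1)[of d]]
    by (intro umod_hom_add[OF P_umod(1) P_umod(1)] umod_hom_smult[OF P_umod(1) P_umod(1)] N) (simp add: P_umod(2))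
  have form: "\<exists>r t. h = r \<cdot>\<^sub>m 1\<^sub>m 8 + t \<cdot>\<^sub>m ?N" if h: "umod_hom (P d) (P d) h" for h
  proof -
    define x where "x = h * ?v"
    have hd: "dim_row h = 8" "dim_col h = 8" using umod_hom_dims[OF h] by (simp_all add: P_umod)
    then have xd: "dim_row x = 8" "dim_col x = 1" by (simp_all add: x_def)
    \<comment> \<open>The projector fixes the generator and commutes with \<open>h\<close>, so it
      fixes \<open>x\<close> as well.\<close>
    have "mact (P d) (um_words (P_proj d)) * ?v = ?v"
      using mact_P_words(1)[of "[[P_top d]]" d "P_proj d"] spm_eq[OF P_cyclic_data(2)[of d], of 8]
      by (simp add: bounded_cols_def td)
    then have "h * (mact (P d) (um_words (P_proj d)) * ?v) = x" by (simp add: x_def)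
    moreover have "h * (mact (P d) (um_words (P_proj d)) * ?v) = mact (P d) (um_words (P_proj d)) * x"
      using mat_reassoc[OF umod_homD(3)[OF h], of "um_words (P_proj d)" ?v] 
      by (simp add: x_def mat_assoc hd umod_dims[OF P_umod(1)] P_umod(2))
    ultimately have "spm 8 (P_proj_cols d) * x = x" by (simp add: mact_P_proj)
    then have e: "x $$ (i, 0) = (\<Sum>j<8. spm 8 (P_proj_cols d) $$ (i, j) * x $$ (j, 0))" if "i < 8" for i
      using that xd index_mult_mat(1)[of i "spm 8 (P_proj_cols d)" 0 x]
      by (simp add: scalar_prod_def atLeast0LessThan P_proj_cols_def split: if_splits)
    have len: "length (P_proj_cols d) = 8" by (simp add: P_proj_cols_def)
    have c: "of_nat (count_list (P_proj_cols d ! j) i) = (if i = j \<and> (j = P_top d \<or> j = P_soc d) then 1 else 0 :: 'k)"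
      if "j < 8" for i j
      using that by (auto simp: P_proj_cols_def P_top_def P_soc_def less_Suc_eq numeral_eq_Suc)
    have "x $$ (i, 0) = (if i = P_top d \<or> i = P_soc d then x $$ (i, 0) else 0)" if i: "i < 8" for i
    proof -
      have "(\<Sum>j<8. spm 8 (P_proj_cols d) $$ (i, j) * x $$ (j, 0)) = 
          (\<Sum>j<8. (if i = j \<and> (j = P_top d \<or> j = P_soc d) then 1 else 0) * x $$ (j, 0))"
        using i by (intro sum.cong) (simp_all add: spm_def len c)
      also have "\<dots> = (if i = P_top d \<or> i = P_soc d then x $$ (i, 0) else 0)"
        using i by (subst sum_eq_single[where a = i]) auto
      finally show ?thesis using e[OF i] by simp
    qed
    then have "x $$ (i, 0) = 0" if "i < 8" "i \<noteq> P_top d" "i \<noteq> P_soc d" for i using that by metis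
    then have x: "x = x $$ (P_top d, 0) \<cdot>\<^sub>m ?v + x $$ (P_soc d, 0) \<cdot>\<^sub>m ?s"
      using td by (intro eq_matI) (auto simp: xd spm_def)
    let ?g = "x $$ (P_top d, 0) \<cdot>\<^sub>m 1\<^sub>m 8 + x $$ (P_soc d, 0) \<cdot>\<^sub>m ?N"
    have "?g * ?v = x"
      by (subst (3) x) (simp add: mat_ring mat_smult Nv \<open>length (P_nil d) = 8\<close>)
    then have "h = ?g"
      using P.hom_eqI[OF P_umod(1)[of d], of d h ?g, folded P_def, OF h hom] by (simp add: x_def)
    then show ?thesis by blast
  qed
  show ?thesis
    unfolding local_umod_def P_umod(2)
  proof (intro allI impI)
    fix f assume "umod_hom (P d :: 'k umod) (P d) f"
    then obtain r t where f: "f = r \<cdot>\<^sub>m 1\<^sub>m 8 + t \<cdot>\<^sub>m ?N" using form by blast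
    show "(\<exists>w. umod_hom (P d) (P d) w \<and> w * f = 1\<^sub>m 8) \<or> (\<exists>w. umod_hom (P d) (P d) w \<and> w * (1\<^sub>m 8 + f) = 1\<^sub>m 8)"
    proof (cases "r = 0")
      case True
      have "1\<^sub>m 8 + f = 1 \<cdot>\<^sub>m 1\<^sub>m 8 + t \<cdot>\<^sub>m ?N"
        unfolding f True by (rule eq_matI) (simp_all add: len)
      then have "((1 / 1) \<cdot>\<^sub>m 1\<^sub>m 8 + (t / (1 * 1)) \<cdot>\<^sub>m ?N) * (1\<^sub>m 8 + f) = 1\<^sub>m 8"
        using inv[of 1 t] by (simp only: one_neq_zero not_False_eq_True simp_thms)
      then show ?thesis using hom by blast
    next
      case False
      then have "((1 / r) \<cdot>\<^sub>m 1\<^sub>m 8 + (t / (r * r)) \<cdot>\<^sub>m ?N) * f = 1\<^sub>m 8"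
        unfolding f by (rule inv)
      then show ?thesis using hom by blast
    qed
  qed
qed

end

section \<open>Models of the syzygies\<close>

text \<open>\<open>X_cols d k\<close> (for \<open>k\<close> in \<open>{False, True}\<close>) are two cocycles representing a basis of
  \<open>Ext\<^sup>1(V d, V (\<not> d))\<close>; \<open>P d\<close> has the Loewy layers \<open>V d\<close>, \<open>V (\<not> d) \<oplus> V (\<not> d)\<close>, \<open>V d\<close>.\<close>

fun X_cols :: "bool \<Rightarrow> bool \<Rightarrow> gen \<Rightarrow> cols" where
  "X_cols False False Ga = [[0]]"
| "X_cols False True Gb = [[2]]"
| "X_cols True False Gb = [[0], [], []]"
| "X_cols True True Ga = [[], [], [0]]"
| "X_cols d k g = (if d then [[], [], []] else [[]])"

text \<open>Linear inclusions and projections of the Loewy layers of \<open>P d\<close>; the index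
  \<open>k\<close> of the middle maps numbers the two copies of \<open>V (\<not> d)\<close>. The
  projection to the top and the inclusion of the socle are homomorphisms, while the middle maps are
  so only up to the cocycles \<open>X_cols\<close>.\<close>

fun inc_top :: "bool \<Rightarrow> cols" where
  "inc_top False = [[0]]"
| "inc_top True = [[0], [1], [2]]"
fun inc_mid :: "bool \<Rightarrow> bool \<Rightarrow> cols" where
  "inc_mid False False = [[1], [2], [3]]"
| "inc_mid False True = [[4], [5], [6]]"
| "inc_mid True False = [[3]]"
| "inc_mid True True = [[4]]"
fun inc_soc :: "bool \<Rightarrow> cols" where
  "inc_soc False = [[7]]"
| "inc_soc True = [[5], [6], [7]]"
fun pr_top :: "bool \<Rightarrow> cols" where
  "pr_top False = [[0], [], [], [], [], [], [], []]"
| "pr_top True = [[0], [1], [2], [], [], [], [], []]"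
fun pr_mid :: "bool \<Rightarrow> bool \<Rightarrow> cols" where
  "pr_mid False False = [[], [0], [1], [2], [], [], [], []]"
| "pr_mid False True = [[], [], [], [], [0], [1], [2], []]"
| "pr_mid True False = [[], [], [], [0], [], [], [], []]"
| "pr_mid True True = [[], [], [], [], [0], [], [], []]"
fun pr_soc :: "bool \<Rightarrow> cols" where
  "pr_soc False = [[], [], [], [], [], [], [], [0]]"
| "pr_soc True = [[], [], [], [], [], [0], [1], [2]]"

definition iT :: "bool \<Rightarrow> 'k::field mat" where "iT d = spm 8 (inc_top d)"
definition iM :: "bool \<Rightarrow> bool \<Rightarrow> 'k::field mat" where "iM d k = spm 8 (inc_mid d k)"
definition iS :: "bool \<Rightarrow> 'k::field mat" where "iS d = spm 8 (inc_soc d)"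
definition pT :: "bool \<Rightarrow> 'k::field mat" where "pT d = spm (V_dim d) (pr_top d)"
definition pM :: "bool \<Rightarrow> bool \<Rightarrow> 'k::field mat" where "pM d k = spm (V_dim (\<not> d)) (pr_mid d k)"
definition pS :: "bool \<Rightarrow> 'k::field mat" where "pS d = spm (V_dim d) (pr_soc d)"
definition VM :: "bool \<Rightarrow> gen \<Rightarrow> 'k::field mat" where "VM d g = spm (V_dim d) (V_cols d g)"
definition PM :: "bool \<Rightarrow> gen \<Rightarrow> 'k::field mat" where "PM d g = spm 8 (P_cols d g)"
definition XM :: "bool \<Rightarrow> bool \<Rightarrow> gen \<Rightarrow> 'k::field mat" where "XM d k g = spm (V_dim (\<not> d)) (X_cols d k g)"

lemma block_dims:
  "length (inc_top d) = V_dim d" "length (inc_mid d k) = V_dim (\<not> d)" "length (inc_soc d) = V_dim d"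
  "length (pr_top d) = 8" "length (pr_mid d k) = 8" "length (pr_soc d) = 8"
  "length (V_cols d g) = V_dim d" "length (P_cols d g) = 8" "length (X_cols d k g) = V_dim d"
  by (cases d; cases k; cases g; simp add: V_dim_def)+

lemma block_dims_mat [simp]:
  "dim_row (iT d) = 8" "dim_col (iT d) = V_dim d" "dim_row (iM d k) = 8" "dim_col (iM d k) = V_dim (\<not> d)"
  "dim_row (iS d) = 8" "dim_col (iS d) = V_dim d" 
  "dim_row (pT d) = V_dim d" "dim_col (pT d) = 8" "dim_row (pM d k) = V_dim (\<not> d)" "dim_col (pM d k) = 8"
  "dim_row (pS d) = V_dim d" "dim_col (pS d) = 8" 
  "dim_row (VM d g) = V_dim d" "dim_col (VM d g) = V_dim d" "dim_row (PM d g) = 8" "dim_col (PM d g) = 8"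
  "dim_row (XM d k g) = V_dim (\<not> d)" "dim_col (XM d k g) = V_dim d"
  by (simp_all add: iT_def iM_def iS_def pT_def pM_def pS_def VM_def PM_def XM_def block_dims)

definition cols_zero :: "nat \<Rightarrow> cols" where "cols_zero n = replicate n []"

lemma spm_zero: "spm n (cols_zero m) = 0\<^sub>m n m"
  by (rule eq_matI) (simp_all add: spm_def cols_zero_def)

lemma block_data:
  fixes d k :: bool and g :: gen
  shows "cols_eq (cols_mult (pr_top d) (P_cols d g)) (cols_mult (V_cols d g) (pr_top d))"
    "cols_eq (cols_mult (pr_mid d k) (P_cols d g)) (cols_add (cols_mult (X_cols d k g) (pr_top d)) (cols_mult (V_cols (\<not> d) g) (pr_mid d k)))"
    "cols_eq (cols_mult (P_cols d g) (inc_mid d k)) (cols_add (cols_mult (inc_mid d k) (V_cols (\<not> d) g)) (cols_mult (inc_soc d) (X_cols (\<not> d) k g)))"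
    "cols_eq (cols_mult (P_cols d g) (inc_soc d)) (cols_mult (inc_soc d) (V_cols d g))"
    "cols_eq (cols_mult (pr_top d) (inc_top d)) (cols_one (V_dim d))"
    "cols_eq (cols_mult (pr_mid d k) (inc_mid d k)) (cols_one (V_dim (\<not> d)))"
    "cols_eq (cols_mult (pr_soc d) (inc_soc d)) (cols_one (V_dim d))"
    "cols_eq (cols_mult (pr_top d) (inc_mid d k)) (cols_zero (V_dim (\<not> d)))"
    "cols_eq (cols_mult (pr_top d) (inc_soc d)) (cols_zero (V_dim d))"
    "cols_eq (cols_mult (pr_mid d k) (inc_mid d (\<not> k))) (cols_zero (V_dim (\<not> d)))"
    "cols_eq (cols_mult (pr_mid d k) (inc_top d)) (cols_zero (V_dim d))"
    "cols_eq (cols_mult (pr_mid d k) (inc_soc d)) (cols_zero (V_dim d))"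
    "cols_eq (cols_mult (pr_soc d) (inc_mid d k)) (cols_zero (V_dim (\<not> d)))"
    "cols_eq (cols_mult (pr_soc d) (inc_top d)) (cols_zero (V_dim d))"
    "cols_eq (cols_add (cols_add (cols_mult (inc_top d) (pr_top d)) (cols_mult (inc_soc d) (pr_soc d)))
       (cols_add (cols_mult (inc_mid d False) (pr_mid d False)) (cols_mult (inc_mid d True) (pr_mid d True)))) (cols_one 8)"
    "bounded_cols 8 (inc_top d)" "bounded_cols 8 (inc_mid d k)" "bounded_cols 8 (inc_soc d)"
    "bounded_cols (V_dim d) (pr_top d)" "bounded_cols (V_dim (\<not> d)) (pr_mid d k)" "bounded_cols (V_dim d) (pr_soc d)"
    "bounded_cols (V_dim d) (V_cols d g)" "bounded_cols 8 (P_cols d g)" "bounded_cols (V_dim (\<not> d)) (X_cols d k g)"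
  by (cases d; cases k; cases g; simp; code_simp)+

context char_two
begin

lemma block_mat:
  "pT d * PM d g = VM d g * (pT d :: 'k mat)"
  "pM d k * PM d g = XM d k g * pT d + VM (\<not> d) g * (pM d k :: 'k mat)"
  "PM d g * iM d k = iM d k * VM (\<not> d) g + iS d * (XM (\<not> d) k g :: 'k mat)"
  "PM d g * iS d = iS d * (VM d g :: 'k mat)"
  "pT d * iT d = (1\<^sub>m (V_dim d) :: 'k mat)" "pM d k * iM d k = (1\<^sub>m (V_dim (\<not> d)) :: 'k mat)" "pS d * iS d = (1\<^sub>m (V_dim d) :: 'k mat)"
  "pT d * iM d k = (0\<^sub>m (V_dim d) (V_dim (\<not> d)) :: 'k mat)" "pT d * iS d = (0\<^sub>m (V_dim d) (V_dim d) :: 'k mat)"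
  "pM d k * iM d (\<not> k) = (0\<^sub>m (V_dim (\<not> d)) (V_dim (\<not> d)) :: 'k mat)" "pM d k * iT d = (0\<^sub>m (V_dim (\<not> d)) (V_dim d) :: 'k mat)"
  "pM d k * iS d = (0\<^sub>m (V_dim (\<not> d)) (V_dim d) :: 'k mat)" "pS d * iM d k = (0\<^sub>m (V_dim d) (V_dim (\<not> d)) :: 'k mat)"
  "pS d * iT d = (0\<^sub>m (V_dim d) (V_dim d) :: 'k mat)"
  "(iT d * pT d + iS d * pS d) + (iM d False * pM d False + iM d True * pM d True) = (1\<^sub>m 8 :: 'k mat)"
proof -
  have m: "spm n X * spm l Y = (spm n (cols_mult X Y) :: 'k mat)" if "length X = l" "bounded_cols l Y" for n X l Y
    using spm_mult[where 'a = 'k, of X Y n] that by simp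
  note defs = iT_def iM_def iS_def pT_def pM_def pS_def VM_def PM_def XM_def spm_one[symmetric] spm_zero[symmetric]
  note b = block_dims block_data(16-24) block_data(24)[of "\<not> d" for d, simplified]
  have c: "spm n X = (spm n Y :: 'k mat)" if "cols_eq X Y" for n X Y by (rule spm_eq[OF that])
  show "pT d * PM d g = VM d g * (pT d :: 'k mat)"
    "pM d k * PM d g = XM d k g * pT d + VM (\<not> d) g * (pM d k :: 'k mat)"
    "PM d g * iM d k = iM d k * VM (\<not> d) g + iS d * (XM (\<not> d) k g :: 'k mat)"
    "PM d g * iS d = iS d * (VM d g :: 'k mat)"
    "pT d * iT d = (1\<^sub>m (V_dim d) :: 'k mat)" "pM d k * iM d k = (1\<^sub>m (V_dim (\<not> d)) :: 'k mat)" "pS d * iS d = (1\<^sub>m (V_dim d) :: 'k mat)"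
    "pT d * iM d k = (0\<^sub>m (V_dim d) (V_dim (\<not> d)) :: 'k mat)" "pT d * iS d = (0\<^sub>m (V_dim d) (V_dim d) :: 'k mat)"
    "pM d k * iM d (\<not> k) = (0\<^sub>m (V_dim (\<not> d)) (V_dim (\<not> d)) :: 'k mat)" "pM d k * iT d = (0\<^sub>m (V_dim (\<not> d)) (V_dim d) :: 'k mat)"
    "pM d k * iS d = (0\<^sub>m (V_dim (\<not> d)) (V_dim d) :: 'k mat)" "pS d * iM d k = (0\<^sub>m (V_dim d) (V_dim (\<not> d)) :: 'k mat)"
    "pS d * iT d = (0\<^sub>m (V_dim d) (V_dim d) :: 'k mat)"
    "(iT d * pT d + iS d * pS d) + (iM d False * pM d False + iM d True * pM d True) = (1\<^sub>m 8 :: 'k mat)"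
    unfolding defs by (subst m, simp add: b, simp add: b,
      (simp add: m b spm_add)?, rule c, rule block_data)+
qed

end

text \<open>A surjection \<open>p\<close> can be cancelled on the right, so the defining relations
  descend from \<open>Q\<close> to the matrices \<open>\<rho>\<close>. In this way the modules
  \<open>KM\<close>, whose size varies, inherit them from copies of \<open>P d\<close>.\<close>

lemma umod_quotient:
  fixes \<rho> :: "gen \<Rightarrow> 'k::field mat"
  assumes Q: "is_umod Q" and \<rho>: "\<And>g. \<rho> g \<in> carrier_mat n n" and p: "p \<in> carrier_mat n (mdim Q)"
    and u: "u \<in> carrier_mat (mdim Q) n" "p * u = 1\<^sub>m n" and hom: "\<And>g. p * mact Q (um_gen g) = \<rho> g * p"
  shows "is_umod (umod_of n \<rho>)" "mact (umod_of n \<rho>) (um_gen g) = \<rho> g"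
proof -
  have \<rho>d: "dim_row (\<rho> g) = n" "dim_col (\<rho> g) = n" for g using \<rho>[of g] by auto
  note d = carrier_matD[OF p] carrier_matD[OF u(1)] \<rho>d umod_dims[OF Q]
  have epi: "X = Y" if "X * p = Y * p" "dim_row X = n" "dim_col X = n" "dim_row Y = n" "dim_col Y = n" for X Y :: "'k mat"
  proof -
    have "X * (p * u) = Y * (p * u)" using that d mat_assoc[of X p u] mat_assoc[of Y p u] by simp
    then show ?thesis using that by (simp add: u(2) mat_one_right)
  qed
  have step: "\<rho> g * (p * Z) = p * (mact Q (um_gen g) * Z)" if "dim_row Z = mdim Q" for g Z
    using that mat_reassoc[OF hom, of g Z] by (simp add: mat_assoc d)
  note r = mact_relations[OF Q]
  note s = mat_ring d step hom[symmetric]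
  have fold: "p * X + p * Y = p * (X + Y)" if "dim_row X = mdim Q" "dim_row Y = mdim Q" "dim_col X = dim_col Y" for X Y
    using that by (simp add: mat_distrib_left d)
  have "\<rho> Ga * \<rho> Gb + \<rho> Gb * \<rho> Ga = \<rho> Gc" "\<rho> Ga * \<rho> Gc + \<rho> Gc * \<rho> Ga = \<rho> Ga" 
    "\<rho> Gb * \<rho> Gc + \<rho> Gc * \<rho> Gb = \<rho> Gb" 
    "\<rho> Ga * (\<rho> Ga * (\<rho> Ga * \<rho> Ga)) = 0\<^sub>m n n" "\<rho> Gb * (\<rho> Gb * (\<rho> Gb * \<rho> Gb)) = 0\<^sub>m n n"
    "\<rho> Gc * \<rho> Gc + \<rho> Gc = 0\<^sub>m n n"
    by (rule epi; simp add: mat_assoc mat_distrib_right mat_zero_left d step hom[symmetric] fold r mat_zero_right)+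
  note * = is_umod_of_mact_relations[of \<rho>, OF \<rho> this]
  show "is_umod (umod_of n \<rho>)" "mact (umod_of n \<rho>) (um_gen g) = \<rho> g" by (rule *)+
qed

text \<open>The module with head \<open>n V_d\<close> and second layer \<open>m V_e\<close>, \<open>e \<noteq> d\<close>, in which the two cocycles act through
  \<open>A\<close> and \<open>B\<close>, matrices of size \<open>m \<times> n\<close>. It is the image of a representation of the Kronecker quiver.\<close>

definition KM_mat :: "bool \<Rightarrow> nat \<Rightarrow> nat \<Rightarrow> 'k::field mat \<Rightarrow> 'k mat \<Rightarrow> gen \<Rightarrow> 'k mat" where
  "KM_mat d n m A B g = (let N = n * V_dim d; M = m * V_dim (\<not> d) in
     inl N M * (kron (1\<^sub>m n) (VM d g) * prl N M) +
     (inr N M * ((kron A (XM d False g) + kron B (XM d True g)) * prl N M) +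
      inr N M * (kron (1\<^sub>m m) (VM (\<not> d) g) * prr N M)))"

definition KM :: "bool \<Rightarrow> nat \<Rightarrow> nat \<Rightarrow> 'k::field mat \<Rightarrow> 'k mat \<Rightarrow> 'k umod" where
  "KM d n m A B = umod_of (n * V_dim d + m * V_dim (\<not> d)) (KM_mat d n m A B)"

text \<open>The tops of the n copies of \<open>P d\<close> form the head. Their two middle layers
  are combined through \<open>A\<close> and \<open>B\<close>, and the socles go to zero.\<close>

definition KM_cover :: "bool \<Rightarrow> nat \<Rightarrow> nat \<Rightarrow> 'k::field mat \<Rightarrow> 'k mat \<Rightarrow> 'k mat" where
  "KM_cover d n m A B = (let N = n * V_dim d; M = m * V_dim (\<not> d) in
     inl N M * kron (1\<^sub>m n) (pT d) + inr N M * (kron A (pM d False) + kron B (pM d True)))"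

text \<open>Embeds the module with the opposite head: its head enters the middle layers of the
  copies of \<open>P d\<close> through \<open>A\<close> and \<open>B\<close>, and its second layer
  becomes the sum of the socles.\<close>

definition KM_kernel :: "bool \<Rightarrow> nat \<Rightarrow> nat \<Rightarrow> 'k::field mat \<Rightarrow> 'k mat \<Rightarrow> 'k mat" where
  "KM_kernel d n m A B = (let N = n * V_dim (\<not> d); M = m * V_dim d in
     (kron A (iM d False) + kron B (iM d True)) * prl N M + kron (1\<^sub>m m) (iS d) * prr N M)"

context char_two
begin

text \<open>The condition on \<open>S\<close> and \<open>T\<close> says that (A, B) maps a space of
  dimension 2n onto one of dimension m. This makes the cover onto, and \<open>umod_quotient\<close>
  applies to it.\<close>

lemma KM_umod:
  fixes A B :: "'k mat"
  assumes A: "A \<in> carrier_mat m n" and B: "B \<in> carrier_mat m n" 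
    and S: "S \<in> carrier_mat n m" and T: "T \<in> carrier_mat n m" and AS: "A * S + B * T = 1\<^sub>m m"
  shows "is_umod (KM d n m A B)" "mact (KM d n m A B) (um_gen g) = KM_mat d n m A B g"
    "mdim (KM d n m A B) = n * V_dim d + m * V_dim (\<not> d)"
    "umod_hom (copies n (P d)) (KM d n m A B) (KM_cover d n m A B)"
    "KM_cover d n m A B * (kron (1\<^sub>m n) (iT d) * prl (n * V_dim d) (m * V_dim (\<not> d)) + 
      (kron S (iM d False) + kron T (iM d True)) * prr (n * V_dim d) (m * V_dim (\<not> d))) = 1\<^sub>m (n * V_dim d + m * V_dim (\<not> d))"
proof -
  let ?N = "n * V_dim d" and ?M = "m * V_dim (\<not> d)"
  let ?p = "KM_cover d n m A B"
  let ?u = "kron (1\<^sub>m n) (iT d) * prl ?N ?M + (kron S (iM d False) + kron T (iM d True)) * prr ?N ?M"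
  note c = carrier_matD[OF A] carrier_matD[OF B] carrier_matD[OF S] carrier_matD[OF T]
  note ip = inj_proj[where 'k = 'k, of ?N ?M] inj_proj[where 'k = 'k, of ?N ?M, THEN mat_reassoc]
  note K = KM_mat_def[of d n m A B, unfolded Let_def] KM_cover_def[of d n m A B, unfolded Let_def]
  have Q: "is_umod (copies n (P d :: 'k umod))" by (rule is_umod_copies[OF P_umod(1)])
  have Qd: "mdim (copies n (P d :: 'k umod)) = n * 8" by (simp add: P_umod)
  have Qa: "mact (copies n (P d)) (um_gen g) = kron (1\<^sub>m n) (PM d g :: 'k mat)" for g
    by (simp add: mact_copies P_umod PM_def)
  have \<rho>: "KM_mat d n m A B g \<in> carrier_mat (?N + ?M) (?N + ?M)" for g
    unfolding K by (intro carrier_matI) (simp_all add: c)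
  have p: "?p \<in> carrier_mat (?N + ?M) (mdim (copies n (P d :: 'k umod)))"
    unfolding K Qd by (intro carrier_matI) (simp_all add: c)
  have u: "?u \<in> carrier_mat (mdim (copies n (P d :: 'k umod))) (?N + ?M)"
    unfolding Qd by (intro carrier_matI) (simp_all add: c)
  have Ak: "kron (A * S) (1\<^sub>m l) + kron (B * T) (1\<^sub>m l) = 1\<^sub>m (m * l)" for l
    using kron_add_left[of "A * S" "B * T" "1\<^sub>m l"] by (simp add: c AS kron_one)
  have "pM d False * iM d True = (0\<^sub>m (V_dim (\<not> d)) (V_dim (\<not> d)) :: 'k mat)" 
    "pM d True * iM d False = (0\<^sub>m (V_dim (\<not> d)) (V_dim (\<not> d)) :: 'k mat)"
    using block_mat(10)[of d False] block_mat(10)[of d True] by simp_all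
  note bm = this block_mat
  have Ak': "inr ?N ?M * (kron (A * S) (1\<^sub>m (V_dim (\<not> d))) * Z) + inr ?N ?M * (kron (B * T) (1\<^sub>m (V_dim (\<not> d))) * Z) = inr ?N ?M * Z"
    if "dim_row Z = ?M" for Z
    using that arg_cong[OF Ak[of "V_dim (\<not> d)"], of "\<lambda>X. inr ?N ?M * (X * Z)"]
    by (simp add: mat_distrib_left mat_distrib_right c mat_one_left)
  show pu: "?p * ?u = 1\<^sub>m (?N + ?M)"
    unfolding K using inj_proj_sum[where 'k = 'k, of ?N ?M]
    by (simp add: mat_ring c mat_reassoc[OF kron_mult] kron_mult bm kron_zero_right kron_one Ak')
  have hom: "?p * mact (copies n (P d)) (um_gen g) = KM_mat d n m A B g * ?p" for g
    unfolding K Qa by (simp add: mat_ring mat_ac c ip kron_mult bm kron_add_right)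
  note q = umod_quotient[OF Q \<rho> p u pu hom]
  show "is_umod (KM d n m A B)" "mact (KM d n m A B) (um_gen g) = KM_mat d n m A B g"
    unfolding KM_def by (rule q)+
  show dim: "mdim (KM d n m A B) = n * V_dim d + m * V_dim (\<not> d)" by (simp add: KM_def)
  show "umod_hom (copies n (P d)) (KM d n m A B) (KM_cover d n m A B)"
    by (rule umod_hom_genI) (use Q p q hom in \<open>simp_all add: KM_def\<close>)
qed

text \<open>By hypothesis (A', B') and (A, B) form a short exact sequence of spaces of dimensions l,
  2n, m with section (S, T) and retraction (U, U'). Tensored with the simple module it gives
  exactness in the middle layers; the tops and the socles of \<open>P d\<close> are matched
  bijectively with the head of the quotient and the second layer of the kernel.\<close>

lemma KM_ses:
  fixes A B A' B' :: "'k mat"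
  assumes A: "A \<in> carrier_mat m n" "B \<in> carrier_mat m n" "S \<in> carrier_mat n m" "T \<in> carrier_mat n m" "A * S + B * T = 1\<^sub>m m"
    and A': "A' \<in> carrier_mat n l" "B' \<in> carrier_mat n l" "S' \<in> carrier_mat l n" "T' \<in> carrier_mat l n" "A' * S' + B' * T' = 1\<^sub>m n"
    and U: "U \<in> carrier_mat l n" "U' \<in> carrier_mat l n" and 0: "A * A' + B * B' = 0\<^sub>m m l"
    and UA: "U * A' + U' * B' = 1\<^sub>m l"
    and h: "S * A + A' * U = 1\<^sub>m n" "S * B + A' * U' = 0\<^sub>m n n" "T * A + B' * U = 0\<^sub>m n n" "T * B + B' * U' = 1\<^sub>m n"
  shows "\<exists>u v. ses (KM (\<not> d) l n A' B') (copies n (P d)) (KM d n m A B) (KM_kernel d l n A' B') (KM_cover d n m A B) u v"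
proof -
  let ?N = "n * V_dim d" and ?M = "m * V_dim (\<not> d)" and ?N' = "l * V_dim (\<not> d)"
  let ?p = "KM_cover d n m A B" and ?e = "KM_kernel d l n A' B'"
  let ?u = "kron (1\<^sub>m n) (iT d) * prl ?N ?M + (kron S (iM d False) + kron T (iM d True)) * prr ?N ?M"
  let ?v = "inl ?N' ?N * (kron U (pM d False) + kron U' (pM d True)) + inr ?N' ?N * kron (1\<^sub>m n) (pS d)"
  note c = A(1-4)[THEN carrier_matD(1)] A(1-4)[THEN carrier_matD(2)] A'(1-4)[THEN carrier_matD(1)] A'(1-4)[THEN carrier_matD(2)]
    U[THEN carrier_matD(1)] U[THEN carrier_matD(2)]
  note ip = inj_proj[where 'k = 'k, of ?N ?M] inj_proj[where 'k = 'k, of ?N ?M, THEN mat_reassoc]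
    inj_proj[where 'k = 'k, of ?N' ?N] inj_proj[where 'k = 'k, of ?N' ?N, THEN mat_reassoc]
  note K = KM_umod[OF A, of d]
  note K' = KM_umod[OF A', of "\<not> d", unfolded not_not]
  note D = KM_mat_def[of "\<not> d" l n A' B', unfolded Let_def not_not] KM_cover_def[of d n m A B, unfolded Let_def] 
    KM_kernel_def[of d l n A' B', unfolded Let_def]
  have "pM d False * iM d True = (0\<^sub>m (V_dim (\<not> d)) (V_dim (\<not> d)) :: 'k mat)" 
    "pM d True * iM d False = (0\<^sub>m (V_dim (\<not> d)) (V_dim (\<not> d)) :: 'k mat)"
    using block_mat(10)[of d False] block_mat(10)[of d True] by simp_all
  note bm = this block_mat
  have Q: "is_umod (copies n (P d :: 'k umod))" by (rule is_umod_copies[OF P_umod(1)])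
  have Qd: "mdim (copies n (P d :: 'k umod)) = n * 8" by (simp add: P_umod)
  have Qa: "mact (copies n (P d)) (um_gen g) = kron (1\<^sub>m n) (PM d g :: 'k mat)" for g
    by (simp add: mact_copies P_umod PM_def)
  have e: "umod_hom (KM (\<not> d) l n A' B') (copies n (P d)) ?e"
  proof (rule umod_hom_genI[OF K'(1) Q])
    show "?e \<in> carrier_mat (mdim (copies n (P d :: 'k umod))) (mdim (KM (\<not> d) l n A' B'))"
      unfolding Qd K'(3) D by (intro carrier_matI) (simp_all add: c)
    show "?e * mact (KM (\<not> d) l n A' B') (um_gen g) = mact (copies n (P d)) (um_gen g) * ?e" for g
      unfolding Qa K'(2) D by (simp add: mat_ring mat_ac c ip kron_mult mat_reassoc[OF kron_mult] bm kron_add_right)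
  qed
  have vc: "?v \<in> carrier_mat (mdim (KM (\<not> d) l n A' B')) (mdim (copies n (P d :: 'k umod)))"
    unfolding Qd K'(3) by (intro carrier_matI) (simp_all add: c)
  have uc: "?u \<in> carrier_mat (mdim (copies n (P d :: 'k umod))) (mdim (KM d n m A B))"
    unfolding Qd K(3) by (intro carrier_matI) (simp_all add: c)
  have k0: "inr ?N ?M * (kron (A * A') X * Z) + inr ?N ?M * (kron (B * B') X * Z) = 0\<^sub>m (?N + ?M) (dim_col Z)"
    if "dim_row X = V_dim (\<not> d)" "dim_col X = V_dim (\<not> d)" "dim_row Z = ?N'" for X Z :: "'k mat"
  proof -
    have "kron (A * A') X + kron (B * B') X = 0\<^sub>m ?M ?N'"
      using kron_add_left[of "A * A'" "B * B'" X] that by (simp add: c 0 kron_zero_left)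
    from arg_cong[OF this, of "\<lambda>Y. inr ?N ?M * (Y * Z)"] show ?thesis using that
      by (simp add: mat_distrib_left mat_distrib_right c mat_zero_left mat_zero_right)
  qed
  have pe: "?p * ?e = 0\<^sub>m (mdim (KM d n m A B)) (mdim (KM (\<not> d) l n A' B'))"
    unfolding D K(3) K'(3)
    by (simp add: mat_ring mat_ac c ip kron_mult mat_reassoc[OF kron_mult] bm kron_zero_right k0)
  have k1: "inl ?N' ?N * (kron (U * A') (1\<^sub>m (V_dim (\<not> d))) * Z) + inl ?N' ?N * (kron (U' * B') (1\<^sub>m (V_dim (\<not> d))) * Z) = inl ?N' ?N * Z"
    if "dim_row Z = ?N'" for Z :: "'k mat"
  proof -
    have "kron (U * A') (1\<^sub>m (V_dim (\<not> d))) + kron (U' * B') (1\<^sub>m (V_dim (\<not> d))) = (1\<^sub>m ?N' :: 'k mat)"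
      using kron_add_left[of "U * A'" "U' * B'" "1\<^sub>m (V_dim (\<not> d))"] by (simp add: c UA kron_one)
    from arg_cong[OF this, of "\<lambda>Y. inl ?N' ?N * (Y * Z)"] show ?thesis using that
      by (simp add: mat_distrib_left mat_distrib_right c mat_one_left)
  qed
  have ve: "?v * ?e = 1\<^sub>m (mdim (KM (\<not> d) l n A' B'))"
    unfolding D K'(3) using inj_proj_sum[where 'k = 'k, of ?N' ?N]
    by (simp add: mat_ring mat_ac c ip kron_mult mat_reassoc[OF kron_mult] bm kron_zero_right kron_one k1)
  \<comment> \<open>After sorting by the products of a middle inclusion and a middle projection, the
    four coefficients are the left-hand sides of \<open>h\<close>.\<close>
  have up: "?u * ?p + ?e * ?v = 1\<^sub>m (mdim (copies n (P d :: 'k umod)))"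
  proof -
    let ?E = "\<lambda>k k'. iM d k * pM d k' :: 'k mat"
    have "?u * ?p + ?e * ?v = (kron (1\<^sub>m n) (iT d * pT d) + kron (1\<^sub>m n) (iS d * pS d)) +
       ((kron (S * A) (?E False False) + kron (A' * U) (?E False False)) + (kron (S * B) (?E False True) + kron (A' * U') (?E False True)) +
        ((kron (T * A) (?E True False) + kron (B' * U) (?E True False)) + (kron (T * B) (?E True True) + kron (B' * U') (?E True True))))"
      unfolding D by (simp add: mat_ring mat_ac c ip kron_mult mat_reassoc[OF kron_mult])
    also have "\<dots> = kron (1\<^sub>m n) (iT d * pT d + iS d * pS d) +
       (kron (S * A + A' * U) (?E False False) + kron (S * B + A' * U') (?E False True) +
       (kron (T * A + B' * U) (?E True False) + kron (T * B + B' * U') (?E True True)))"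
      by (simp add: kron_add_left kron_add_right c)
    also have "\<dots> = kron (1\<^sub>m n) ((iT d * pT d + iS d * pS d) + (?E False False + ?E True True))"
      unfolding h by (simp add: kron_zero_left mat_ring kron_add_right)
    finally show ?thesis unfolding Qd by (simp add: bm(17) kron_one)
  qed
  show ?thesis
    using K(1) K'(1) Q e K(4) uc vc K(5) ve pe up unfolding ses_def K(3)[symmetric] by blast
qed

end

section \<open>Preprojective Kronecker modules and their projective covers\<close>

definition shift_mat :: "nat \<Rightarrow> nat \<Rightarrow> nat \<Rightarrow> 'k::field mat" where
  "shift_mat r m n = mat m n (\<lambda>(i, j). if j = i + r then 1 else 0)"

definition corner_mat :: "nat \<Rightarrow> nat \<Rightarrow> 'k::field mat" where
  "corner_mat m n = mat m n (\<lambda>(i, j). if Suc i = m \<and> Suc j = n then 1 else 0)"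

lemma shift_mat_dims [simp]:
  "shift_mat r m n \<in> carrier_mat m n" "corner_mat m n \<in> carrier_mat m n"
  "dim_row (shift_mat r m n) = m" "dim_col (shift_mat r m n) = n"
  "dim_row (corner_mat m n) = m" "dim_col (corner_mat m n) = n"
  by (simp_all add: shift_mat_def corner_mat_def)

lemma shift_mat_mult:
  assumes "F \<in> carrier_mat n k"
  shows "shift_mat r m n * F = mat m k (\<lambda>(i, j). if i + r < n then F $$ (i + r, j) else 0)"
proof (rule eq_matI)
  fix i j assume "i < dim_row (mat m k (\<lambda>(i, j). if i + r < n then F $$ (i + r, j) else 0))"
    "j < dim_col (mat m k (\<lambda>(i, j). if i + r < n then F $$ (i + r, j) else 0))"
  then have ij: "i < m" "j < k" by simp_all
  have "(shift_mat r m n * F) $$ (i, j) = (\<Sum>l = 0..<n. (if l = i + r then 1 else 0) * F $$ (l, j))"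
    using ij assms by (auto simp: shift_mat_def scalar_prod_def intro!: sum.cong)
  also have "\<dots> = (if i + r < n then F $$ (i + r, j) else 0)"
    by (subst sum_eq_single[where a = "i + r"]) auto
  finally show "(shift_mat r m n * F) $$ (i, j) = mat m k (\<lambda>(i, j). if i + r < n then F $$ (i + r, j) else 0) $$ (i, j)"
    using ij by simp
qed (use assms in auto)

lemma corner_mat_mult:
  assumes "F \<in> carrier_mat n k"
  shows "corner_mat m n * F = mat m k (\<lambda>(i, j). if Suc i = m \<and> 0 < n then F $$ (n - 1, j) else 0)"
proof (rule eq_matI)
  fix i j assume "i < dim_row (mat m k (\<lambda>(i, j). if Suc i = m \<and> 0 < n then F $$ (n - 1, j) else 0))"
    "j < dim_col (mat m k (\<lambda>(i, j). if Suc i = m \<and> 0 < n then F $$ (n - 1, j) else 0))"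
  then have ij: "i < m" "j < k" by simp_all
  have "(corner_mat m n * F) $$ (i, j) = (\<Sum>l = 0..<n. (if Suc i = m \<and> Suc l = n then 1 else 0) * F $$ (l, j))"
    using ij assms by (auto simp: corner_mat_def scalar_prod_def intro!: sum.cong)
  also have "\<dots> = (if Suc i = m \<and> 0 < n then F $$ (n - 1, j) else 0)"
    by (subst sum_eq_single[where a = "n - 1"]) auto
  finally show "(corner_mat m n * F) $$ (i, j) = mat m k (\<lambda>(i, j). if Suc i = m \<and> 0 < n then F $$ (n - 1, j) else 0) $$ (i, j)"
    using ij by simp
qed (use assms in auto)

text \<open>\<open>KK s d\<close> is the \<open>s\<close>-th syzygy whose head is a multiple of \<open>V d\<close>; the two shifts of the
  preprojective Kronecker module exchange their roles with the parity of \<open>s\<close>.\<close>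

definition KK_arrow :: "nat \<Rightarrow> bool \<Rightarrow> 'k::field mat" where
  "KK_arrow s k = shift_mat (if odd s \<noteq> k then 1 else 0) s (Suc s)"

definition KK :: "nat \<Rightarrow> bool \<Rightarrow> 'k::field umod" where
  "KK s d = KM d (Suc s) s (KK_arrow s False) (KK_arrow s True)"

definition KK_cover :: "nat \<Rightarrow> bool \<Rightarrow> 'k::field mat" where
  "KK_cover s d = KM_cover d (Suc s) s (KK_arrow s False) (KK_arrow s True)"

definition KK_kernel :: "nat \<Rightarrow> bool \<Rightarrow> 'k::field mat" where
  "KK_kernel s d = KM_kernel d (Suc (Suc s)) (Suc s) (KK_arrow (Suc s) False) (KK_arrow (Suc s) True)"

text \<open>With \<open>x = a b\<close> this is \<open>x\<close> for \<open>P_0\<close> and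
  \<open>x + 1\<close> for \<open>P_1\<close>. It takes the generator of \<open>P d\<close> to the
  basis vector \<open>P_soc d\<close> and kills the latter.\<close>

definition P_rad :: "bool \<Rightarrow> gen list list" where
  "P_rad d = (if d then [[Ga, Gb], []] else [[Ga, Gb]])"

definition P_lift :: "bool \<Rightarrow> cols" where
  "P_lift d = (if d then [[], [1], []] else [[0]])"

lemma P_rad_data:
  "cols_eq (cols_mult (P_proj_cols d) (P_proj_cols d)) (P_proj_cols d)"
  "cols_eq (cols_mult (P_proj_cols d) (inc_mid d k)) (cols_zero (V_dim (\<not> d)))"
  "cols_eq (words_cols (P_cols d) (P_rad d) (cols_mult (P_proj_cols d) (inc_soc d))) (cols_zero (V_dim d))"
  "cols_eq (words_cols (P_cols d) (P_rad d) (cols_mult (P_proj_cols d) (P_lift d))) (cols_mult (P_proj_cols d) (inc_soc d))"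
  "bounded_cols 8 (P_proj_cols d)" "bounded_cols 8 (P_lift d)" "length (P_lift d) = V_dim d"
  "bounded_cols 8 (cols_mult (P_proj_cols d) (inc_soc d))" "bounded_cols 8 (cols_mult (P_proj_cols d) (P_lift d))"
  by (cases d; cases k; simp; code_simp)+

context char_two
begin

text \<open>Here \<open>a\<close> drops the last coordinate, \<open>b\<close> drops the first,
  \<open>t\<close> appends a zero, and \<open>z\<close> moves the last coordinate to the new last
  place. Dropping the first and dropping the last coordinate commute, whence
  \<open>a * b' = b * a'\<close>.\<close>

lemma KK_identities:
  fixes s :: nat
  defines "a \<equiv> shift_mat 0 s (Suc s) :: 'k mat" and "b \<equiv> shift_mat 1 s (Suc s)" and "t \<equiv> shift_mat 0 (Suc s) s"
    and "a' \<equiv> shift_mat 0 (Suc s) (Suc (Suc s))" and "b' \<equiv> shift_mat 1 (Suc s) (Suc (Suc s))" 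
    and "t' \<equiv> shift_mat 0 (Suc (Suc s)) (Suc s)" and "z \<equiv> corner_mat (Suc (Suc s)) (Suc s)"
  shows "a * t = 1\<^sub>m s" "a * b' = b * a'" "z * b' + t' * a' = 1\<^sub>m (Suc (Suc s))" 
    "t * a + b' * z = 1\<^sub>m (Suc s)" "t * b = b' * t'" "a' * z = 0\<^sub>m (Suc s) (Suc s)"
  unfolding a_def b_def t_def a'_def b'_def t'_def z_def
  by (simp_all add: shift_mat_mult[where k = s] shift_mat_mult[where k = "Suc s"] shift_mat_mult[where k = "Suc (Suc s)"]
        corner_mat_mult[where k = "Suc (Suc s)"])
    (rule eq_matI; auto simp: shift_mat_def corner_mat_def)+

lemma KK_splitting:
  obtains S T :: "'k mat" where "S \<in> carrier_mat (Suc s) s" "T \<in> carrier_mat (Suc s) s"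
    "KK_arrow s False * S + KK_arrow s True * T = 1\<^sub>m s"
proof (cases "odd s")
  case True
  show ?thesis
    by (rule that[of "0\<^sub>m (Suc s) s" "shift_mat 0 (Suc s) s"])
      (simp_all add: KK_arrow_def True KK_identities mat_ring)
next
  case False
  show ?thesis
    by (rule that[of "shift_mat 0 (Suc s) s" "0\<^sub>m (Suc s) s"])
      (simp_all add: KK_arrow_def False KK_identities mat_ring)
qed

lemma KK_umod:
  "is_umod (KK s d :: 'k umod)" "mdim (KK s d :: 'k umod) = Suc s * V_dim d + s * V_dim (\<not> d)"
  "mact (KK s d) (um_gen g) = (KM_mat d (Suc s) s (KK_arrow s False) (KK_arrow s True) g :: 'k mat)"
proof -
  obtain S T :: "'k mat" where "S \<in> carrier_mat (Suc s) s" "T \<in> carrier_mat (Suc s) s"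
    "KK_arrow s False * S + KK_arrow s True * T = 1\<^sub>m s" by (rule KK_splitting)
  note * = KM_umod[OF _ _ this, of d]
  show "is_umod (KK s d :: 'k umod)" "mdim (KK s d :: 'k umod) = Suc s * V_dim d + s * V_dim (\<not> d)"
    "mact (KK s d) (um_gen g) = (KM_mat d (Suc s) s (KK_arrow s False) (KK_arrow s True) g :: 'k mat)"
    unfolding KK_def by (rule *; simp add: KK_arrow_def)+
qed

text \<open>Since the shifts exchange their roles with the parity of \<open>s\<close>, the composite
  in \<open>KM_ses\<close> is \<open>a * b' + b * a'\<close> up to order, and vanishes in
  characteristic two. Appending a zero splits \<open>a\<close>; the corner matrix restores the last
  coordinate that is lost by this.\<close>

lemma KK_ses:
  "\<exists>u v. ses (KK (Suc s) (\<not> d)) (copies (Suc s) (P d)) (KK s d :: 'k umod) (KK_kernel s d) (KK_cover s d) u v"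
proof (cases "odd s")
  case True
  show ?thesis
    unfolding KK_def KK_kernel_def KK_cover_def
    by (rule KM_ses[where S = "0\<^sub>m (Suc s) s" and T = "shift_mat 0 (Suc s) s"
          and S' = "shift_mat 0 (Suc (Suc s)) (Suc s)" and T' = "0\<^sub>m (Suc (Suc s)) (Suc s)"
          and U = "shift_mat 0 (Suc (Suc s)) (Suc s)" and U' = "corner_mat (Suc (Suc s)) (Suc s)"])
      (simp_all add: KK_arrow_def True KK_identities mat_ring mat_ac mat_char2,
       simp_all add: KK_identities[of s, unfolded One_nat_def] KK_identities[of "Suc s", unfolded One_nat_def] mat_self_add mat_add_comm)
next
  case False
  show ?thesis
    unfolding KK_def KK_kernel_def KK_cover_def
    by (rule KM_ses[where S = "shift_mat 0 (Suc s) s" and T = "0\<^sub>m (Suc s) s"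
          and S' = "0\<^sub>m (Suc (Suc s)) (Suc s)" and T' = "shift_mat 0 (Suc (Suc s)) (Suc s)"
          and U = "corner_mat (Suc (Suc s)) (Suc s)" and U' = "shift_mat 0 (Suc (Suc s)) (Suc s)"])
      (simp_all add: KK_arrow_def False KK_identities mat_ring mat_ac mat_char2,
       simp_all add: KK_identities[of s, unfolded One_nat_def] KK_identities[of "Suc s", unfolded One_nat_def] mat_self_add mat_add_comm)
qed

text \<open>If \<open>z q = w + x\<close> with \<open>w\<close> in \<open>W\<close> and \<open>x\<close> in the kernel, then \<open>y z q = y z w\<close> lies in \<open>W\<close>. Hence so do
  \<open>z x\<close>, which is of the form \<open>y z r\<close>, and \<open>z q\<close>.\<close>

lemma superfluous_kerI:
  fixes Q K M :: "'k umod"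
  assumes s: "ses K Q M e p u v"
    and 1: "mact Q y * (mact Q z * e) = 0\<^sub>m (mdim Q) (mdim K)"
    and 2: "mact Q z * e = mact Q y * (mact Q z * R)" and R: "R \<in> carrier_mat (mdim Q) (mdim K)"
    and 3: "mact Q z * mact Q z = mact Q z"
    and 4: "\<And>W q. is_submod Q W \<Longrightarrow> (\<And>q. q \<in> carrier_vec (mdim Q) \<Longrightarrow> mact Q z *\<^sub>v q \<in> W) \<Longrightarrow> q \<in> carrier_vec (mdim Q) \<Longrightarrow> q \<in> W"
  shows "is_superfluous Q (ker_umod Q p)"
proof -
  note sd = sesD[OF s]
  note d = sd(10-17) umod_dims[OF sd(2)] carrier_matD[OF R]
  have c: "mact Q x *\<^sub>v w \<in> carrier_vec (mdim Q)" if "w \<in> carrier_vec (mdim Q)" for x w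
    by (rule mult_mat_vec_carrier[OF is_umodD(1)[OF sd(2)] that])
  have ker: "ker_umod Q p = range_umod K e" using ses_exact(3)[OF s] ..
  have sub: "is_submod Q (ker_umod Q p)" unfolding ker by (rule range_umod_submod[OF sd(1,2,4)])
  show ?thesis
    unfolding is_superfluous_def
  proof (intro conjI allI impI)
    fix W assume W: "is_submod Q W \<and> {w + u |w u. w \<in> W \<and> u \<in> ker_umod Q p} = carrier_vec (mdim Q)"
    then have Ws: "is_submod Q W" by simp
    have "mact Q z *\<^sub>v q \<in> W" if q: "q \<in> carrier_vec (mdim Q)" for q
    proof -
      have "mact Q z *\<^sub>v q \<in> {w + u |w u. w \<in> W \<and> u \<in> ker_umod Q p}" using W c[OF q, of z] by simp
      then obtain w x where wx: "w \<in> W" "x \<in> ker_umod Q p" "mact Q z *\<^sub>v q = w + x" by blast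
      then obtain x' where x': "x' \<in> carrier_vec (mdim K)" "x = e *\<^sub>v x'" unfolding ker range_umod_def by blast
      have wc: "w \<in> carrier_vec (mdim Q)" using wx(1) Ws by (auto simp: is_submod_def)
      have xc: "x \<in> carrier_vec (mdim Q)" using wx(2) by (auto simp: ker_umod_def)
      have zz: "mact Q z *\<^sub>v q = mact Q z *\<^sub>v w + mact Q z *\<^sub>v x"
      proof -
        have "mact Q z *\<^sub>v q = (mact Q z * mact Q z) *\<^sub>v q" by (simp add: 3)
        also have "\<dots> = mact Q z *\<^sub>v (w + x)" unfolding wx(3)[symmetric]
          using q by (intro mult_mat_vec_assoc) (simp_all add: d)
        also have "\<dots> = mact Q z *\<^sub>v w + mact Q z *\<^sub>v x"
          by (rule mult_add_distrib_mat_vec[OF is_umodD(1)[OF sd(2)] wc xc])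
        finally show ?thesis .
      qed
      have yz: "mact Q y *\<^sub>v (mact Q z *\<^sub>v r) \<in> W" if r: "r \<in> carrier_vec (mdim Q)" 
        and dec: "\<exists>w x x'. w \<in> W \<and> x' \<in> carrier_vec (mdim K) \<and> x = e *\<^sub>v x' \<and> r = w + x" for r
      proof -
        from dec obtain w x x' where *: "w \<in> W" "x' \<in> carrier_vec (mdim K)" "x = e *\<^sub>v x'" "r = w + x" by blast
        have wc: "w \<in> carrier_vec (mdim Q)" using *(1) Ws by (auto simp: is_submod_def)
        have xc: "x \<in> carrier_vec (mdim Q)" using *(2,3) umod_homD(4)[OF sd(4)] by simp
        have "mact Q y *\<^sub>v (mact Q z *\<^sub>v r) = mact Q y *\<^sub>v (mact Q z *\<^sub>v w) + mact Q y *\<^sub>v (mact Q z *\<^sub>v x)"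
          unfolding *(4) using mult_add_distrib_mat_vec[OF is_umodD(1)[OF sd(2)] wc xc, of z]
            mult_add_distrib_mat_vec[OF is_umodD(1)[OF sd(2)] c[OF wc] c[OF xc], of y z z] by simp
        also have "mact Q y *\<^sub>v (mact Q z *\<^sub>v x) = (mact Q y * (mact Q z * e)) *\<^sub>v x'"
          using *(2,3) by (simp add: mult_mat_vec_assoc d)
        also have "\<dots> = 0\<^sub>v (mdim Q)" unfolding 1 using *(2) by (intro eq_vecI) auto
        also have "mact Q y *\<^sub>v (mact Q z *\<^sub>v w) + 0\<^sub>v (mdim Q) = mact Q y *\<^sub>v (mact Q z *\<^sub>v w)"
          by (rule right_zero_vec[OF c[OF c[OF wc]]])
        finally show ?thesis using Ws *(1) by (auto simp: is_submod_def)
      qed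
      have Rx: "R *\<^sub>v x' \<in> carrier_vec (mdim Q)" by (rule mult_mat_vec_carrier[OF R x'(1)])
      then have "R *\<^sub>v x' \<in> {w + u |w u. w \<in> W \<and> u \<in> ker_umod Q p}" using W by simp
      then have "\<exists>w x x''. w \<in> W \<and> x'' \<in> carrier_vec (mdim K) \<and> x = e *\<^sub>v x'' \<and> R *\<^sub>v x' = w + x"
        unfolding ker range_umod_def by blast
      from yz[OF Rx this] have "mact Q y *\<^sub>v (mact Q z *\<^sub>v (R *\<^sub>v x')) \<in> W" .
      also have "mact Q y *\<^sub>v (mact Q z *\<^sub>v (R *\<^sub>v x')) = (mact Q y * (mact Q z * R)) *\<^sub>v x'"
        using x' by (simp add: mult_mat_vec_assoc d)
      also have "\<dots> = mact Q z *\<^sub>v x" unfolding 2[symmetric] using x' by (simp add: mult_mat_vec_assoc d)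
      finally have "mact Q z *\<^sub>v x \<in> W" .
      then show ?thesis unfolding zz using Ws wx(1) by (auto simp: is_submod_def)
    qed
    then have "carrier_vec (mdim Q) \<subseteq> W" using 4[OF Ws] by blast
    then show "W = carrier_vec (mdim Q)" using Ws by (auto simp: is_submod_def)
  qed (rule sub)
qed

text \<open>The words of \<open>P_words\<close> take the image of the projector to every basis
  vector. A vector is assembled one coordinate at a time: \<open>D m\<close> keeps the first m
  coordinates in each of the n summands, and the functional \<open>r m\<close> reads off the next
  one.\<close>

lemma copies_P_generated:
  assumes W: "is_submod (copies n (P d)) W" 
    and z: "\<And>q. q \<in> carrier_vec (n * 8) \<Longrightarrow> mact (copies n (P d)) (um_words (P_proj d)) *\<^sub>v q \<in> W"
    and q: "q \<in> carrier_vec (n * 8)"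
  shows "q \<in> (W :: 'k vec set)"
proof -
  let ?Q = "copies n (P d :: 'k umod)"
  have Q: "is_umod ?Q" by (rule is_umod_copies[OF P_umod(1)])
  have Qd: "mdim ?Q = n * 8" by (simp add: P_umod)
  have Qa: "mact ?Q x = kron (1\<^sub>m n) (mact (P d) x)" for x by (simp add: mact_copies P_umod)
  define D where "D m = mat 8 8 (\<lambda>(i, j). if i = j \<and> j < m then 1 else 0 :: 'k)" for m
  define r where "r m = mat 1 8 (\<lambda>(i, j). if j = m then 1 else 0 :: 'k)" for m
  have Dd: "dim_row (D m) = 8" "dim_col (D m) = 8" "dim_row (r m) = 1" "dim_col (r m) = 8" for m
    by (simp_all add: D_def r_def)
  have step: "D (Suc m) = D m + mact (P d) (um_words (P_words d ! m)) * (mact (P d) (um_words (P_proj d)) * (spm 8 [[P_top d]] * r m))"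
    if m: "m < 8" for m
  proof -
    have "mact (P d) (um_words (P_words d ! m)) * (mact (P d) (um_words (P_proj d)) * (spm 8 [[P_top d]] * r m)) =
      mact (P d) (um_words (P_words d ! m) * um_words (P_proj d)) * spm 8 [[P_top d]] * r m"
      by (simp add: is_umodD[OF P_umod(1)] P_umod(2) mat_assoc Dd)
    also have "\<dots> = spm 8 [[m]] * r m"
      using P.W_v[OF m, of d, folded P_def] by simp
    finally have e: "mact (P d) (um_words (P_words d ! m)) * (mact (P d) (um_words (P_proj d)) * (spm 8 [[P_top d]] * r m)) = spm 8 [[m]] * r m" .
    show ?thesis unfolding e
      by (rule eq_matI) (auto simp: D_def r_def spm_def scalar_prod_def)
  qed
  have "kron (1\<^sub>m n) (D m) *\<^sub>v q \<in> W" if "m \<le> 8" for m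
    using that
  proof (induction m)
    case 0
    have "D 0 = 0\<^sub>m 8 8" by (rule eq_matI) (simp_all add: D_def)
    then have "kron (1\<^sub>m n) (D 0) *\<^sub>v q = 0\<^sub>v (n * 8)" using q by (intro eq_vecI) (auto simp: kron_zero_right)
    then show ?case using W unfolding is_submod_def Qd by auto
  next
    case (Suc m)
    let ?F = "spm 8 [[P_top d]] * r m"
    have F: "kron (1\<^sub>m n) ?F *\<^sub>v q \<in> carrier_vec (n * 8)"
      by (rule mult_mat_vec_carrier[OF carrier_matI q]) (simp_all add: Dd)
    have "kron (1\<^sub>m n) (D (Suc m)) = kron (1\<^sub>m n) (D m) + mact ?Q (um_words (P_words d ! m)) * (mact ?Q (um_words (P_proj d)) * kron (1\<^sub>m n) ?F)"
      unfolding Qa using Suc.prems 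
      by (simp add: step kron_mult kron_add_right Dd umod_dims[OF P_umod(1)] P_umod(2) mat_one_left)
    then have "kron (1\<^sub>m n) (D (Suc m)) *\<^sub>v q = kron (1\<^sub>m n) (D m) *\<^sub>v q + 
        (mact ?Q (um_words (P_words d ! m)) * (mact ?Q (um_words (P_proj d)) * kron (1\<^sub>m n) ?F)) *\<^sub>v q"
      using q by (simp, intro add_mult_distrib_mat_vec[of _ "n * 8" "n * 8"])
        (auto simp: Dd umod_dims[OF Q] P_umod(2) intro!: carrier_matI)
    also have "(mact ?Q (um_words (P_words d ! m)) * (mact ?Q (um_words (P_proj d)) * kron (1\<^sub>m n) ?F)) *\<^sub>v q =
        mact ?Q (um_words (P_words d ! m)) *\<^sub>v (mact ?Q (um_words (P_proj d)) *\<^sub>v (kron (1\<^sub>m n) ?F *\<^sub>v q))"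
      using q by (simp add: mult_mat_vec_assoc Dd umod_dims[OF Q] Qd del: mdim_copies)
    finally show ?case using Suc W z[OF F] by (simp add: is_submod_def)
  qed
  from this[of 8] have "kron (1\<^sub>m n) (D 8) *\<^sub>v q \<in> W" by simp
  moreover have "D 8 = 1\<^sub>m 8" by (rule eq_matI) (auto simp: D_def)
  ultimately show ?thesis using q by (simp add: kron_one)
qed

lemma KK_proj_cover: "is_proj_cover (copies (Suc s) (P d)) (KK s d :: 'k umod) (KK_cover s d)"
proof -
  let ?n = "Suc s" and ?l = "Suc (Suc s)"
  let ?Q = "copies ?n (P d :: 'k umod)" and ?K = "KK (Suc s) (\<not> d) :: 'k umod"
  let ?A = "KK_arrow (Suc s) False :: 'k mat" and ?B = "KK_arrow (Suc s) True :: 'k mat"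
  obtain u v where s: "ses ?K ?Q (KK s d) (KK_kernel s d) (KK_cover s d) u v" using KK_ses by blast
  have Qa: "mact ?Q x = kron (1\<^sub>m ?n) (mact (P d) x)" for x using mact_copies[OF P_umod(1)] .
  have Qd: "mdim ?Q = ?n * 8" by (simp add: P_umod)
  have Kd: "mdim ?K = ?l * V_dim (\<not> d) + ?n * V_dim d" by (simp add: KK_umod)
  have Ad: "dim_row ?A = ?n" "dim_col ?A = ?l" "dim_row ?B = ?n" "dim_col ?B = ?l" by (simp_all add: KK_arrow_def)
  let ?Z = "mact (P d) (um_words (P_proj d)) :: 'k mat" and ?Y = "mact (P d) (um_words (P_rad d)) :: 'k mat"
  let ?L = "spm 8 (P_lift d) :: 'k mat"
  have len: "length (P_proj_cols d) = 8" by (simp add: P_proj_cols_def)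
  have m: "spm 8 (P_proj_cols d) * spm 8 X = (spm 8 (cols_mult (P_proj_cols d) X) :: 'k mat)" if "bounded_cols 8 X" for X
    using spm_mult[where 'a = 'k, of "P_proj_cols d" X 8] that by (simp add: len)
  note b = block_data(16-18) P_rad_data(5-9)
  have ZZ: "?Z * ?Z = ?Z" unfolding mact_P_proj using spm_eq[OF P_rad_data(1)] by (simp add: m b)
  have ZM: "?Z * iM d k = 0\<^sub>m 8 (V_dim (\<not> d))" for k
    unfolding mact_P_proj iM_def spm_zero[symmetric] using spm_eq[OF P_rad_data(2)] by (simp add: m b)
  have ZS: "?Y * (?Z * iS d) = 0\<^sub>m 8 (V_dim d)"
    unfolding mact_P_proj iS_def spm_zero[symmetric] using spm_eq[OF P_rad_data(3)] by (simp add: m b mact_P_words)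
  have ZL: "?Z * iS d = ?Y * (?Z * ?L)"
    unfolding mact_P_proj iS_def using spm_eq[OF P_rad_data(4)] by (simp add: m b mact_P_words)
  have Zd: "dim_row (mact (P d) x :: 'k mat) = 8" "dim_col (mact (P d) x :: 'k mat) = 8" for x
    using umod_dims[OF P_umod(1)] by (simp_all add: P_umod)
  have ker: "KK_kernel s d = (kron ?A (iM d False) + kron ?B (iM d True)) * prl (?l * V_dim (\<not> d)) (?n * V_dim d) + 
      kron (1\<^sub>m ?n) (iS d) * prr (?l * V_dim (\<not> d)) (?n * V_dim d)"
    unfolding KK_kernel_def KM_kernel_def Let_def ..
  have Ze: "mact ?Q (um_words (P_proj d)) * KK_kernel s d = kron (1\<^sub>m ?n) (?Z * iS d) * prr (?l * V_dim (\<not> d)) (?n * V_dim d)"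
    unfolding Qa ker
    by (simp add: mat_ring Zd Ad kron_mult mat_reassoc[OF kron_mult] ZM kron_zero_right del: mult_Suc)
  have "is_superfluous ?Q (ker_umod ?Q (KK_cover s d))"
  proof (rule superfluous_kerI[OF s])
    show "mact ?Q (um_words (P_rad d)) * (mact ?Q (um_words (P_proj d)) * KK_kernel s d) = 0\<^sub>m (mdim ?Q) (mdim ?K)"
      unfolding Ze unfolding Qa Qd Kd
      by (simp add: mat_ring Zd kron_mult mat_reassoc[OF kron_mult] ZS kron_zero_right del: mult_Suc)
    show "mact ?Q (um_words (P_proj d)) * KK_kernel s d = mact ?Q (um_words (P_rad d)) *
      (mact ?Q (um_words (P_proj d)) * (kron (1\<^sub>m ?n) ?L * prr (?l * V_dim (\<not> d)) (?n * V_dim d)))"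
      unfolding Ze unfolding Qa
      by (simp add: mat_ring Zd kron_mult mat_reassoc[OF kron_mult] ZL P_rad_data(7) del: mult_Suc)
    show "kron (1\<^sub>m ?n) ?L * prr (?l * V_dim (\<not> d)) (?n * V_dim d) \<in> carrier_mat (mdim ?Q) (mdim ?K)"
      unfolding Qd Kd by (intro carrier_matI) (simp_all add: P_rad_data(7))
    show "mact ?Q (um_words (P_proj d)) * mact ?Q (um_words (P_proj d)) = mact ?Q (um_words (P_proj d))"
      unfolding Qa by (simp add: kron_mult Zd ZZ mat_one_left)
    show "q \<in> W" if "is_submod ?Q W" "\<And>q. q \<in> carrier_vec (mdim ?Q) \<Longrightarrow> mact ?Q (um_words (P_proj d)) *\<^sub>v q \<in> W" "q \<in> carrier_vec (mdim ?Q)" for W q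
      using copies_P_generated[OF that(1)] that(2,3) unfolding Qd by blast
  qed
  then show ?thesis
    using projective_copies[OF projective_P] ses_exact(2)[OF s] KK_umod(1) by (simp add: is_proj_cover_def del: copies.simps)
qed

section \<open>Iterated syzygies of the simple modules\<close>

lemma ses_iso:
  fixes K Q M N :: "'k umod"
  assumes s: "ses K Q M e p u v" and i: "M \<cong>\<^sub>u N"
  shows "\<exists>p u. ses K Q N e p u v"
proof -
  from i obtain f g where fg: "is_umod M" "is_umod N" "umod_hom M N f" "umod_hom N M g"
    "g * f = 1\<^sub>m (mdim M)" "f * g = 1\<^sub>m (mdim N)" by (rule umod_isoE)
  note sd = sesD[OF s] 
  note d = sd(10-17) umod_hom_dims[OF fg(3)] umod_hom_dims[OF fg(4)]
  have "umod_hom Q N (f * p)" by (rule umod_hom_comp[OF sd(2,3) fg(2) sd(5) fg(3)])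
  then have "ses K Q N e (f * p) (u * g) v"
    unfolding ses_def using sd fg(2)
    by (auto simp: mat_ring d mat_reassoc[OF sd(6)] mat_reassoc[OF fg(5)] fg(6) intro!: carrier_matI)
  then show ?thesis by blast
qed

lemma proj_cover_transport:
  fixes M N Q K :: "'k umod"
  assumes c: "is_proj_cover Q M p" and s: "ses K Q M e p u v" and i: "M \<cong>\<^sub>u N"
  obtains p' u' where "is_proj_cover Q N p'" "ses K Q N e p' u' v"
proof -
  obtain p' u' where s': "ses K Q N e p' u' v" using ses_iso[OF s i] by blast
  have "ker_umod Q p' = ker_umod Q p" using ses_exact(3)[OF s] ses_exact(3)[OF s'] by simp
  then have "is_proj_cover Q N p'"
    using c ses_exact(2)[OF s'] sesD(3)[OF s'] by (simp add: is_proj_cover_def)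
  then show ?thesis using s' that by blast
qed

lemma Omega_KK:
  fixes M :: "'k umod"
  assumes "M \<cong>\<^sub>u KK s d"
  shows "Omega M \<cong>\<^sub>u KK (Suc s) (\<not> d)"
proof -
  obtain u v where s: "ses (KK (Suc s) (\<not> d)) (copies (Suc s) (P d)) (KK s d :: 'k umod) (KK_kernel s d) (KK_cover s d) u v"
    using KK_ses by blast
  show ?thesis
    using proj_cover_transport[OF KK_proj_cover s umod_iso_sym[OF assms]] Omega_iso by metis
qed

text \<open>Serves two purposes: tensored with \<open>P d\<close> the sequence splits, and for
  \<open>s = 0\<close> its kernel is zero, which identifies \<open>KK 0 d\<close>.\<close>

lemma KK_layers:
  "ses (copies s (V (\<not> d))) (KK s d) (copies (Suc s) (V d) :: 'k umod)
     (inr (Suc s * V_dim d) (s * V_dim (\<not> d))) (prl (Suc s * V_dim d) (s * V_dim (\<not> d)))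
     (inl (Suc s * V_dim d) (s * V_dim (\<not> d))) (prr (Suc s * V_dim d) (s * V_dim (\<not> d)))"
proof -
  let ?N = "Suc s * V_dim d" and ?M = "s * V_dim (\<not> d)"
  note ip = inj_proj[where 'k = 'k, of ?N ?M] inj_proj[where 'k = 'k, of ?N ?M, THEN mat_reassoc]
  have Va: "mact (copies n (V e)) (um_gen g) = kron (1\<^sub>m n) (VM e g :: 'k mat)" for n e g
    by (simp add: mact_copies V_umod VM_def)
  have Vd: "mdim (copies n (V e :: 'k umod)) = n * V_dim e" for n e by (simp add: V_umod)
  have U: "is_umod (copies n (V e :: 'k umod))" for n e by (rule is_umod_copies[OF V_umod(1)])
  have Ad: "dim_row (KK_arrow s k :: 'k mat) = s" "dim_col (KK_arrow s k :: 'k mat) = Suc s" for k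
    by (simp_all add: KK_arrow_def)
  have a: "mact (KK s d) (um_gen g) = inl ?N ?M * (kron (1\<^sub>m (Suc s)) (VM d g) * prl ?N ?M) +
     (inr ?N ?M * ((kron (KK_arrow s False) (XM d False g) + kron (KK_arrow s True) (XM d True g)) * prl ?N ?M) +
      inr ?N ?M * (kron (1\<^sub>m s) (VM (\<not> d) g) * (prr ?N ?M :: 'k mat)))" for g
    unfolding KK_umod KM_mat_def Let_def ..
  have e: "umod_hom (copies s (V (\<not> d))) (KK s d) (inr ?N ?M :: 'k mat)"
  proof (rule umod_hom_genI[OF U KK_umod(1)])
    show "inr ?N ?M \<in> carrier_mat (mdim (KK s d :: 'k umod)) (mdim (copies s (V (\<not> d) :: 'k umod)))"
      unfolding Vd KK_umod by (intro carrier_matI) (simp_all del: mult_Suc)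
    show "inr ?N ?M * mact (copies s (V (\<not> d))) (um_gen g) = mact (KK s d) (um_gen g) * (inr ?N ?M :: 'k mat)" for g
      unfolding a Va by (simp add: mat_ring Ad ip del: mult_Suc)
  qed
  have p: "umod_hom (KK s d) (copies (Suc s) (V d)) (prl ?N ?M :: 'k mat)"
  proof (rule umod_hom_genI[OF KK_umod(1) U])
    show "prl ?N ?M \<in> carrier_mat (mdim (copies (Suc s) (V d :: 'k umod))) (mdim (KK s d :: 'k umod))"
      unfolding Vd KK_umod by (intro carrier_matI) (simp_all del: mult_Suc)
    show "prl ?N ?M * mact (KK s d) (um_gen g) = mact (copies (Suc s) (V d)) (um_gen g) * (prl ?N ?M :: 'k mat)" for g
      unfolding a Va by (simp add: mat_ring Ad ip del: mult_Suc)
  qed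
  show ?thesis
    unfolding ses_def using U KK_umod(1) e p inj_proj_sum[where 'k = 'k, of ?N ?M]
    by (auto simp: Vd KK_umod(2) V_umod(2) ip simp del: mult_Suc copies.simps intro!: carrier_matI)
qed

lemma umod_iso_bijI:
  fixes M N :: "'k umod"
  assumes M: "is_umod M" and N: "is_umod N" and f: "umod_hom M N f" and g: "g \<in> carrier_mat (mdim M) (mdim N)"
    and gf: "g * f = 1\<^sub>m (mdim M)" and fg: "f * g = 1\<^sub>m (mdim N)"
  shows "M \<cong>\<^sub>u N"
proof (rule umod_isoI[OF M N f _ gf fg])
  note d = umod_hom_dims[OF f] carrier_matD[OF g] umod_dims[OF M] umod_dims[OF N]
  have "g * mact N x = mact M x * g" for x
  proof -
    have "g * mact N x = g * (mact N x * f) * g" by (simp add: mat_assoc d fg mat_one_right)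
    also have "\<dots> = (g * f) * mact M x * g" unfolding umod_homD(3)[OF f, symmetric] by (simp add: mat_assoc d)
    finally show ?thesis by (simp add: gf mat_one_left d)
  qed
  then show "umod_hom N M g" using g by (simp add: umod_hom_def)
qed

lemma KK_0: "KK 0 d \<cong>\<^sub>u (V d :: 'k umod)"
proof -
  note s = sesD[OF KK_layers[of 0 d]]
  \<comment> \<open>This product factors through a space of dimension zero.\<close>
  have "inr (Suc 0 * V_dim d) (0 * V_dim (\<not> d)) * prr (Suc 0 * V_dim d) (0 * V_dim (\<not> d)) = (0\<^sub>m (V_dim d) (V_dim d) :: 'k mat)"
    by (rule eq_matI) (simp_all add: scalar_prod_def)
  then have "inl (Suc 0 * V_dim d) (0 * V_dim (\<not> d)) * prl (Suc 0 * V_dim d) (0 * V_dim (\<not> d)) = (1\<^sub>m (mdim (KK 0 d :: 'k umod)) :: 'k mat)"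
    using s(9) by (simp add: KK_umod(2) mat_add_zero_right)
  then have "KK 0 d \<cong>\<^sub>u (copies (Suc 0) (V d) :: 'k umod)"
    by (rule umod_iso_bijI[OF s(2,3,5) carrier_matI[OF s(10,11)] _ s(6)])
  also have "\<dots> \<cong>\<^sub>u V d" by (simp add: dsum_zero_right V_umod)
  finally show ?thesis .
qed

lemma proj_cover_V: "proj_cover (V d) \<cong>\<^sub>u (P d :: 'k umod)"
proof -
  obtain u v where s: "ses (KK (Suc 0) (\<not> d)) (copies (Suc 0) (P d)) (KK 0 d :: 'k umod) (KK_kernel 0 d) (KK_cover 0 d) u v"
    using KK_ses by blast
  obtain p' where "is_proj_cover (copies (Suc 0) (P d)) (V d :: 'k umod) p'"
    using proj_cover_transport[OF KK_proj_cover s KK_0] by blast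
  then have "proj_cover (V d) \<cong>\<^sub>u (copies (Suc 0) (P d) :: 'k umod)" by (rule proj_cover_iso)
  also have "\<dots> \<cong>\<^sub>u P d" by (simp add: dsum_zero_right P_umod)
  finally show ?thesis .
qed

lemma Omega_iterate: "(Omega ^^ s) (V d) \<cong>\<^sub>u (KK s (odd s \<noteq> d) :: 'k umod)"
proof (induction s)
  case 0
  show ?case using umod_iso_sym[OF KK_0[of d]] by simp
next
  case (Suc s)
  have "(\<not> (odd s \<noteq> d)) = (odd (Suc s) \<noteq> d)" by auto
  then show ?case using Omega_KK[OF Suc] by simp
qed

end

section \<open>Tensor products of simple and projective modules\<close>

text \<open>The columns of these isomorphisms come from a computer search: a homomorphism from \<open>P d\<close> is given by an
  element fixed by the projector \<open>P_proj d\<close>.\<close>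

definition V1_V1_iso :: cols where
  "V1_V1_iso =
    [[2, 4, 6], [3], [2, 4], [7], [0], [8], [1, 3], [2, 6], [5, 7]]"

definition V1_V1_inv :: cols where
  "V1_V1_inv =
    [[4], [1, 6], [0, 2, 7], [1], [0, 7], [3, 8], [0, 2], [3], [5]]"

definition P0_V1_iso :: cols where
  "P0_V1_iso =
    [[4], [7, 9], [8], [3, 22], [11], [4, 6, 23], [5, 9], [8, 10], [0, 17, 21], [1, 3, 20], [2, 6,
    23], [14, 16, 18], [5, 7, 9], [21], [22], [23], [13], [16, 18], [17, 21], [12], [20, 22], [13,
    15], [14, 18], [17, 19, 21]]"

definition P0_V1_inv :: cols where
  "P0_V1_inv =
    [[8, 18], [3, 9, 20], [0, 5, 10], [3, 14], [0], [1, 12], [0, 5, 15], [6, 12], [2], [1, 6, 12],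
    [2, 7], [4], [19], [16], [11, 17], [16, 21], [11, 22], [13, 18], [11, 17, 22], [18, 23], [14,
    20], [13], [14], [15]]"

definition P1_V1_iso :: cols where
  "P1_V1_iso =
    [[2, 4, 6], [12, 20], [13, 23], [14], [9], [10, 15], [11, 18], [17, 19, 21], [3, 11, 16], [2,
    4, 17], [7], [0, 10, 15], [8, 13], [1, 3, 11], [2, 6, 17, 19], [5, 7, 12, 20, 22], [16], [19,
    21], [20], [15], [23], [16, 18], [17, 21], [20, 22]]"

definition P1_V1_inv :: cols where
  "P1_V1_inv =
    [[5, 11], [8, 13, 16], [0, 7, 9, 14, 22], [6, 8, 21], [0, 14, 17, 22], [1, 10, 15, 18, 23], [0,
    7, 9, 17], [10], [2, 12, 20], [4], [5, 19], [6, 16, 21], [1, 18], [2, 20], [3], [19], [16], [7,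
    17], [16, 21], [7, 22], [18], [7, 17, 22], [18, 23], [20]]"

lemma V1_V1_data:
  "sp_relations 9 (sp_tensor 3 (V_cols True) 3 (V_cols True))"
  "sp_relations 9 (sp_dsum 1 (V_cols False) (P_cols True))"
  "sp_hom 9 (sp_dsum 1 (V_cols False) (P_cols True)) 9 (sp_tensor 3 (V_cols True) 3 (V_cols True)) V1_V1_iso"
  "sp_hom 9 (sp_tensor 3 (V_cols True) 3 (V_cols True)) 9 (sp_dsum 1 (V_cols False) (P_cols True)) V1_V1_inv"
  "cols_eq (cols_mult V1_V1_inv V1_V1_iso) (cols_one 9)" "cols_eq (cols_mult V1_V1_iso V1_V1_inv) (cols_one 9)"
  by code_simp+

lemma P0_V1_data:
  "sp_relations 24 (sp_tensor 8 (P_cols False) 3 (V_cols True))"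
  "sp_relations 24 (sp_dsum 8 (P_cols True) (sp_dsum 8 (P_cols True) (P_cols True)))"
  "sp_hom 24 (sp_dsum 8 (P_cols True) (sp_dsum 8 (P_cols True) (P_cols True))) 24 (sp_tensor 8 (P_cols False) 3 (V_cols True)) P0_V1_iso"
  "sp_hom 24 (sp_tensor 8 (P_cols False) 3 (V_cols True)) 24 (sp_dsum 8 (P_cols True) (sp_dsum 8 (P_cols True) (P_cols True))) P0_V1_inv"
  "cols_eq (cols_mult P0_V1_inv P0_V1_iso) (cols_one 24)" "cols_eq (cols_mult P0_V1_iso P0_V1_inv) (cols_one 24)"
  by code_simp+

lemma P1_V1_data:
  "sp_relations 24 (sp_tensor 8 (P_cols True) 3 (V_cols True))"
  "sp_relations 24 (sp_dsum 8 (P_cols False) (sp_dsum 8 (P_cols True) (P_cols True)))"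
  "sp_hom 24 (sp_dsum 8 (P_cols False) (sp_dsum 8 (P_cols True) (P_cols True))) 24 (sp_tensor 8 (P_cols True) 3 (V_cols True)) P1_V1_iso"
  "sp_hom 24 (sp_tensor 8 (P_cols True) 3 (V_cols True)) 24 (sp_dsum 8 (P_cols False) (sp_dsum 8 (P_cols True) (P_cols True))) P1_V1_inv"
  "cols_eq (cols_mult P1_V1_inv P1_V1_iso) (cols_one 24)" "cols_eq (cols_mult P1_V1_iso P1_V1_inv) (cols_one 24)"
  by code_simp+

lemma sp_relations_PP: "sp_relations 16 (sp_dsum 8 (P_cols True) (P_cols True))"
  by code_simp

context char_two
begin

lemma V_eq_spmod: "V False = spmod 1 (V_cols False)" "V True = spmod 3 (V_cols True)"
  by (simp_all add: V_def V_dim_def)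

lemma V1_tensor_V1: "V True \<otimes>\<^sub>u V True \<cong>\<^sub>u (V False \<oplus>\<^sub>u P True :: 'k umod)"
proof -
  note V = sp_relations_V[of True, unfolded V_dim_def if_True] sp_relations_V[of False, unfolded V_dim_def if_False]
  have "V True \<otimes>\<^sub>u V True \<cong>\<^sub>u (spmod 9 (sp_tensor 3 (V_cols True) 3 (V_cols True)) :: 'k umod)"
    unfolding V_eq_spmod using spmod_tensor[OF V(1,1)] V1_V1_data(1) by simp
  also have "\<dots> \<cong>\<^sub>u spmod 9 (sp_dsum 1 (V_cols False) (P_cols True))"
    by (rule umod_iso_sym[OF spmod_iso]) (rule V1_V1_data)+
  also have "\<dots> \<cong>\<^sub>u V False \<oplus>\<^sub>u P True"
    unfolding V_eq_spmod P_def using umod_iso_sym[OF spmod_dsum[OF V(2) sp_relations_P]] V1_V1_data(2) by simp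
  finally show ?thesis .
qed

lemma spmod_three:
  assumes "sp_relations 24 (sp_dsum 8 (P_cols d) (sp_dsum 8 (P_cols True) (P_cols True)))"
  shows "(spmod 24 (sp_dsum 8 (P_cols d) (sp_dsum 8 (P_cols True) (P_cols True))) :: 'k umod) \<cong>\<^sub>u P d \<oplus>\<^sub>u (P True \<oplus>\<^sub>u P True)"
proof -
  have "spmod 24 (sp_dsum 8 (P_cols d) (sp_dsum 8 (P_cols True) (P_cols True))) \<cong>\<^sub>u
      (P d \<oplus>\<^sub>u spmod 16 (sp_dsum 8 (P_cols True) (P_cols True)) :: 'k umod)"
    unfolding P_def using umod_iso_sym[OF spmod_dsum[OF sp_relations_P sp_relations_PP]] assms by simp
  also have "\<dots> \<cong>\<^sub>u P d \<oplus>\<^sub>u (P True \<oplus>\<^sub>u P True)"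
    unfolding P_def using spmod_dsum[OF sp_relations_P[of True] sp_relations_P[of True]] sp_relations_PP
    by (intro dsum_cong umod_iso_refl spmod_umod sp_relations_P) (simp add: umod_iso_sym)
  finally show ?thesis .
qed

lemma P_tensor_V1: "P d \<otimes>\<^sub>u V True \<cong>\<^sub>u (P (\<not> d) \<oplus>\<^sub>u (P True \<oplus>\<^sub>u P True) :: 'k umod)"
proof -
  note V = sp_relations_V[of True, unfolded V_dim_def if_True]
  have "P d \<otimes>\<^sub>u V True \<cong>\<^sub>u (spmod 24 (sp_tensor 8 (P_cols d) 3 (V_cols True)) :: 'k umod)"
    unfolding V_eq_spmod P_def using spmod_tensor[OF sp_relations_P V, of d] P0_V1_data(1) P1_V1_data(1)
    by (cases d) simp_all
  also have "\<dots> \<cong>\<^sub>u spmod 24 (sp_dsum 8 (P_cols (\<not> d)) (sp_dsum 8 (P_cols True) (P_cols True)))"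
    using umod_iso_sym[OF spmod_iso[OF P0_V1_data(2,1,3-6)]] umod_iso_sym[OF spmod_iso[OF P1_V1_data(2,1,3-6)]]
    by (cases d) simp_all
  also have "\<dots> \<cong>\<^sub>u P (\<not> d) \<oplus>\<^sub>u (P True \<oplus>\<^sub>u P True)"
    by (rule spmod_three) (use P0_V1_data(2) P1_V1_data(2) in \<open>cases d; simp\<close>)
  finally show ?thesis .
qed

lemma umod_tensor_V0:
  fixes M :: "'k umod"
  assumes M: "is_umod M"
  shows "V False \<otimes>\<^sub>u M \<cong>\<^sub>u M"
proof (rule umod_iso_genI)
  have "spm (V_dim False) (V_cols False g) = (0\<^sub>m 1 1 :: 'k mat)" for g
    by (rule eq_matI) (simp_all add: spm_def V_dim_def)
  then show "mact (V False \<otimes>\<^sub>u M) (um_gen g) = mact M (um_gen g)" for g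
    unfolding tensor_umod(2)[OF V_umod(1) M] V_umod
    using kron_one_one_left[of "mact M (um_gen g)"]
    by (simp add: kron_zero_left V_dim_def mat_ring umod_dims[OF M])
qed (simp_all add: tensor_umod M V_umod V_dim_def)

section \<open>Multiplicities of the projective summands\<close>

text \<open>The counterpart of \<open>P_mod\<close> for the models \<open>P d\<close> in place of
  the chosen covers.\<close>

definition PP :: "nat \<Rightarrow> nat \<Rightarrow> 'k umod" where
  "PP m n = copies m (P False) \<oplus>\<^sub>u copies n (P True)"

lemma PP_umod: "is_umod (PP m n)"
  unfolding PP_def by (intro is_umod_dsum is_umod_copies P_umod)

lemma projective_PP: "is_projective (PP m n)"
  unfolding PP_def by (intro projective_dsum projective_copies projective_P)

lemma dsum_swap_middle:
  fixes A B C D :: "'k umod"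
  assumes u: "is_umod A" "is_umod B" "is_umod C" "is_umod D"
  shows "(A \<oplus>\<^sub>u B) \<oplus>\<^sub>u (C \<oplus>\<^sub>u D) \<cong>\<^sub>u (A \<oplus>\<^sub>u C) \<oplus>\<^sub>u (B \<oplus>\<^sub>u D)"
proof -
  note i = u is_umod_dsum umod_iso_refl
  have "(A \<oplus>\<^sub>u B) \<oplus>\<^sub>u (C \<oplus>\<^sub>u D) \<cong>\<^sub>u A \<oplus>\<^sub>u (B \<oplus>\<^sub>u (C \<oplus>\<^sub>u D))" by (intro dsum_assoc i)
  also have "\<dots> \<cong>\<^sub>u A \<oplus>\<^sub>u ((B \<oplus>\<^sub>u C) \<oplus>\<^sub>u D)" by (intro dsum_cong umod_iso_sym[OF dsum_assoc] i)
  also have "\<dots> \<cong>\<^sub>u A \<oplus>\<^sub>u ((C \<oplus>\<^sub>u B) \<oplus>\<^sub>u D)" by (intro dsum_cong dsum_comm i)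
  also have "\<dots> \<cong>\<^sub>u A \<oplus>\<^sub>u (C \<oplus>\<^sub>u (B \<oplus>\<^sub>u D))" by (intro dsum_cong dsum_assoc i)
  also have "\<dots> \<cong>\<^sub>u (A \<oplus>\<^sub>u C) \<oplus>\<^sub>u (B \<oplus>\<^sub>u D)" by (intro umod_iso_sym[OF dsum_assoc] i)
  finally show ?thesis .
qed

lemma PP_add: "PP m n \<oplus>\<^sub>u PP m' n' \<cong>\<^sub>u PP (m + m') (n + n')"
proof -
  have "PP m n \<oplus>\<^sub>u PP m' n' \<cong>\<^sub>u (copies m (P False) \<oplus>\<^sub>u copies m' (P False)) \<oplus>\<^sub>u (copies n (P True) \<oplus>\<^sub>u copies n' (P True))"
    unfolding PP_def by (intro dsum_swap_middle is_umod_copies P_umod)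
  also have "\<dots> \<cong>\<^sub>u PP (m + m') (n + n')"
    unfolding PP_def by (intro dsum_cong umod_iso_sym[OF copies_add] P_umod)
  finally show ?thesis .
qed

lemma PP_0: "zero_umod \<cong>\<^sub>u PP 0 0"
  unfolding PP_def using umod_iso_sym[OF dsum_zero_right[OF is_umod_zero]] by simp

lemma copies_PP: 
  assumes "M \<cong>\<^sub>u PP m n" shows "copies k M \<cong>\<^sub>u PP (k * m) (k * n)"
proof (induction k)
  case 0
  show ?case using PP_0 by simp
next
  case (Suc k)
  show ?case using umod_iso_trans[OF dsum_cong[OF assms Suc] PP_add] by simp
qed

lemma P_PP: "P d \<cong>\<^sub>u PP (if d then 0 else 1) (if d then 1 else 0)"
proof -
  have 1: "P e \<cong>\<^sub>u (copies 1 (P e) :: 'k umod)" for e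
    using umod_iso_sym[OF dsum_zero_right[OF P_umod(1)[of e]]] by simp
  show ?thesis
  proof (cases d)
    case True
    have "P True \<cong>\<^sub>u (zero_umod \<oplus>\<^sub>u copies 1 (P True) :: 'k umod)"
      using umod_iso_trans[OF 1 umod_iso_sym[OF dsum_zero_left]] is_umod_copies[OF P_umod(1)] by blast
    then show ?thesis using True by (simp add: PP_def)
  next
    case False
    have "P False \<cong>\<^sub>u (copies 1 (P False) \<oplus>\<^sub>u zero_umod :: 'k umod)"
      using umod_iso_trans[OF 1 umod_iso_sym[OF dsum_zero_right]] is_umod_copies[OF P_umod(1)] by blast
    then show ?thesis using False by (simp add: PP_def)
  qed
qed

lemma copies_cancel:
  fixes A B :: "'k umod"
  assumes "copies n (P d) \<oplus>\<^sub>u A \<cong>\<^sub>u copies n (P d) \<oplus>\<^sub>u B" "is_umod A" "is_umod B"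
  shows "A \<cong>\<^sub>u B"
  using assms(1)
proof (induction n)
  case 0
  then have "zero_umod \<oplus>\<^sub>u A \<cong>\<^sub>u zero_umod \<oplus>\<^sub>u B" by simp
  then show ?case
    using dsum_zero_left[OF assms(2)] dsum_zero_left[OF assms(3)] umod_iso_sym umod_iso_trans by blast
next
  case (Suc n)
  have c: "is_umod (copies n (P d :: 'k umod))" by (rule is_umod_copies[OF P_umod(1)])
  have "P d \<oplus>\<^sub>u (copies n (P d) \<oplus>\<^sub>u A) \<cong>\<^sub>u (P d \<oplus>\<^sub>u copies n (P d)) \<oplus>\<^sub>u A"
    by (rule umod_iso_sym[OF dsum_assoc[OF P_umod(1) c assms(2)]])
  also have "\<dots> \<cong>\<^sub>u (P d \<oplus>\<^sub>u copies n (P d)) \<oplus>\<^sub>u B" using Suc.prems by simp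
  also have "\<dots> \<cong>\<^sub>u P d \<oplus>\<^sub>u (copies n (P d) \<oplus>\<^sub>u B)" by (rule dsum_assoc[OF P_umod(1) c assms(3)])
  finally show ?case
    using Suc.IH dsum_cancel[OF _ local_P P_umod(1)] is_umod_dsum[OF c] assms(2,3) by blast
qed

lemma PP_cancel:
  fixes A B :: "'k umod"
  assumes "A \<oplus>\<^sub>u PP m n \<cong>\<^sub>u B \<oplus>\<^sub>u PP m n" "is_umod A" "is_umod B"
  shows "A \<cong>\<^sub>u B"
proof -
  let ?F = "copies m (P False) :: 'k umod" and ?T = "copies n (P True) :: 'k umod"
  have u: "is_umod ?F" "is_umod ?T" by (rule is_umod_copies[OF P_umod(1)])+
  have e: "C \<oplus>\<^sub>u PP m n \<cong>\<^sub>u ?F \<oplus>\<^sub>u (?T \<oplus>\<^sub>u C)" if C: "is_umod C" for C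
  proof -
    have "C \<oplus>\<^sub>u PP m n \<cong>\<^sub>u PP m n \<oplus>\<^sub>u C" by (rule dsum_comm[OF C PP_umod])
    also have "\<dots> \<cong>\<^sub>u ?F \<oplus>\<^sub>u (?T \<oplus>\<^sub>u C)" unfolding PP_def by (rule dsum_assoc[OF u C])
    finally show ?thesis .
  qed
  have "?F \<oplus>\<^sub>u (?T \<oplus>\<^sub>u A) \<cong>\<^sub>u ?F \<oplus>\<^sub>u (?T \<oplus>\<^sub>u B)"
    using umod_iso_trans[OF umod_iso_trans[OF umod_iso_sym[OF e[OF assms(2)]] assms(1)] e[OF assms(3)]] .
  from copies_cancel[OF this] have "?T \<oplus>\<^sub>u A \<cong>\<^sub>u ?T \<oplus>\<^sub>u B" using u assms by (blast intro: is_umod_dsum)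
  from copies_cancel[OF this assms(2,3)] show ?thesis .
qed

text \<open>The pair lists the multiplicities of \<open>P False\<close> and \<open>P True\<close> in
  \<open>P d \<otimes>\<^sub>u V e\<close>.\<close>

definition tensor_mult :: "bool \<Rightarrow> bool \<Rightarrow> nat \<times> nat" where
  "tensor_mult d e = (if e then if d then (1, 2) else (0, 3) else if d then (0, 1) else (1, 0))"

lemma P_tensor_V: "P d \<otimes>\<^sub>u V e \<cong>\<^sub>u PP (fst (tensor_mult d e)) (snd (tensor_mult d e))"
proof (cases e)
  case True
  have "P d \<otimes>\<^sub>u V True \<cong>\<^sub>u (P (\<not> d) \<oplus>\<^sub>u (P True \<oplus>\<^sub>u P True) :: 'k umod)" by (rule P_tensor_V1)
  also have "\<dots> \<cong>\<^sub>u PP (if \<not> d then 0 else 1) (if \<not> d then 1 else 0) \<oplus>\<^sub>u (PP 0 1 \<oplus>\<^sub>u PP 0 1)"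
    using P_PP[of True] by (intro dsum_cong P_PP) simp_all
  also have "\<dots> \<cong>\<^sub>u PP (if \<not> d then 0 else 1) (if \<not> d then 1 else 0) \<oplus>\<^sub>u PP (0 + 0) (1 + 1)"
    by (intro dsum_cong umod_iso_refl PP_umod PP_add)
  also have "\<dots> \<cong>\<^sub>u PP ((if \<not> d then 0 else 1) + (0 + 0)) ((if \<not> d then 1 else 0) + (1 + 1))"
    by (rule PP_add)
  finally show ?thesis using True by (cases d) (simp_all add: tensor_mult_def eval_nat_numeral)
next
  case False
  have "P d \<otimes>\<^sub>u V False \<cong>\<^sub>u (V False \<otimes>\<^sub>u P d :: 'k umod)" by (rule tensor_comm[OF P_umod(1) V_umod(1)])
  also have "\<dots> \<cong>\<^sub>u P d" by (rule umod_tensor_V0[OF P_umod(1)])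
  also have "\<dots> \<cong>\<^sub>u PP (if d then 0 else 1) (if d then 1 else 0)" by (rule P_PP)
  finally show ?thesis using False by (cases d) (simp_all add: tensor_mult_def)
qed

lemma P_tensor_KK:
  "P d \<otimes>\<^sub>u KK t e \<cong>\<^sub>u PP (t * fst (tensor_mult d (\<not> e)) + Suc t * fst (tensor_mult d e))
     (t * snd (tensor_mult d (\<not> e)) + Suc t * snd (tensor_mult d e))"
proof -
  have c: "P d \<otimes>\<^sub>u copies n (V f) \<cong>\<^sub>u PP (n * fst (tensor_mult d f)) (n * snd (tensor_mult d f))" for n f
    by (rule umod_iso_trans[OF tensor_copies[OF V_umod(1) P_umod(1)] copies_PP[OF P_tensor_V]])
  \<comment> \<open>By \<open>c\<close> the quotient of the tensored sequence is a sum of projective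
    modules, so the sequence splits.\<close>
  have "P d \<otimes>\<^sub>u KK t e \<cong>\<^sub>u P d \<otimes>\<^sub>u copies t (V (\<not> e)) \<oplus>\<^sub>u (P d \<otimes>\<^sub>u copies (Suc t) (V e) :: 'k umod)"
    by (rule ses_split[OF ses_tensor_right[OF KK_layers P_umod(1)] projective_iso[OF projective_PP umod_iso_sym[OF c]]])
  also have "\<dots> \<cong>\<^sub>u PP (t * fst (tensor_mult d (\<not> e))) (t * snd (tensor_mult d (\<not> e))) \<oplus>\<^sub>u
      PP (Suc t * fst (tensor_mult d e)) (Suc t * snd (tensor_mult d e))"
    by (rule dsum_cong[OF c c])
  also have "\<dots> \<cong>\<^sub>u PP (t * fst (tensor_mult d (\<not> e)) + Suc t * fst (tensor_mult d e))
     (t * snd (tensor_mult d (\<not> e)) + Suc t * snd (tensor_mult d e))"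
    by (rule PP_add)
  finally show ?thesis .
qed

section \<open>Comparison of resolutions and the induction\<close>

lemma ses_dsum:
  fixes K Q M R :: "'k umod"
  assumes s: "ses K Q M e p u v" and R: "is_umod R"
  shows "\<exists>e p u v. ses K (Q \<oplus>\<^sub>u R) (M \<oplus>\<^sub>u R) e p u v"
proof -
  note sd = sesD[OF s]
  let ?q = "mdim Q" and ?m = "mdim M" and ?r = "mdim R"
  note bq = biprodD[OF biprod_dsum[OF sd(2) R]] and bm = biprodD[OF biprod_dsum[OF sd(3) R]]
  note ip = inj_proj[where 'k = 'k, of ?q ?r] inj_proj[where 'k = 'k, of ?q ?r, THEN mat_reassoc]
    inj_proj[where 'k = 'k, of ?m ?r] inj_proj[where 'k = 'k, of ?m ?r, THEN mat_reassoc]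
  let ?e = "inl ?q ?r * e" and ?p = "inl ?m ?r * p * prl ?q ?r + inr ?m ?r * prr ?q ?r"
  let ?u = "inl ?q ?r * u * prl ?m ?r + inr ?q ?r * prr ?m ?r" and ?v = "v * prl ?q ?r"
  have e: "umod_hom K (Q \<oplus>\<^sub>u R) ?e" by (rule umod_hom_comp[OF sd(1,2) bq(1) sd(4) bq(4)])
  have "umod_hom (Q \<oplus>\<^sub>u R) (M \<oplus>\<^sub>u R) (inl ?m ?r * p * prl ?q ?r)"
    by (rule umod_hom_comp[OF bq(1) sd(2) bm(1) bq(6) umod_hom_comp[OF sd(2,3) bm(1) sd(5) bm(4)]])
  moreover have "umod_hom (Q \<oplus>\<^sub>u R) (M \<oplus>\<^sub>u R) (inr ?m ?r * prr ?q ?r)"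
    by (rule umod_hom_comp[OF bq(1) R bm(1) bq(7) bm(5)])
  ultimately have p: "umod_hom (Q \<oplus>\<^sub>u R) (M \<oplus>\<^sub>u R) ?p" by (rule umod_hom_add[OF bq(1) bm(1)])
  have "?u * ?p + ?e * ?v = inl ?q ?r * ((u * p + e * v) * prl ?q ?r) + inr ?q ?r * prr ?q ?r"
    by (simp add: mat_ring mat_ac sd(10-17) ip)
  also have "\<dots> = 1\<^sub>m (?q + ?r)" unfolding sd(9) using inj_proj_sum[where 'k = 'k, of ?q ?r] by (simp add: mat_ring)
  finally have up: "?u * ?p + ?e * ?v = 1\<^sub>m (?q + ?r)" .
  have "?p * ?u = 1\<^sub>m (?m + ?r)" using inj_proj_sum[where 'k = 'k, of ?m ?r]
    by (simp add: mat_ring sd(6,10-17) mat_reassoc[OF sd(6)] ip)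
  moreover have "?v * ?e = 1\<^sub>m (mdim K)" by (simp add: mat_ring sd(7,10-17) ip)
  moreover have "?p * ?e = 0\<^sub>m (?m + ?r) (mdim K)" by (simp add: mat_ring sd(8,10-17) ip)
  moreover have "?u \<in> carrier_mat (?q + ?r) (?m + ?r)" "?v \<in> carrier_mat (mdim K) (?q + ?r)"
    by (intro carrier_matI; simp add: sd(10-17))+
  ultimately have "ses K (Q \<oplus>\<^sub>u R) (M \<oplus>\<^sub>u R) ?e ?p ?u ?v"
    unfolding ses_def mdim_dsum using sd(1) bq(1) bm(1) e p up by blast
  then show ?thesis by blast
qed

text \<open>Schanuel's lemma for the resolution of \<open>KK s d\<close> tensored with \<open>X\<close> and the minimal one.\<close>

lemma KK_tensor_step:
  fixes X :: "'k umod"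
  assumes X: "is_umod X" and iso: "KK s d \<otimes>\<^sub>u X \<cong>\<^sub>u KK r f \<oplus>\<^sub>u PP m n"
    and Q: "P d \<otimes>\<^sub>u X \<cong>\<^sub>u PP a b"
    and eq: "Suc s * a = ((if f then 0 else Suc r) + m) + m'" "Suc s * b = ((if f then Suc r else 0) + n) + n'"
  shows "KK (Suc s) (\<not> d) \<otimes>\<^sub>u X \<cong>\<^sub>u KK (Suc r) (\<not> f) \<oplus>\<^sub>u PP m' n'"
proof -
  let ?Q = "copies (Suc s) (P d) \<otimes>\<^sub>u X" and ?R = "copies (Suc r) (P f) \<oplus>\<^sub>u PP m n"
  let ?K = "KK (Suc s) (\<not> d) \<otimes>\<^sub>u X" and ?L = "KK (Suc r) (\<not> f) :: 'k umod"
  let ?x = "(if f then 0 else Suc r) + m" and ?y = "(if f then Suc r else 0) + n"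
  have u: "is_umod ?K" "is_umod ?L" by (intro tensor_umod KK_umod X)+
  have "?Q \<cong>\<^sub>u copies (Suc s) (P d \<otimes>\<^sub>u X)" by (rule copies_tensor[OF P_umod(1) X])
  also have "\<dots> \<cong>\<^sub>u PP (?x + m') (?y + n')" using copies_PP[OF Q, of "Suc s"] unfolding eq .
  finally have Qi: "?Q \<cong>\<^sub>u PP (?x + m') (?y + n')" .
  have "copies (Suc r) (P f) \<cong>\<^sub>u PP (if f then 0 else Suc r) (if f then Suc r else 0)"
    using copies_PP[OF P_PP[of f], of "Suc r"] by (cases f) simp_all
  then have Ri: "?R \<cong>\<^sub>u PP ?x ?y"
    using umod_iso_trans[OF dsum_cong[OF _ umod_iso_refl[OF PP_umod]] PP_add] by blast
  obtain e1 p1 u1 v1 where s1: "ses ?K ?Q (KK s d \<otimes>\<^sub>u X) e1 p1 u1 v1"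
    using KK_ses ses_tensor_left[OF _ X] by blast
  have "\<exists>e p u v. ses ?L (copies (Suc r) (P f)) (KK r f) e p u v" using KK_ses by blast
  then have "\<exists>e p u v. ses ?L ?R (KK r f \<oplus>\<^sub>u PP m n) e p u v" using ses_dsum[OF _ PP_umod] by blast
  then obtain e2 p2 u2 v2 where s2: "ses ?L ?R (KK s d \<otimes>\<^sub>u X) e2 p2 u2 v2"
    using ses_iso[OF _ umod_iso_sym[OF iso]] by blast
  \<comment> \<open>By \<open>eq\<close>, \<open>?Q\<close> has the summands of \<open>?R\<close>,
    counted by \<open>?x\<close> and \<open>?y\<close>, and \<open>PP m' n'\<close> besides.
    Schanuel's lemma leaves the common part on both sides, where it cancels.\<close>
  have "?K \<oplus>\<^sub>u PP ?x ?y \<cong>\<^sub>u ?K \<oplus>\<^sub>u ?R" by (intro dsum_cong umod_iso_refl u umod_iso_sym[OF Ri])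
  also have "\<dots> \<cong>\<^sub>u ?L \<oplus>\<^sub>u ?Q"
    by (rule schanuel[OF s1 s2 projective_iso[OF projective_PP umod_iso_sym[OF Qi]]
          projective_iso[OF projective_PP umod_iso_sym[OF Ri]]])
  also have "\<dots> \<cong>\<^sub>u ?L \<oplus>\<^sub>u (PP ?x ?y \<oplus>\<^sub>u PP m' n')"
    by (intro dsum_cong umod_iso_refl u umod_iso_trans[OF Qi umod_iso_sym[OF PP_add]])
  also have "\<dots> \<cong>\<^sub>u ?L \<oplus>\<^sub>u (PP m' n' \<oplus>\<^sub>u PP ?x ?y)"
    by (intro dsum_cong umod_iso_refl u dsum_comm PP_umod)
  also have "\<dots> \<cong>\<^sub>u (?L \<oplus>\<^sub>u PP m' n') \<oplus>\<^sub>u PP ?x ?y"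
    by (intro umod_iso_sym[OF dsum_assoc] u PP_umod)
  finally show ?thesis by (rule PP_cancel) (intro u is_umod_dsum PP_umod)+
qed

text \<open>The multiplicities of \<open>P_0\<close> and \<open>P_1\<close> in the four cases of the
  theorem, with \<open>d\<close> for odd \<open>s + i\<close> and \<open>e\<close> for odd
  \<open>t + j\<close>.\<close>

definition KK_mult :: "nat \<Rightarrow> bool \<Rightarrow> nat \<Rightarrow> bool \<Rightarrow> nat \<times> nat" where
  "KK_mult s d t e = (if d then if e then (s * t, (s + 1) * (t + 1)) else (0, (2 * s + 1) * t)
     else if e then (0, s * (2 * t + 1)) else (s * t, s * t))"

text \<open>Induction on the first factor for both heads at once, because each step exchanges them.
  For \<open>d\<close> false it starts from \<open>V_0\<close> acting as a unit; the start for
  \<open>d\<close> true is a hypothesis, since it is the same problem with the factors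
  exchanged.\<close>

lemma KK_tensor_induct:
  fixes t :: nat and e :: bool
  defines "X \<equiv> KK t e :: 'k umod"
  assumes base: "KK 0 True \<otimes>\<^sub>u X \<cong>\<^sub>u KK t (\<not> e) \<oplus>\<^sub>u PP (fst (KK_mult 0 True t e)) (snd (KK_mult 0 True t e))"
  shows "KK s d \<otimes>\<^sub>u X \<cong>\<^sub>u KK (s + t) (d \<noteq> e) \<oplus>\<^sub>u PP (fst (KK_mult s d t e)) (snd (KK_mult s d t e))"
proof (induction s arbitrary: d)
  case 0
  have X: "is_umod X" unfolding X_def by (rule KK_umod)
  show ?case
  proof (cases d)
    case True
    then show ?thesis using base by simp
  next
    case False
    have "KK 0 False \<otimes>\<^sub>u X \<cong>\<^sub>u V False \<otimes>\<^sub>u X" by (rule tensor_cong[OF KK_0 umod_iso_refl[OF X]])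
    also have "\<dots> \<cong>\<^sub>u X" by (rule umod_tensor_V0[OF X])
    also have "\<dots> \<cong>\<^sub>u X \<oplus>\<^sub>u zero_umod" by (rule umod_iso_sym[OF dsum_zero_right[OF X]])
    also have "\<dots> \<cong>\<^sub>u X \<oplus>\<^sub>u PP 0 0" by (rule dsum_cong[OF umod_iso_refl[OF X] PP_0])
    finally show ?thesis using False by (cases e) (simp_all add: KK_mult_def X_def)
  qed
next
  case (Suc s)
  have X: "is_umod X" unfolding X_def by (rule KK_umod)
  note step = KK_tensor_step[OF X Suc[of "\<not> d"] P_tensor_KK[of "\<not> d" t e, folded X_def], of
    "fst (KK_mult (Suc s) d t e)" "snd (KK_mult (Suc s) d t e)", unfolded not_not]
  have "KK (Suc s) d \<otimes>\<^sub>u X \<cong>\<^sub>u KK (Suc (s + t)) ((\<not> d) = e) \<oplus>\<^sub>u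
      PP (fst (KK_mult (Suc s) d t e)) (snd (KK_mult (Suc s) d t e))"
    by (rule step; cases d; cases e; simp add: KK_mult_def tensor_mult_def algebra_simps)
  moreover have "((\<not> d) = e) = (d \<noteq> e)" by auto
  ultimately show ?case by (simp only: add_Suc)
qed

text \<open>\<open>KK_tensor_induct\<close> is used twice. With second factor
  \<open>KK 0 True\<close> it starts from the square of \<open>V_1\<close>; by commutativity the
  result is the missing start for an arbitrary second factor.\<close>

lemma KK_tensor:
  "KK s d \<otimes>\<^sub>u KK t e \<cong>\<^sub>u (KK (s + t) (d \<noteq> e) :: 'k umod) \<oplus>\<^sub>u
     PP (fst (KK_mult s d t e)) (snd (KK_mult s d t e))"
proof (rule KK_tensor_induct)
  have "KK 0 True \<otimes>\<^sub>u KK 0 True \<cong>\<^sub>u (V True \<otimes>\<^sub>u V True :: 'k umod)" by (rule tensor_cong[OF KK_0 KK_0])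
  also have "\<dots> \<cong>\<^sub>u V False \<oplus>\<^sub>u P True" by (rule V1_tensor_V1)
  also have "\<dots> \<cong>\<^sub>u KK 0 (\<not> True) \<oplus>\<^sub>u PP 0 1"
    using P_PP[of True] KK_0[of False] by (intro dsum_cong) (simp_all add: umod_iso_sym)
  finally have "KK t e \<otimes>\<^sub>u KK 0 True \<cong>\<^sub>u KK (t + 0) (e \<noteq> True) \<oplus>\<^sub>u
      PP (fst (KK_mult t e 0 True)) (snd (KK_mult t e 0 True))"
    by (intro KK_tensor_induct) (simp add: KK_mult_def)
  moreover have "KK_mult t e 0 True = KK_mult 0 True t e" by (simp add: KK_mult_def)
  moreover have "KK 0 True \<otimes>\<^sub>u KK t e \<cong>\<^sub>u (KK t e \<otimes>\<^sub>u KK 0 True :: 'k umod)"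
    by (rule tensor_comm[OF KK_umod(1) KK_umod(1)])
  ultimately show "KK 0 True \<otimes>\<^sub>u KK t e \<cong>\<^sub>u KK t (\<not> e) \<oplus>\<^sub>u
      PP (fst (KK_mult 0 True t e)) (snd (KK_mult 0 True t e))"
    using umod_iso_trans by simp
qed

lemma P_mod_PP: "P_mod m n \<cong>\<^sub>u PP m n"
  unfolding P_mod_def PP_def V_mod_eq_V
  using proj_cover_V[of False] proj_cover_V[of True] by (intro dsum_cong copies_cong) simp_all

lemma Omega_V_mod:
  assumes "i \<le> 2"
  shows "(Omega ^^ s) (V_mod i) \<cong>\<^sub>u (KK s (odd (s + i)) :: 'k umod)"
proof -
  \<comment> \<open>The index 2 occurs as \<open>i + j\<close> in the theorem; the convention
    \<open>V_2 = V_0\<close> makes parity decide there as well.\<close>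
  have "(i = 1) = odd i" using assms by (cases i rule: nat.exhaust; auto simp: le_Suc_eq numeral_2_eq_2)
  then have "(odd s \<noteq> (i = 1)) = odd (s + i)" by simp
  then show ?thesis using Omega_iterate[of s "i = 1"] unfolding V_mod_eq_V by simp
qed

end

theorem proposition4p7:
  fixes s t i j :: nat
  assumes "CHAR('k::alg_closed_field) = 2"
    and "i \<in> {0, 1}" and "j \<in> {0, 1}"
  shows "(Omega ^^ s) (V_mod i) \<otimes>\<^sub>u (Omega ^^ t) (V_mod j) \<cong>\<^sub>u
    (Omega ^^ (s + t)) (V_mod (i + j) :: 'k umod) \<oplus>\<^sub>u
      (if even (s + i) \<and> even (t + j) then P_mod (s * t) (s * t)
       else if even (s + i) \<and> odd (t + j) then P_mod 0 (s * (2 * t + 1))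
       else if odd (s + i) \<and> even (t + j) then P_mod 0 ((2 * s + 1) * t)
       else P_mod (s * t) ((s + 1) * (t + 1)))"
proof -
  interpret char_two "TYPE('k)" by unfold_locales (rule assms)
  let ?d = "odd (s + i)" and ?e = "odd (t + j)"
  let ?m = "fst (KK_mult s ?d t ?e)" and ?n = "snd (KK_mult s ?d t ?e)"
  have ij: "i \<le> 2" "j \<le> 2" "i + j \<le> 2" using assms(2,3) by auto
  have "(Omega ^^ s) (V_mod i) \<otimes>\<^sub>u (Omega ^^ t) (V_mod j) \<cong>\<^sub>u (KK s ?d \<otimes>\<^sub>u KK t ?e :: 'k umod)"
    by (intro tensor_cong Omega_V_mod ij)
  also have "\<dots> \<cong>\<^sub>u KK (s + t) (?d \<noteq> ?e) \<oplus>\<^sub>u PP ?m ?n" by (rule KK_tensor)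
  \<comment> \<open>The type of the head is the parity of the syzygy degree plus the index of the
    simple module, and these parities add.\<close>
  also have "(?d \<noteq> ?e) = odd (s + t + (i + j))" by auto
  also have "KK (s + t) (odd (s + t + (i + j))) \<oplus>\<^sub>u PP ?m ?n \<cong>\<^sub>u (Omega ^^ (s + t)) (V_mod (i + j)) \<oplus>\<^sub>u P_mod ?m ?n"
    by (intro dsum_cong umod_iso_sym[OF Omega_V_mod] umod_iso_sym[OF P_mod_PP] ij)
  also have "P_mod ?m ?n = (if even (s + i) \<and> even (t + j) then P_mod (s * t) (s * t)
       else if even (s + i) \<and> odd (t + j) then P_mod 0 (s * (2 * t + 1))
       else if odd (s + i) \<and> even (t + j) then P_mod 0 ((2 * s + 1) * t)
       else P_mod (s * t) ((s + 1) * (t + 1)) :: 'k umod)"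
    by (simp add: KK_mult_def)
  finally show ?thesis .
qed

end
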